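(* The boundary $\partial\mathcal{X}$ of the space $\mathcal{X}$ of similarity classes of pup tents contains a subset $\mathcal{G}$ of gracefully immersed pup tents, homeomorphic to the bi-cusped fundamental domain $\mathcal{F}$, such that $\Phi(\mathcal{G})=\mathcal{M}$, where $\mathcal{M}$ is the modular surface and $\Phi$ sends a gracefully immersed pup tent to the point of $\mathcal{M}$ representing its underlying flat torus.
   Context: A flat torus is a quotient $\mathbb{R}^2/\Lambda$ with $\Lambda$ a lattice of translations. A paper torus is a piecewise linear isometric embedding of a flat torus into $\mathbb{R}^3$; equivalently, an embedded topological torus in $\mathbb{R}^3$ made from finitely many triangles such that the cone angle (sum of the incident triangle angles) at each vertex is $2\pi$. Uniform triangulation: the triangulation $K$ of the torus with vertex set $\{0,\dots,7\}=\mathbb{Z}/8$ and the 16 triangles $\{a,a+1,a+3\}$ and $\{a,a+2,a+3\}$ (mod 8), $a\in\mathbb{Z}/8$. Orient $K$ so that each $(a,a+2,a+3)$ is positively oriented (and hence each $(a,a+3,a+1)$ is positively oriented). Pup tent: an 8-vertex paper torus triangulated by $K$, with vertices $p_0,\dots,p_7\in\mathbb{R}^3$ (each triangle of $K$ is mapped affinely onto the triangle with the corresponding vertices; the resulting map is injective; all cone angles are $2\pi$), such that: (i) it is invariant under $\rho(u,v,w)=(-u,-v,w)$, with $p_{7-j}=\rho(p_j)$ for all $j$; (ii) exactly 6 of the 16 triangles lie in the boundary of the convex hull of the torus, namely $\{1,2,7\},\{1,2,4\},\{2,4,5\},\{2,3,5\},\{3,5,6\},\{0,5,6\}$. The underlying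 flat torus of a pup tent is oriented by the orientation of $K$. $\mathcal{X}$ is the space of similarity classes of pup tents, viewed (via the vertex tuples $(p_0,\dots,p_7)$) inside the space of non-constant 8-tuples of points of $\mathbb{R}^3$ modulo similarities of $\mathbb{R}^3$, with the quotient topology. $\partial\mathcal{X}$ denotes the set of accumulation points of $\mathcal{X}$ in this space that do not lie in $\mathcal{X}$. Uniform distance: given maps $\phi_j:T_j\to\mathbb{R}^3$ ($j=1,2$) on oriented flat tori, it is the infimal $\epsilon$ such that there is a $(1+\epsilon)$-bilipschitz (orientation-preserving) map $\alpha:T_1\to T_2$ for which the $L_\infty$ distance from $\phi_1$ to $\phi_2\circ\alpha$ is at most $\epsilon$. Gracefully immersed pup tent: a piecewise linear isometric immersion $\phi:T\to\mathbb{R}^3$ of a flat torus $T$ (a piecewise linear map that preserves the lengths of paths; complete folds are allowed, so local injectivity is not required) that can be approximated arbitrarily closely by pup tents $\phi_n:T_n\to\mathbb{R}^3$ (uniform distance from $\phi_n$ to $\phi$ tending to $0$). It represents the point of $\overline{\mathcal{X}}$ given by the limit of the vertex tuples of such $\phi_n$. $\mathcal{M}=\mathbb{H}^2/SL_2(\mathbb{Z})$ is the modular surface ($\mathbb{H}^2$ the upper half plane, linear fractional action), parametrizing flat tori: $\mathbb{C}/(\mathbb{Z}L_1+\mathbb{Z}L_2)$ with $\mathrm{Im}(L_2/L_1)>0$ corresponds to the class of $L_2/L_1$. $\Phi$ sends a pup tent, or a gracefully immersed pup tent, to the point representing its (oriented) domain flat torus. The bi-cusped fundamental domain is $\mathcal{F}=\{x+iy: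 y>0,\ x\ge 0,\ 1-2x\ge 0,\ -2x+x^2+y^2\ge 0\}\subset\mathbb{H}^2$, the geodesic triangle with interior vertex $\tfrac12+\tfrac{\sqrt3}{2}i$ and cusps $0,\infty$. *)

theory Defs
  imports "HOL-Complex_Analysis.Complex_Analysis" "HOL-Library.Numeral_Type"
begin

section \<open>The triangulation\<close>

text \<open>
  The index type \<^typ>\<open>8\<close> is the ring of integers modulo 8, so all index arithmetic below is
  modulo 8. An element of \<^typ>\<open>real^3^8\<close> is a tuple of eight points of three-space.
\<close>

definition K :: "8 set set" where
  "K = (\<Union>a. {{a, a+1, a+3}, {a, a+2, a+3}})"

text \<open>
  The triangles of \<^term>\<open>K\<close> as positively ordered triples: all cyclic rotations of
  \<open>(a, a+2, a+3)\<close> and \<open>(a, a+3, a+1)\<close>.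
\<close>

definition positive_triples :: "(8 \<times> 8 \<times> 8) set" where
  "positive_triples = (\<Union>a.
     {(a, a+2, a+3), (a+2, a+3, a), (a+3, a, a+2),
      (a, a+3, a+1), (a+3, a+1, a), (a+1, a, a+3)})"

text \<open>Geometric realization of \<^term>\<open>K\<close>, in barycentric coordinates.\<close>

definition realization :: "(real^8) set" where
  "realization = (\<Union>t\<in>K. convex hull ((\<lambda>i. axis i 1) ` t))"

definition affine_extension :: "real^3^8 \<Rightarrow> real^8 \<Rightarrow> real^3" where
  "affine_extension p x = (\<Sum>i\<in>UNIV. x $ i *\<^sub>R p $ i)"

definition image_torus :: "real^3^8 \<Rightarrow> (real^3) set" where
  "image_torus p = affine_extension p ` realization"


section \<open>Pup tents\<close>

definition angle :: "'a::real_inner \<Rightarrow> 'a \<Rightarrow> 'a \<Rightarrow> real" where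
  "angle b a c = arccos (((b - a) \<bullet> (c - a)) / (norm (b - a) * norm (c - a)))"

text \<open>Every triangle at \<open>i\<close> occurs in exactly one positive triple with first entry \<open>i\<close>.\<close>

definition cone_angle :: "real^3^8 \<Rightarrow> 8 \<Rightarrow> real" where
  "cone_angle p i = (\<Sum>(j, k) \<in> {(j, k). (i, j, k) \<in> positive_triples}. angle (p $ j) (p $ i) (p $ k))"

definition \<rho> :: "real^3 \<Rightarrow> real^3" where
  "\<rho> v = vector [- v $ 1, - v $ 2, v $ 3]"

definition pup_tent :: "real^3^8 \<Rightarrow> bool" where
  "pup_tent p \<longleftrightarrow>
     inj_on (affine_extension p) realization \<and>
     (\<forall>i. cone_angle p i = 2 * pi) \<and>
     \<rho> ` image_torus p = image_torus p \<and>
     (\<forall>j. p $ (7 - j) = \<rho> (p $ j)) \<and>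
     {t \<in> K. convex hull ((\<lambda>i. p $ i) ` t) \<subseteq> frontier (convex hull (image_torus p))} =
       {{1,2,7}, {1,2,4}, {2,4,5}, {2,3,5}, {3,5,6}, {0,5,6}}"


section \<open>The space of similarity classes\<close>

definition similarity :: "(real^3 \<Rightarrow> real^3) \<Rightarrow> bool" where
  "similarity f \<longleftrightarrow> (\<exists>r>0. \<forall>x y. dist (f x) (f y) = r * dist x y)"

definition similarity_class :: "real^3^8 \<Rightarrow> (real^3^8) set" where
  "similarity_class p = {(\<chi> i. f (p $ i)) | f. similarity f}"

definition nonconstant_tuples :: "(real^3^8) set" where
  "nonconstant_tuples = {p. \<exists>i j. p $ i \<noteq> p $ j}"

definition similarity_space :: "(real^3^8) set topology" where
  "similarity_space = topology (\<lambda>U. U \<subseteq> similarity_class ` nonconstant_tuples \<and>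
     openin (top_of_set nonconstant_tuples) {p \<in> nonconstant_tuples. similarity_class p \<in> U})"

lemma openin_similarity_space:
  "openin similarity_space U \<longleftrightarrow> U \<subseteq> similarity_class ` nonconstant_tuples \<and>
     openin (top_of_set nonconstant_tuples) {p \<in> nonconstant_tuples. similarity_class p \<in> U}"
proof -
  let ?T = "top_of_set nonconstant_tuples"
  let ?pre = "\<lambda>U. {p \<in> nonconstant_tuples. similarity_class p \<in> U}"
  have "istopology (\<lambda>U. U \<subseteq> similarity_class ` nonconstant_tuples \<and> openin ?T (?pre U))"
    unfolding istopology_def
  proof (intro conjI allI impI; (elim conjE)?)
    fix S T
    assume "openin ?T (?pre S)" "openin ?T (?pre T)"
    then have "openin ?T (?pre S \<inter> ?pre T)" by (rule openin_Int)
    also have "?pre S \<inter> ?pre T = ?pre (S \<inter> T)" by blast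
    finally show "openin ?T (?pre (S \<inter> T))" .
  next
    fix \<U>
    assume *: "\<forall>U\<in>\<U>. U \<subseteq> similarity_class ` nonconstant_tuples \<and> openin ?T (?pre U)"
    then have "openin ?T (\<Union>U\<in>\<U>. ?pre U)" by (intro openin_Union) blast
    also have "(\<Union>U\<in>\<U>. ?pre U) = ?pre (\<Union>\<U>)" by blast
    finally show "openin ?T (?pre (\<Union>\<U>))" .
  qed blast+
  then show ?thesis
    unfolding similarity_space_def by (simp add: topology_inverse')
qed

lemma topspace_similarity_space: "topspace similarity_space = similarity_class ` nonconstant_tuples"
proof -
  have "{p \<in> nonconstant_tuples. similarity_class p \<in> similarity_class ` nonconstant_tuples}
          = nonconstant_tuples" by blast
  then have "openin similarity_space (similarity_class ` nonconstant_tuples)"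
    by (simp add: openin_similarity_space)
  moreover have "topspace similarity_space \<subseteq> similarity_class ` nonconstant_tuples"
    using openin_topspace openin_similarity_space by blast
  ultimately show ?thesis
    by (simp add: openin_subset subset_antisym)
qed

lemma quotient_map_similarity_space:
  "quotient_map (top_of_set nonconstant_tuples) similarity_space similarity_class"
  by (simp add: quotient_map_def topspace_similarity_space openin_similarity_space)

definition pup_tent_space :: "(real^3^8) set set" where
  "pup_tent_space = similarity_class ` {p. pup_tent p}"

definition pup_tent_boundary :: "(real^3^8) set set" where
  "pup_tent_boundary = similarity_space derived_set_of pup_tent_space - pup_tent_space"


section \<open>Flat tori\<close>

text \<open>
  An oriented flat torus is given by an oriented basis \<open>L = (L\<^sub>1, L\<^sub>2)\<close> of its lattice. Its points are
  the cosets of the lattice, its distance is the quotient distance \<^const>\<open>setdist\<close>, and its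
  orientation is that of the complex plane. Values of a function on cosets outside \<open>torus L\<close> are
  never used.
\<close>

type_synonym basis = "complex \<times> complex"

definition oriented_basis :: "basis \<Rightarrow> bool" where
  "oriented_basis L \<longleftrightarrow> Im (snd L / fst L) > 0"

definition torus_point :: "basis \<Rightarrow> complex \<Rightarrow> complex set" where
  "torus_point L z = {z + of_int m * fst L + of_int n * snd L | m n :: int. True}"

definition torus :: "basis \<Rightarrow> complex set set" where
  "torus L = range (torus_point L)"

definition torus_dist :: "complex set \<Rightarrow> complex set \<Rightarrow> real" where
  "torus_dist x y = setdist x y"

definition bilipschitz :: "real \<Rightarrow> basis \<Rightarrow> basis \<Rightarrow> (complex set \<Rightarrow> complex set) \<Rightarrow> bool" where
  "bilipschitz c L L' \<alpha> \<longleftrightarrow> bij_betw \<alpha> (torus L) (torus L') \<and>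
     (\<forall>x\<in>torus L. \<forall>y\<in>torus L.
        torus_dist x y / c \<le> torus_dist (\<alpha> x) (\<alpha> y) \<and> torus_dist (\<alpha> x) (\<alpha> y) \<le> c * torus_dist x y)"

text \<open>
  Only applied to homeomorphisms \<open>\<alpha>\<close>; then any continuous lift \<open>A\<close> is a homeomorphism of the plane, and
  the winding number below is its local degree at \<open>z\<close>.
\<close>

definition orientation_preserving :: "basis \<Rightarrow> basis \<Rightarrow> (complex set \<Rightarrow> complex set) \<Rightarrow> bool" where
  "orientation_preserving L L' \<alpha> \<longleftrightarrow>
     (\<exists>A. continuous_on UNIV A \<and> (\<forall>z. \<alpha> (torus_point L z) = torus_point L' (A z)) \<and>
          (\<forall>z. \<forall>r>0. winding_number (A \<circ> circlepath z r) (A z) = 1))"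

definition uniform_distance ::
    "basis \<Rightarrow> (complex set \<Rightarrow> real^3) \<Rightarrow> basis \<Rightarrow> (complex set \<Rightarrow> real^3) \<Rightarrow> ereal" where
  "uniform_distance L \<phi> L' \<phi>' = Inf {ereal \<epsilon> | \<epsilon>. 0 \<le> \<epsilon> \<and>
     (\<exists>\<alpha>. bilipschitz (1 + \<epsilon>) L L' \<alpha> \<and> orientation_preserving L L' \<alpha> \<and>
          (\<forall>x\<in>torus L. dist (\<phi> x) (\<phi>' (\<alpha> x)) \<le> \<epsilon>))}"


section \<open>Pup tents as maps, and gracefully immersed pup tents\<close>

text \<open>
  \<open>\<phi>\<close> is the pup tent with vertex tuple \<open>p\<close>, as a map from its underlying oriented flat torus: the
  inverse of the bijection \<open>g\<close> marks the torus by \<^term>\<open>K\<close>, so that every positive triangle of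
  \<^term>\<open>K\<close> corresponds affinely to (the projection of) a counterclockwise Euclidean triangle in the plane
  that is congruent to the triangle with vertices given by \<open>p\<close>.
\<close>

definition pup_tent_map :: "basis \<Rightarrow> (complex set \<Rightarrow> real^3) \<Rightarrow> real^3^8 \<Rightarrow> bool" where
  "pup_tent_map L \<phi> p \<longleftrightarrow> oriented_basis L \<and> pup_tent p \<and>
     (\<exists>g. bij_betw g realization (torus L) \<and>
        (\<forall>x\<in>realization. \<phi> (g x) = affine_extension p x) \<and>
        (\<forall>(i, j, k)\<in>positive_triples. \<exists>u v w.
           dist u v = dist (p $ i) (p $ j) \<and> dist v w = dist (p $ j) (p $ k) \<and>
           dist w u = dist (p $ k) (p $ i) \<and> Im (cnj (v - u) * (w - u)) > 0 \<and>
           (\<forall>a b c. 0 \<le> a \<and> 0 \<le> b \<and> 0 \<le> c \<and> a + b + c = 1 \<longrightarrow>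
              g (a *\<^sub>R axis i 1 + b *\<^sub>R axis j 1 + c *\<^sub>R axis k 1) =
                torus_point L (a *\<^sub>R u + b *\<^sub>R v + c *\<^sub>R w))))"

text \<open>
  Finitely many triangles cover the torus, and the map is affine on each; this forces continuity
  because the triangles are closed.
\<close>

definition piecewise_linear :: "basis \<Rightarrow> (complex set \<Rightarrow> real^3) \<Rightarrow> bool" where
  "piecewise_linear L \<phi> \<longleftrightarrow>
     (\<exists>\<T>. finite \<T> \<and> (\<forall>t\<in>\<T>. \<exists>a b c. t = convex hull {a, b, c}) \<and>
          torus L = torus_point L ` \<Union>\<T> \<and>
          (\<forall>t\<in>\<T>. \<exists>f d. linear f \<and> (\<forall>z\<in>t. \<phi> (torus_point L z) = f z + d)))"

definition path_length :: "(real \<Rightarrow> 'a::metric_space) \<Rightarrow> ereal" where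
  "path_length \<gamma> = (SUP ts \<in> {ts. sorted ts \<and> set ts \<subseteq> {0..1}}.
     ereal (\<Sum>i<length ts - 1. dist (\<gamma> (ts ! i)) (\<gamma> (ts ! Suc i))))"

text \<open>
  Every path in the torus is the projection of a path \<open>\<gamma>\<close> in the plane, of the same length.
\<close>

definition preserves_path_lengths :: "basis \<Rightarrow> (complex set \<Rightarrow> real^3) \<Rightarrow> bool" where
  "preserves_path_lengths L \<phi> \<longleftrightarrow>
     (\<forall>\<gamma>. path \<gamma> \<longrightarrow> path_length (\<phi> \<circ> torus_point L \<circ> \<gamma>) = path_length \<gamma>)"

definition pup_tents_approximate ::
    "(nat \<Rightarrow> basis) \<Rightarrow> (nat \<Rightarrow> complex set \<Rightarrow> real^3) \<Rightarrow> (nat \<Rightarrow> real^3^8) \<Rightarrow>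
     basis \<Rightarrow> (complex set \<Rightarrow> real^3) \<Rightarrow> bool" where
  "pup_tents_approximate Ls \<phi>s ps L \<phi> \<longleftrightarrow>
     (\<forall>n. pup_tent_map (Ls n) (\<phi>s n) (ps n)) \<and>
     (\<lambda>n. uniform_distance (Ls n) (\<phi>s n) L \<phi>) \<longlonglongrightarrow> 0"

definition gracefully_immersed :: "basis \<times> (complex set \<Rightarrow> real^3) \<Rightarrow> bool" where
  "gracefully_immersed = (\<lambda>(L, \<phi>). oriented_basis L \<and> piecewise_linear L \<phi> \<and>
     preserves_path_lengths L \<phi> \<and> (\<exists>Ls \<phi>s ps. pup_tents_approximate Ls \<phi>s ps L \<phi>))"

definition represents :: "basis \<times> (complex set \<Rightarrow> real^3) \<Rightarrow> (real^3^8) set \<Rightarrow> bool" where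
  "represents = (\<lambda>(L, \<phi>) X. \<exists>Ls \<phi>s ps p. pup_tents_approximate Ls \<phi>s ps L \<phi> \<and>
     ps \<longlonglongrightarrow> p \<and> X = similarity_class p)"


section \<open>The modular surface\<close>

definition upper_half_plane :: "complex set" where
  "upper_half_plane = {z. Im z > 0}"

definition modular_orbit :: "complex \<Rightarrow> complex set" where
  "modular_orbit z = {(of_int a * z + of_int b) / (of_int c * z + of_int d) |
     a b c d :: int. a * d - b * c = 1}"

definition modular_surface :: "complex set set" where
  "modular_surface = modular_orbit ` upper_half_plane"

definition \<Phi> :: "basis \<times> (complex set \<Rightarrow> real^3) \<Rightarrow> complex set" where
  "\<Phi> = (\<lambda>(L, \<phi>). modular_orbit (snd L / fst L))"

definition bicusped_domain :: "complex set" where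
  "bicusped_domain = {z. Im z > 0 \<and> Re z \<ge> 0 \<and> 1 - 2 * Re z \<ge> 0 \<and>
     - 2 * Re z + (Re z)\<^sup>2 + (Im z)\<^sup>2 \<ge> 0}"

end

theory Submission
  imports Defs
begin

text \<open>
  The points of \<open>G\<close> are degenerate tents, one for each \<open>\<tau> = e + i f\<close> in the bi-cusped domain: the six
  vertices 1, ..., 6 lie in a horizontal parallelogram, with 2 and 5 the midpoints of two opposite
  sides, and 0 and 7 span a ridge above it that is parallel to these sides. The four coordinates
  that describe such a tent are explicit functions of \<open>\<tau>\<close>, and \<open>\<tau>\<close> can be read off the ratios of
  three distances; this is the homeomorphism. The underlying torus has the periods 2 and \<open>2 \<tau>\<close>, and every
  orbit of the modular group meets the bi-cusped domain by the usual reduction of a lattice basis.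

  Whether a symmetric tuple is embedded and has the right convex hull depends only on the signs of
  the volumes of tetrahedra spanned by its vertices. That it is flat, with the prescribed torus as
  domain, follows once the planar triangles with the same edge lengths develop injectively, since
  then they tile the plane and the angles at each vertex add up to a full turn. To approximate a
  degenerate tent over an interior point, the walls and the floor are bent slightly. The conditions
  on the edge lengths are solved explicitly up to one scalar equation, which is solved by the
  intermediate value theorem; the volumes that vanish in the limit get the right signs to leading
  order. Points on the boundary of the domain are limits of interior ones.
\<close>

text \<open>Cone angles are sums of arccosines; starting from a development in the plane replaces
  them by polynomial equations between squared edge lengths, and the half-turn halves the unknowns.
  A degenerate tent fails to be a pup tent in two ways at once, its floor and its walls being flat,
  so it is perturbed on two scales. With the floor still flat (\<open>s = 0\<close>) the last
  equation is linear in the real part of \<open>\<tau>\<close> and is solved exactly; for small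
  \<open>w > 0\<close> the wall volumes are then nonzero. For that fixed \<open>w\<close>, any small
  enough \<open>s > 0\<close> keeps the wall signs and a sign change of the equation, while the
  floor signs depend only on the ratio 1 : -1 : 0 of the heights of the vertices 1, 2 and 3. The
  constant \<open>l\<close> adjusts the exact solution to the prescribed real part as
  \<open>w\<close> tends to 0. Over the boundary of the domain edges may collapse, and the
  development may cease to be injective. Only closed conditions are therefore carried to the limit:
  the length equations and the fact that the map from the plane to space does not increase
  distances.\<close>

lemma UNIV_8: "(UNIV :: 8 set) = {0, 1, 2, 3, 4, 5, 6, 7}"
proof -
  have "x \<in> {0, 1, 2, 3, 4, 5, 6, 7}" for x :: 8
  proof (cases x)
    case (of_int z)
    then have "z \<in> {0, 1, 2, 3, 4, 5, 6, 7}" by auto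
    with of_int show ?thesis by auto
  qed
  then show ?thesis by blast
qed

lemma sum_UNIV_8: "sum f (UNIV :: 8 set) = f 0 + f 1 + f 2 + f 3 + f 4 + f 5 + f 6 + f 7"
  unfolding UNIV_8 by (simp add: add.assoc)

lemma all_8: "(\<forall>i :: 8. P i) \<longleftrightarrow> P 0 \<and> P 1 \<and> P 2 \<and> P 3 \<and> P 4 \<and> P 5 \<and> P 6 \<and> P 7"
  by (metis UNIV_8 UNIV_I insert_iff empty_iff)

lemma mod_8: "(8::8) = 0" "(9::8) = 1" "(10::8) = 2"
  by simp_all

lemma K_eq: "K = {{0,1,3},{0,2,3},{1,2,4},{1,3,4},{2,3,5},{2,4,5},{3,4,6},{3,5,6},
   {4,5,7},{4,6,7},{0,5,6},{0,5,7},{1,6,7},{0,1,6},{0,2,7},{1,2,7}}"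
  unfolding K_def UNIV_8 by (simp add: mod_8 insert_commute)

section \<open>Barycentric coordinates\<close>

lemma convex_hull_axis_image:
  "convex hull ((\<lambda>i. axis i 1) ` t) =
     {x :: real^'n. (\<forall>i. 0 \<le> x $ i) \<and> (\<forall>i. i \<notin> t \<longrightarrow> x $ i = 0) \<and> sum (($) x) UNIV = 1}"
  (is "?H = ?S")
proof
  have "convex ?S"
    by (rule convexI) (auto simp: sum.distrib simp flip: sum_distrib_left)
  moreover have "(\<lambda>i. axis i 1) ` t \<subseteq> ?S"
    by (auto simp: axis_def)
  ultimately show "?H \<subseteq> ?S" by (rule hull_minimal[rotated])
next
  show "?S \<subseteq> ?H"
  proof
    fix x assume x: "x \<in> ?S"
    have x_eq: "x = (\<Sum>i\<in>t. x $ i *\<^sub>R axis i 1)"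
    proof -
      have "x = (\<Sum>i\<in>UNIV. x $ i *\<^sub>R axis i 1)"
        by (simp add: vec_eq_iff axis_def if_distrib cong: if_cong)
      also have "\<dots> = (\<Sum>i\<in>t. x $ i *\<^sub>R axis i 1)"
        using x by (intro sum.mono_neutral_right) auto
      finally show ?thesis .
    qed
    have "sum (($) x) t = 1"
      using x sum.mono_neutral_right[of UNIV t "($) x"] by auto
    then show "x \<in> ?H"
      by (subst x_eq, intro convex_sum) (use x in \<open>auto intro: hull_inc\<close>)
  qed
qed

lemma mem_realization_iff:
  "x \<in> realization \<longleftrightarrow>
     (\<exists>t\<in>K. (\<forall>i. 0 \<le> x $ i) \<and> (\<forall>i. i \<notin> t \<longrightarrow> x $ i = 0) \<and> sum (($) x) UNIV = 1)"
  unfolding realization_def convex_hull_axis_image by blast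

lemma linear_affine_extension: "linear (affine_extension p)"
  by (rule linearI) (simp_all add: affine_extension_def algebra_simps sum.distrib scaleR_sum_right)

lemma affine_extension_axis [simp]: "affine_extension p (axis i c) = c *\<^sub>R p $ i"
  by (simp add: affine_extension_def axis_def if_distrib[of "\<lambda>z. z *\<^sub>R _"] cong: if_cong)

lemma image_torus_eq: "image_torus p = (\<Union>t\<in>K. convex hull (($) p ` t))"
  unfolding image_torus_def realization_def image_UN
  by (simp add: convex_hull_linear_image[OF linear_affine_extension] image_image)

section \<open>Oriented volumes\<close>

text \<open>Six times the signed volume of the tetrahedron \<open>a\<close>, \<open>b\<close>,
  \<open>c\<close>, \<open>d\<close>. As a function of \<open>d\<close> it is affine and vanishes on
  the plane through the other three points, so its sign tells the side of that plane.\<close>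

definition orient :: "real^3 \<Rightarrow> real^3 \<Rightarrow> real^3 \<Rightarrow> real^3 \<Rightarrow> real" where
  "orient a b c d = cross3 (b - a) (c - a) \<bullet> (d - a)"

lemma cross3_dot:
  "cross3 x y \<bullet> z = (vec_nth x 2 * vec_nth y 3 - vec_nth x 3 * vec_nth y 2) * vec_nth z 1 + (vec_nth x 3 * vec_nth y 1 - vec_nth x 1 * vec_nth y 3) * vec_nth z 2 + (vec_nth x 1 * vec_nth y 2 - vec_nth x 2 * vec_nth y 1) * vec_nth z 3"
  by (simp add: cross3_def inner_vec_def sum_3)

lemma orient_expand:
  "orient a b c d =
     ((vec_nth b 2 - vec_nth a 2) * (vec_nth c 3 - vec_nth a 3) - (vec_nth b 3 - vec_nth a 3) * (vec_nth c 2 - vec_nth a 2)) * (vec_nth d 1 - vec_nth a 1) +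
     ((vec_nth b 3 - vec_nth a 3) * (vec_nth c 1 - vec_nth a 1) - (vec_nth b 1 - vec_nth a 1) * (vec_nth c 3 - vec_nth a 3)) * (vec_nth d 2 - vec_nth a 2) +
     ((vec_nth b 1 - vec_nth a 1) * (vec_nth c 2 - vec_nth a 2) - (vec_nth b 2 - vec_nth a 2) * (vec_nth c 1 - vec_nth a 1)) * (vec_nth d 3 - vec_nth a 3)"
  unfolding orient_def cross3_dot vector_minus_component by (rule refl)

lemma orient_swap:
  "orient b a c d = - orient a b c d"
  "orient a c b d = - orient a b c d"
  "orient a b d c = - orient a b c d"
  unfolding orient_expand by algebra+

lemma orient_degenerate:
  "orient a a c d = 0" "orient a b a d = 0" "orient a b c a = 0"
  "orient a b b d = 0" "orient a b c b = 0" "orient a b c c = 0"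
  unfolding orient_expand by algebra+

lemma \<rho>_nth [simp]: "\<rho> v $ 1 = - v $ 1" "\<rho> v $ 2 = - v $ 2" "\<rho> v $ 3 = v $ 3"
  by (simp_all add: \<rho>_def)

lemma orient_\<rho>: "orient (\<rho> a) (\<rho> b) (\<rho> c) (\<rho> d) = orient a b c d"
  unfolding orient_expand \<rho>_nth by algebra

lemma orient_affine_combination:
  assumes "sum x I = 1"
  shows "orient a b c (\<Sum>i\<in>I. x i *\<^sub>R q i) = (\<Sum>i\<in>I. x i * orient a b c (q i))"
proof -
  let ?n = "cross3 (b - a) (c - a)"
  have "(\<Sum>i\<in>I. x i * orient a b c (q i)) = (\<Sum>i\<in>I. x i * (?n \<bullet> q i)) - sum x I * (?n \<bullet> a)"
    by (simp add: orient_def inner_diff_right algebra_simps sum_subtractf sum_distrib_right sum_distrib_left)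
  then show ?thesis
    by (simp add: assms orient_def inner_diff_right inner_sum_right)
qed

lemma orient_nonzero_cross: "orient a b c d \<noteq> 0 \<Longrightarrow> cross3 (b - a) (c - a) \<noteq> 0"
  by (auto simp: orient_def)

text \<open>The cross product with one edge of a nondegenerate triangle isolates the weight of the
  other edge.\<close>

lemma affine_independent_weights:
  fixes x :: "'i::finite \<Rightarrow> real"
  assumes "cross3 (q b - q a) (q c - q a) \<noteq> 0"
    and "\<And>i. i \<notin> {a, b, c} \<Longrightarrow> x i = 0" and "sum x UNIV = 0"
    and "(\<Sum>i\<in>UNIV. x i *\<^sub>R q i) = 0"
  shows "x i = 0"
proof -
  have "b \<noteq> a" "c \<noteq> a" "b \<noteq> c" using assms(1) by (auto simp: cross_refl)
  have S: "sum f UNIV = f a + f b + f c" if "\<And>i. i \<notin> {a, b, c} \<Longrightarrow> f i = 0" for f :: "'i \<Rightarrow> 'v::comm_monoid_add"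
  proof -
    have "sum f UNIV = sum f {a, b, c}"
      using that by (intro sum.mono_neutral_right) auto
    then show ?thesis using \<open>b \<noteq> a\<close> \<open>c \<noteq> a\<close> \<open>b \<noteq> c\<close> by (simp add: add.assoc)
  qed
  have sum0: "x a + x b + x c = 0"
    using S[of x] assms(2,3) by simp
  have "x a *\<^sub>R q a + x b *\<^sub>R q b + x c *\<^sub>R q c = 0"
    using S[of "\<lambda>i. x i *\<^sub>R q i"] assms(2,4) by simp
  moreover have "x a = - x b - x c" using sum0 by simp
  ultimately have eq: "x b *\<^sub>R (q b - q a) + x c *\<^sub>R (q c - q a) = 0"
    by (simp add: algebra_simps)
  have "x b *\<^sub>R cross3 (q b - q a) (q c - q a) = cross3 (x b *\<^sub>R (q b - q a) + x c *\<^sub>R (q c - q a)) (q c - q a)"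
    by (simp add: cross_add_left cross_mult_left cross_refl)
  with eq assms(1) have "x b = 0" by simp
  have "x c *\<^sub>R cross3 (q b - q a) (q c - q a) = cross3 (q b - q a) (x b *\<^sub>R (q b - q a) + x c *\<^sub>R (q c - q a))"
    by (simp add: cross_add_right cross_mult_right cross_refl)
  with eq assms(1) have "x c = 0" by simp
  show ?thesis
    using \<open>x b = 0\<close> \<open>x c = 0\<close> sum0 assms(2)[of i] by (cases "i \<in> {a,b,c}") auto
qed

section \<open>Sign vectors of planes\<close>

text \<open>The indices are natural numbers because rewriting with \<open>vol_sort\<close> needs
  their order; it reduces each volume to the one with increasing indices, as in the tables.\<close>

definition vol :: "real^3^8 \<Rightarrow> nat \<Rightarrow> nat \<Rightarrow> nat \<Rightarrow> nat \<Rightarrow> real" where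
  "vol p a b c d = orient (p $ of_nat a) (p $ of_nat b) (p $ of_nat c) (p $ of_nat d)"

text \<open>
  Of two quadruples exchanged by the half-turn \<open>\<rho>\<close> only one is listed, and a few whose signs do not
  matter are omitted. These signs alone decide which triangles meet and which lie on the convex hull.
\<close>

definition quads :: "(nat \<times> nat \<times> nat \<times> nat \<times> int) list" where
  "quads = [(0,1,2,3,1),(0,1,2,4,1),(0,1,2,5,1),(0,1,2,6,1),(0,1,2,7,-1),(0,1,3,4,1),(0,1,3,5,1),(0,1,3,6,1),(0,1,3,7,-1),(0,1,4,6,-1),(0,1,4,7,1),(0,1,5,6,-1),(0,1,5,7,1),(0,1,6,7,1),(0,2,3,4,1),(0,2,3,5,1),(0,2,3,7,-1),(0,2,4,5,-1),(0,2,4,6,-1),(0,2,4,7,1),(0,2,5,6,-1),(0,2,5,7,1),(0,3,4,6,-1),(0,3,5,6,-1),(0,4,5,6,-1),(1,2,3,4,1),(1,2,3,5,1),(1,2,3,6,1),(1,2,4,5,-1),(1,2,4,6,-1),(1,3,4,5,1),(1,3,4,6,-1),(2,3,4,5,1)]"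

text \<open>In the language of oriented matroids, a prescribed part of the chirotope of the eight
  points.\<close>

definition pup_chirotope :: "real^3^8 \<Rightarrow> bool" where
  "pup_chirotope p \<longleftrightarrow> (\<forall>(a, b, c, d, s) \<in> set quads. sgn (vol p a b c d) = of_int s)"

lemma vol_sort:
  "b < a \<Longrightarrow> vol p a b c d = - vol p b a c d"
  "c < b \<Longrightarrow> vol p a b c d = - vol p a c b d"
  "d < c \<Longrightarrow> vol p a b c d = - vol p a b d c"
  unfolding vol_def by (rule orient_swap)+

lemma vol_degenerate:
  "vol p a a c d = 0" "vol p a b b d = 0" "vol p a b c c = 0"
  by (simp_all add: vol_def orient_degenerate)

locale pup_tuple =
  fixes p :: "real^3^8"
  assumes sym: "p $ (7 - j) = \<rho> (p $ j)"
    and chirotope: "pup_chirotope p"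
begin

text \<open>Reversing four indices is an even permutation, and \<open>\<rho>\<close> is a rotation.
  This recovers the quadruples that \<open>quads\<close> omits by symmetry.\<close>

lemma vol_reflect: "vol p (7 - d) (7 - c) (7 - b) (7 - a) = vol p a b c d"
  if "a \<le> 7" "b \<le> 7" "c \<le> 7" "d \<le> 7"
proof -
  have "vol p (7 - d) (7 - c) (7 - b) (7 - a) = vol p d c b a"
    using that by (simp add: vol_def of_nat_diff sym orient_\<rho>)
  also have "\<dots> = vol p a b c d"
    by (metis (no_types, lifting) orient_swap vol_def add.inverse_inverse)
  finally show ?thesis .
qed

lemma sgn_vol:
  "\<forall>(a, b, c, d, s) \<in> set quads. sgn (vol p a b c d) = of_int s \<and> sgn (vol p (7 - d) (7 - c) (7 - b) (7 - a)) = of_int s"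
proof -
  have "list_all (\<lambda>(a, b, c, d, s). a \<le> 7 \<and> b \<le> 7 \<and> c \<le> 7 \<and> d \<le> 7) quads"
    by (simp add: quads_def)
  then show ?thesis
    using chirotope vol_reflect unfolding pup_chirotope_def list_all_iff by fastforce
qed

lemmas sgn_vols = sgn_vol[unfolded quads_def, simplified]

end

definition plane_signs :: "real^3^8 \<Rightarrow> ((nat \<times> nat \<times> nat) \<times> int list) list \<Rightarrow> bool" where
  "plane_signs p ps \<longleftrightarrow>
     (\<forall>((a, b, c), s) \<in> set ps. \<forall>i < 8. sgn (vol p a b c i) = of_int (s ! i))"

text \<open>
  Any two triangles of \<^term>\<open>K\<close> lie weakly on different sides of one of the planes below.
\<close>

definition separating_planes :: "((nat \<times> nat \<times> nat) \<times> int list) list" where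
  "separating_planes = [
((1,2,3),[-1,0,0,0,1,1,1,-1]),
   ((4,5,6),[1,-1,-1,-1,0,0,0,1]),
   ((0,1,7),[0,0,1,1,-1,-1,-1,0]),
   ((0,6,7),[0,1,1,1,-1,-1,0,0]),
   ((1,3,4),[-1,0,1,0,0,1,-1,-1]),
   ((3,4,6),[1,1,-1,0,0,-1,0,1]),
   ((0,2,5),[0,1,0,-1,1,0,-1,1]),
   ((2,5,7),[-1,1,0,-1,1,0,-1,0]),
   ((0,1,3),[0,0,-1,0,1,1,1,-1]),
   ((4,6,7),[1,-1,-1,-1,0,1,0,0]),
   ((0,2,4),[0,1,0,-1,0,-1,-1,1]),
   ((3,5,7),[-1,1,1,0,1,0,-1,0]),
   ((0,1,6),[0,0,-1,-1,1,1,0,1]),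
   ((1,6,7),[-1,0,-1,-1,1,1,0,0])]"

text \<open>These planes support the convex hull: the nonzero entries of each sign vector
  agree.\<close>

definition facet_planes :: "((nat \<times> nat \<times> nat) \<times> int list) list" where
  "facet_planes = [
((1,2,7),[1,0,0,1,1,1,1,0]),
   ((0,5,6),[0,-1,-1,-1,-1,0,0,-1]),
   ((1,2,4),[-1,0,0,-1,0,-1,-1,-1]),
   ((3,5,6),[1,1,1,0,1,0,0,1]),
   ((2,4,5),[1,1,0,1,0,0,1,1]),
   ((2,3,5),[-1,-1,0,0,-1,0,-1,-1])]"

lemma all_less_8: "(\<forall>i<8::nat. P i) \<longleftrightarrow> P 0 \<and> P 1 \<and> P 2 \<and> P 3 \<and> P 4 \<and> P 5 \<and> P 6 \<and> P 7"
proof -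
  have "i < 8 \<longleftrightarrow> i = 0 \<or> i = 1 \<or> i = 2 \<or> i = 3 \<or> i = 4 \<or> i = 5 \<or> i = 6 \<or> i = 7" for i :: nat
    by auto
  then show ?thesis by auto
qed

context pup_tuple
begin

lemma plane_signs: "plane_signs p separating_planes" "plane_signs p facet_planes"
  unfolding plane_signs_def separating_planes_def facet_planes_def all_less_8
   apply simp_all
   \<comment> \<open>Sorting the indices leads either to a quadruple of known sign or to one with a
     repeated vertex.\<close>
   apply (simp_all add: sgn_vols vol_sort)
   apply (simp_all add: vol_degenerate)
  done

end

section \<open>Embeddedness\<close>

definition triangle_lists :: "nat list list" where
  "triangle_lists = [[0,1,3],[0,2,3],[1,2,4],[1,3,4],[2,3,5],[2,4,5],[3,4,6],[3,5,6],
     [4,5,7],[4,6,7],[0,5,6],[0,5,7],[1,6,7],[0,1,6],[0,2,7],[1,2,7]]"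

lemma K_eq_lists: "K = (\<lambda>l. of_nat ` set l) ` set triangle_lists"
  unfolding K_eq triangle_lists_def by simp

lemma separating_planes_separate:
  "list_all (\<lambda>t. list_all (\<lambda>t'. t = t' \<or> list_ex (\<lambda>(_, s).
      list_all (\<lambda>i. 0 \<le> s ! i) t \<and> list_all (\<lambda>i. s ! i \<le> 0) t' \<or>
      list_all (\<lambda>i. s ! i \<le> 0) t \<and> list_all (\<lambda>i. 0 \<le> s ! i) t')
      separating_planes) triangle_lists) triangle_lists"
  by code_simp

text \<open>If a point of a plane is a combination of vertices on one side of it, its weights vanish
  off the plane. Hence they are confined to the three vertices that span the plane.\<close>

lemma zeros_of_planes:
  "list_all (\<lambda>((a, b, c), s). list_all (\<lambda>i. s ! i = 0 \<longleftrightarrow> i = a \<or> i = b \<or> i = c) [0..<8])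
     (separating_planes @ facet_planes)"
  by code_simp

lemma of_nat_index: obtains k where "k < 8" "(i::8) = of_nat k"
proof (cases i)
  case (of_int z)
  then show ?thesis by (intro that[of "nat z"]) auto
qed

lemma zeros_of_plane:
  assumes "((a, b, c), s) \<in> set (separating_planes @ facet_planes)" "k < 8"
  shows "s ! k = 0 \<longleftrightarrow> k = a \<or> k = b \<or> k = c"
  using zeros_of_planes assms unfolding list_all_iff by fastforce

context pup_tuple
begin

lemma sgn_orient:
  assumes "((a, b, c), s) \<in> set (separating_planes @ facet_planes)" "k < 8"
  shows "sgn (orient (p $ of_nat a) (p $ of_nat b) (p $ of_nat c) (p $ of_nat k)) = of_int (s ! k)"
  using plane_signs assms unfolding plane_signs_def vol_def by fastforce

lemma triangle_nondegenerate:
  assumes "t \<in> set triangle_lists"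
  obtains a b c where "of_nat ` set t = {a, b, c :: 8}" "cross3 (p $ b - p $ a) (p $ c - p $ a) \<noteq> 0"
proof -
  note result = that
  have *: ?thesis if "t = [a, b, c]" "vol p a b c d \<noteq> 0" for a b c d
    using that(1) orient_nonzero_cross[OF that(2)[unfolded vol_def]] by (intro result[of "of_nat a" "of_nat b" "of_nat c"]) auto
  \<comment> \<open>The second list names, for each triangle in the order of
    \<open>triangle_lists\<close>, a vertex off its plane.\<close>
  have "list_all2 (\<lambda>t d. t = [t!0, t!1, t!2] \<and> sgn (vol p (t!0) (t!1) (t!2) d) \<in> {1, -1})
      triangle_lists [4,4,0,0,0,0,0,0,3,3,1,2,0,2,4,4]"
    unfolding triangle_lists_def by (simp add: vol_sort sgn_vols)
  then have "\<forall>i<length triangle_lists. \<exists>d. triangle_lists ! i = [triangle_lists ! i ! 0, triangle_lists ! i ! 1, triangle_lists ! i ! 2] \<and>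
      sgn (vol p (triangle_lists ! i ! 0) (triangle_lists ! i ! 1) (triangle_lists ! i ! 2) d) \<in> {1, -1}"
    unfolding list_all2_conv_all_nth by blast
  moreover obtain i where "i < length triangle_lists" "t = triangle_lists ! i"
    using assms by (auto simp: in_set_conv_nth)
  ultimately obtain d where "t = [t!0, t!1, t!2]" "sgn (vol p (t!0) (t!1) (t!2) d) \<in> {1, -1}"
    by blast
  then show ?thesis by (intro *[of "t!0" "t!1" "t!2" d]) auto
qed

text \<open>For two triangles, the functional of a separating plane is weakly positive on one and
  weakly negative on the other. If it takes the same value at points of both, every term of both
  sums vanishes, so the weights sit on the three vertices of the plane, and these are affinely
  independent.\<close>

theorem inj_on_realization: "inj_on (affine_extension p) realization"
proof (rule inj_onI)
  fix x y assume xy: "x \<in> realization" "y \<in> realization" "affine_extension p x = affine_extension p y"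
  obtain t where t: "t \<in> set triangle_lists" "\<And>i. 0 \<le> x $ i" "\<And>i. i \<notin> of_nat ` set t \<Longrightarrow> x $ i = 0"
      "sum (($) x) UNIV = 1"
    using xy(1) unfolding mem_realization_iff K_eq_lists by auto
  obtain t' where t': "t' \<in> set triangle_lists" "\<And>i. 0 \<le> y $ i" "\<And>i. i \<notin> of_nat ` set t' \<Longrightarrow> y $ i = 0"
      "sum (($) y) UNIV = 1"
    using xy(2) unfolding mem_realization_iff K_eq_lists by auto
  have eq0: "(\<Sum>i\<in>UNIV. (x $ i - y $ i) *\<^sub>R p $ i) = 0"
    using xy(3) by (simp add: affine_extension_def scaleR_diff_left sum_subtractf)
  have sum0: "sum (\<lambda>i. x $ i - y $ i) UNIV = 0"
    using t t' by (simp add: sum_subtractf)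
  have fin: "x = y" if "cross3 (p $ b - p $ a) (p $ c - p $ a) \<noteq> 0"
    "\<And>i. i \<notin> {a, b, c} \<Longrightarrow> x $ i - y $ i = 0" for a b c
    using affine_independent_weights[where q = "($) p" and x = "\<lambda>i. x $ i - y $ i", OF that sum0 eq0]
    by (simp add: vec_eq_iff)
  show "x = y"
  proof (cases "t = t'")
    case True
    obtain a b c where "of_nat ` set t = {a, b, c :: 8}" "cross3 (p $ b - p $ a) (p $ c - p $ a) \<noteq> 0"
      using triangle_nondegenerate[OF t(1)] .
    then show ?thesis using t(3) t'(3) True by (intro fin) auto
  next
    case False
    then obtain a b c s where P: "((a, b, c), s) \<in> set separating_planes"
      and sep: "(\<forall>i\<in>set t. 0 \<le> s ! i) \<and> (\<forall>i\<in>set t'. s ! i \<le> 0) \<or>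
                (\<forall>i\<in>set t. s ! i \<le> 0) \<and> (\<forall>i\<in>set t'. 0 \<le> s ! i)"
      using separating_planes_separate t(1) t'(1) unfolding list_all_iff list_ex_iff by fastforce
    define l where "l i = orient (p $ of_nat a) (p $ of_nat b) (p $ of_nat c) (p $ i)" for i
    have sgnl: "sgn (l (of_nat k)) = of_int (s ! k)" if "k < 8" for k
      using sgn_orient[of a b c s k] P that by (simp add: l_def)
    have less8: "list_all (\<lambda>t. list_all (\<lambda>i. i < 8) t) triangle_lists" by (simp add: triangle_lists_def)
    have lx: "(\<Sum>i\<in>UNIV. x $ i * l i) = (\<Sum>i\<in>UNIV. y $ i * l i)"
      using orient_affine_combination[of "($) x" UNIV _ _ _ "($) p"] orient_affine_combination[of "($) y" UNIV _ _ _ "($) p"]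
        t(4) t'(4) xy(3) by (simp add: l_def affine_extension_def)
    have sgn_le: "0 \<le> l (of_nat k) \<longleftrightarrow> 0 \<le> s ! k" "l (of_nat k) \<le> 0 \<longleftrightarrow> s ! k \<le> 0" if "k < 8" for k
      using sgnl[OF that] by (metis of_int_0_le_iff zero_le_sgn_iff, metis of_int_le_0_iff sgn_le_0_iff)
    have *: "x $ i * l i = 0 \<and> y $ i * l i = 0" for i
    proof -
      have memt: "of_nat k \<in> of_nat ` set t \<Longrightarrow> True" for k by simp
      consider (1) "\<forall>i. 0 \<le> x $ i * l i \<and> y $ i * l i \<le> 0" | (2) "\<forall>i. x $ i * l i \<le> 0 \<and> 0 \<le> y $ i * l i"
        using sep
      proof
        assume A: "(\<forall>i\<in>set t. 0 \<le> s ! i) \<and> (\<forall>i\<in>set t'. s ! i \<le> 0)"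
        have "0 \<le> x $ i * l i" for i
        proof (cases "i \<in> of_nat ` set t")
          case True
          then obtain k where "k \<in> set t" "i = of_nat k" by auto
          then show ?thesis using A sgn_le(1)[of k] less8 t(1,2) unfolding list_all_iff by simp
        qed (simp add: t)
        moreover have "y $ i * l i \<le> 0" for i
        proof (cases "i \<in> of_nat ` set t'")
          case True
          then obtain k where "k \<in> set t'" "i = of_nat k" by auto
          then show ?thesis using A sgn_le(2)[of k] less8 t'(1,2) unfolding list_all_iff by (simp add: mult_nonneg_nonpos)
        qed (simp add: t')
        ultimately show ?thesis using 1 by blast
      next
        assume A: "(\<forall>i\<in>set t. s ! i \<le> 0) \<and> (\<forall>i\<in>set t'. 0 \<le> s ! i)"
        have "x $ i * l i \<le> 0" for i
        proof (cases "i \<in> of_nat ` set t")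
          case True
          then obtain k where "k \<in> set t" "i = of_nat k" by auto
          then show ?thesis using A sgn_le(2)[of k] less8 t(1,2) unfolding list_all_iff by (simp add: mult_nonneg_nonpos)
        qed (simp add: t)
        moreover have "0 \<le> y $ i * l i" for i
        proof (cases "i \<in> of_nat ` set t'")
          case True
          then obtain k where "k \<in> set t'" "i = of_nat k" by auto
          then show ?thesis using A sgn_le(1)[of k] less8 t'(1,2) unfolding list_all_iff by simp
        qed (simp add: t')
        ultimately show ?thesis using 2 by blast
      qed
      then show ?thesis
      proof cases
        case 1
        then have "(\<Sum>i\<in>UNIV. x $ i * l i) = 0" "(\<Sum>i\<in>UNIV. - (y $ i * l i)) = 0"
          using lx sum_nonneg[of UNIV "\<lambda>i. x $ i * l i"] sum_nonpos[of UNIV "\<lambda>i. y $ i * l i"]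
          by (auto simp: sum_negf)
        then show ?thesis using 1 by (simp add: sum_nonneg_eq_0_iff)
      next
        case 2
        then have "(\<Sum>i\<in>UNIV. - (x $ i * l i)) = 0" "(\<Sum>i\<in>UNIV. y $ i * l i) = 0"
          using lx sum_nonneg[of UNIV "\<lambda>i. y $ i * l i"] sum_nonpos[of UNIV "\<lambda>i. x $ i * l i"]
          by (auto simp: sum_negf)
        then show ?thesis using 2 by (simp add: sum_nonneg_eq_0_iff)
      qed
    qed
    have nzl: "l i \<noteq> 0" if "i \<notin> {of_nat a, of_nat b, of_nat c}" for i
    proof -
      obtain k where "k < 8" "i = of_nat k" using of_nat_index .
      then show ?thesis using sgnl[of k] zeros_of_plane[of a b c s k] P that by auto
    qed
    have "list_all (\<lambda>((a, b, c), s). \<exists>k\<in>{0,1,2,3}. k \<noteq> a \<and> k \<noteq> b \<and> k \<noteq> c) separating_planes"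
      by (simp add: separating_planes_def)
    then have "\<exists>k\<in>{0,1,2,3}. k \<noteq> a \<and> k \<noteq> b \<and> k \<noteq> c"
      using bspec[OF _ P] unfolding list_all_iff by blast
    then obtain k where k: "k \<in> {0,1,2,3}" "k \<noteq> a" "k \<noteq> b" "k \<noteq> c"
      by blast
    then have "k < 8" by auto
    then have "l (of_nat k) \<noteq> 0"
      using k sgnl[of k] zeros_of_plane[of a b c s k] P by auto
    then have "cross3 (p $ of_nat b - p $ of_nat a) (p $ of_nat c - p $ of_nat a) \<noteq> 0"
      unfolding l_def by (rule orient_nonzero_cross)
    moreover have "x $ i - y $ i = 0" if "i \<notin> {of_nat a, of_nat b, of_nat c}" for i
      using *[of i] nzl[OF that] by simp
    ultimately show ?thesis by (rule fin)
  qed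
qed

end

section \<open>Faces of the convex hull\<close>

text \<open>Up to a factor, the expansion of \<open>a\<close> in the basis dual to \<open>e\<close>,
  \<open>x\<close>, \<open>y\<close>. It shows that a vector orthogonal to three independent vectors
  is zero.\<close>

lemma cross3_combination:
  "(cross3 e x \<bullet> y) *\<^sub>R a = (a \<bullet> e) *\<^sub>R cross3 x y + (a \<bullet> x) *\<^sub>R cross3 y e + (a \<bullet> y) *\<^sub>R cross3 e x"
  unfolding vec_eq_iff forall_3 by (simp add: cross3_def inner_vec_def sum_3 algebra_simps)

text \<open>Cramer's rule for \<open>e\<close> in terms of \<open>x\<close>, \<open>y\<close>,
  \<open>z\<close>.\<close>

lemma cross3_cramer:
  "(cross3 e y \<bullet> z) *\<^sub>R x + (cross3 e z \<bullet> x) *\<^sub>R y + (cross3 e x \<bullet> y) *\<^sub>R z = (cross3 x y \<bullet> z) *\<^sub>R e"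
  unfolding vec_eq_iff forall_3 by (simp add: cross3_def inner_vec_def sum_3 algebra_simps)

text \<open>Separation from the interior extends to the whole set, because a convex set with
  interior points lies in the closure of its interior. A convex set with empty interior lies in a
  hyperplane, whence the second alternative.\<close>

lemma convex_support_at_noninterior:
  fixes S :: "'a::euclidean_space set"
  assumes "convex S" "m \<notin> interior S"
  obtains a where "a \<noteq> 0" "\<And>x. x \<in> S \<Longrightarrow> a \<bullet> m \<le> a \<bullet> x" | a b where "a \<noteq> 0" "\<And>x. x \<in> S \<Longrightarrow> a \<bullet> x = b"
proof (cases "interior S = {}")
  case True
  then obtain a b where "a \<noteq> 0" "S \<subseteq> {x. a \<bullet> x = b}"
    using empty_interior_subset_hyperplane[OF assms(1)] by metis
  then show ?thesis by (intro that(2)[of a b]) auto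
next
  case False
  obtain a b where ab: "a \<noteq> 0" "a \<bullet> m \<le> b" "\<forall>x\<in>interior S. b \<le> a \<bullet> x"
    using separating_hyperplane_sets[of "{m}" "interior S"] assms False by (auto simp: convex_interior)
  have "closure (interior S) \<subseteq> {x. b \<le> a \<bullet> x}"
    using ab(3) by (intro closure_minimal) (auto simp: closed_halfspace_ge)
  then have "S \<subseteq> {x. b \<le> a \<bullet> x}"
    using convex_closure_interior[OF assms(1) False] closure_subset by blast
  with ab show ?thesis by (intro that(1)[of a]) force+
qed

text \<open>The projections of x, y, z along the edge surround it, so no supporting plane contains the edge.\<close>

lemma midpoint_in_interior:
  assumes "convex S" "{u, v, x, y, z} \<subseteq> S"
    and pos: "orient u v x y > 0" "orient u v y z > 0" "orient u v z x > 0"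
  shows "midpoint u v \<in> interior S"
proof (rule ccontr)
  assume not: "midpoint u v \<notin> interior S"
  obtain a where a: "a \<noteq> 0" "a \<bullet> u = a \<bullet> v" "a \<bullet> u \<le> a \<bullet> x" "a \<bullet> u \<le> a \<bullet> y" "a \<bullet> u \<le> a \<bullet> z"
    using assms(1) not
  proof (cases rule: convex_support_at_noninterior)
    case (1 a)
    have "a \<bullet> midpoint u v \<le> a \<bullet> u" "a \<bullet> midpoint u v \<le> a \<bullet> v"
      "a \<bullet> midpoint u v \<le> a \<bullet> x" "a \<bullet> midpoint u v \<le> a \<bullet> y" "a \<bullet> midpoint u v \<le> a \<bullet> z"
      using 1 assms(2) by auto
    moreover have "a \<bullet> midpoint u v = (a \<bullet> u + a \<bullet> v) / 2"
      by (simp add: midpoint_def inner_add_right)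
    ultimately have "a \<bullet> u = a \<bullet> v \<and> a \<bullet> u \<le> a \<bullet> x \<and> a \<bullet> u \<le> a \<bullet> y \<and> a \<bullet> u \<le> a \<bullet> z"
      by argo
    then show ?thesis using 1(1) by (intro that[of a]) auto
  next
    case (2 a b)
    then show ?thesis using assms(2) by (intro that[of a]) auto
  qed
  define e X Y Z where "e = v - u" "X = x - u" "Y = y - u" "Z = z - u"
  have ge: "a \<bullet> e = 0" "0 \<le> a \<bullet> X" "0 \<le> a \<bullet> Y" "0 \<le> a \<bullet> Z"
    using a by (simp_all add: e_X_Y_Z_def inner_diff_right)
  have pos': "cross3 e X \<bullet> Y > 0" "cross3 e Y \<bullet> Z > 0" "cross3 e Z \<bullet> X > 0"
    using pos by (simp_all add: e_X_Y_Z_def orient_def)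
  \<comment> \<open>Paired with \<open>a\<close>, which is orthogonal to the edge, Cramer's rule
    becomes a vanishing sum of nonnegative numbers with positive coefficients.\<close>
  have "(cross3 e Y \<bullet> Z) * (a \<bullet> X) + (cross3 e Z \<bullet> X) * (a \<bullet> Y) + (cross3 e X \<bullet> Y) * (a \<bullet> Z) = 0"
    using arg_cong[OF cross3_cramer, of "\<lambda>w. a \<bullet> w" e Y Z X] ge(1) by (simp add: inner_add_right)
  moreover have "(cross3 e Y \<bullet> Z) * (a \<bullet> X) \<ge> 0" "(cross3 e Z \<bullet> X) * (a \<bullet> Y) \<ge> 0" "(cross3 e X \<bullet> Y) * (a \<bullet> Z) \<ge> 0"
    using ge pos' by simp_all
  ultimately have "(cross3 e Y \<bullet> Z) * (a \<bullet> X) = 0" "(cross3 e Z \<bullet> X) * (a \<bullet> Y) = 0"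
    by linarith+
  then have "a \<bullet> X = 0" "a \<bullet> Y = 0" using pos' by auto
  then have "(cross3 e X \<bullet> Y) *\<^sub>R a = 0"
    using cross3_combination[of e X Y a] ge(1) by simp
  then show False using pos'(1) a(1) by simp
qed

lemma face_in_frontier:
  assumes "\<And>v. v \<in> S \<Longrightarrow> 0 \<le> n \<bullet> (v - a)" "n \<noteq> 0" "F \<subseteq> S" "\<And>v. v \<in> F \<Longrightarrow> n \<bullet> (v - a) = 0"
  shows "convex hull F \<subseteq> frontier (convex hull S)"
proof
  fix x assume x: "x \<in> convex hull F"
  have "convex hull F \<subseteq> {x. n \<bullet> x = n \<bullet> a}"
    using assms(4) by (intro hull_minimal) (auto simp: inner_diff_right convex_hyperplane)
  moreover have "convex hull S \<subseteq> {x. n \<bullet> a \<le> n \<bullet> x}"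
    using assms(1) by (intro hull_minimal) (auto simp: inner_diff_right convex_halfspace_ge)
  then have "interior (convex hull S) \<subseteq> {x. n \<bullet> a < n \<bullet> x}"
    using interior_mono interior_halfspace_ge[OF assms(2)] by blast
  ultimately have "x \<notin> interior (convex hull S)" using x by (metis (mono_tags, lifting) in_mono less_irrefl mem_Collect_eq)
  moreover have "x \<in> closure (convex hull S)"
    using x hull_mono[OF assms(3)] closure_subset by blast
  ultimately show "x \<in> frontier (convex hull S)" by (simp add: frontier_def)
qed

lemma convex_hull_image_torus: "convex hull (image_torus p) = convex hull (range (($) p))"
proof (rule antisym)
  have "image_torus p \<subseteq> convex hull (range (($) p))"
    unfolding image_torus_eq by (intro UN_least hull_mono) auto
  then show "convex hull (image_torus p) \<subseteq> convex hull (range (($) p))"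
    by (simp add: hull_minimal)
  have "p $ i \<in> image_torus p" for i
  proof -
    have "\<forall>i. \<exists>t\<in>K. i \<in> t" unfolding all_8 K_eq by simp
    then show ?thesis unfolding image_torus_eq by (meson UN_I hull_inc imageI)
  qed
  then show "convex hull (range (($) p)) \<subseteq> convex hull (image_torus p)"
    by (intro hull_mono) auto
qed

lemma convex_hull_pair_subset: "{a, b} \<subseteq> T \<Longrightarrow> midpoint a b \<in> convex hull T"
  using closed_segment_subset_convex_hull[of a T b] hull_inc[of _ T]
  by (metis in_mono insert_subset midpoint_in_closed_segment)

context pup_tuple
begin

lemma facet_in_frontier:
  assumes P: "((a, b, c), s) \<in> set facet_planes" and s: "list_all (\<lambda>i. 0 \<le> s ! i) [0..<8] \<or> list_all (\<lambda>i. s ! i \<le> 0) [0..<8]"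
  shows "convex hull (($) p ` {of_nat a, of_nat b, of_nat c}) \<subseteq> frontier (convex hull (image_torus p))"
proof -
  define l where "l i = orient (p $ of_nat a) (p $ of_nat b) (p $ of_nat c) (p $ i)" for i
  define n where "n = cross3 (p $ of_nat b - p $ of_nat a) (p $ of_nat c - p $ of_nat a)"
  have sgnl: "sgn (l (of_nat k)) = of_int (s ! k)" if "k < 8" for k
    using sgn_orient[of a b c s k] P that by (simp add: l_def)
  have ln: "l i = n \<bullet> (p $ i - p $ of_nat a)" for i
    by (simp add: l_def n_def orient_def)
  have "list_all (\<lambda>((a, b, c), s). \<exists>k\<in>{0,1,2,3}. k \<noteq> a \<and> k \<noteq> b \<and> k \<noteq> c) facet_planes"
    by (simp add: facet_planes_def)
  then have "\<exists>k\<in>{0,1,2,3}. k \<noteq> a \<and> k \<noteq> b \<and> k \<noteq> c"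
    using bspec[OF _ P] unfolding list_all_iff by blast
  then obtain k where k: "k \<in> {0,1,2,3}" "k \<noteq> a" "k \<noteq> b" "k \<noteq> c"
    by blast
  then have "k < 8" by auto
  then have "l (of_nat k) \<noteq> 0"
    using k sgnl[of k] zeros_of_plane[of a b c s k] P by auto
  then have n0: "n \<noteq> 0" by (auto simp: ln)
  have z: "l (of_nat a) = 0" "l (of_nat b) = 0" "l (of_nat c) = 0"
    by (simp_all add: l_def orient_degenerate)
  consider "\<forall>i. 0 \<le> l i" | "\<forall>i. l i \<le> 0"
  proof -
    have "\<forall>k<8. 0 \<le> l (of_nat k) \<longleftrightarrow> 0 \<le> s ! k" "\<forall>k<8. l (of_nat k) \<le> 0 \<longleftrightarrow> s ! k \<le> 0"
      using sgnl by (metis of_int_0_le_iff zero_le_sgn_iff, metis of_int_le_0_iff sgn_le_0_iff)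
    then have "(\<forall>i. 0 \<le> l i) \<or> (\<forall>i. l i \<le> 0)"
      using s unfolding list_all_iff by (metis atLeastLessThan_iff le0 of_nat_index set_upt)
    then show ?thesis using that by blast
  qed
  then show ?thesis
  proof cases
    case 1
    then show ?thesis unfolding convex_hull_image_torus
      using n0 z by (intro face_in_frontier[of _ n "p $ of_nat a"]) (auto simp: ln)
  next
    case 2
    then show ?thesis unfolding convex_hull_image_torus
      using n0 z by (intro face_in_frontier[of _ "- n" "p $ of_nat a"]) (auto simp: ln)
  qed
qed

text \<open>The midpoint of such an edge is interior to the hull, which excludes all triangles
  containing the edge at once.\<close>

lemma edge_not_in_frontier:
  assumes "vol p i j x y > 0" "vol p i j y z > 0" "vol p i j z x > 0" "{of_nat i, of_nat j} \<subseteq> t"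
  shows "\<not> convex hull (($) p ` t) \<subseteq> frontier (convex hull (image_torus p))"
proof -
  have "midpoint (p $ of_nat i) (p $ of_nat j) \<in> interior (convex hull (image_torus p))"
    unfolding convex_hull_image_torus
    using assms(1-3) by (intro midpoint_in_interior) (auto simp: vol_def intro: hull_inc)
  moreover have "midpoint (p $ of_nat i) (p $ of_nat j) \<in> convex hull (($) p ` t)"
    using assms(4) by (intro convex_hull_pair_subset) auto
  ultimately show ?thesis by (auto simp: frontier_def)
qed

lemmas vol_signs = sgn_vols[unfolded sgn_1_pos sgn_1_neg]

theorem hull_triangles:
  "{t \<in> K. convex hull (($) p ` t) \<subseteq> frontier (convex hull (image_torus p))} =
     {{1,2,7}, {1,2,4}, {2,4,5}, {2,3,5}, {3,5,6}, {0,5,6}}"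
proof -
  let ?F = "\<lambda>t. convex hull (($) p ` t) \<subseteq> frontier (convex hull (image_torus p))"
  have facets: "?F {1,2,7}" "?F {1,2,4}" "?F {2,4,5}" "?F {2,3,5}" "?F {3,5,6}" "?F {0,5,6}"
    using facet_in_frontier[of 1 2 7 "[1,0,0,1,1,1,1,0]"] facet_in_frontier[of 1 2 4 "[-1,0,0,-1,0,-1,-1,-1]"]
      facet_in_frontier[of 2 4 5 "[1,1,0,1,0,0,1,1]"] facet_in_frontier[of 2 3 5 "[-1,-1,0,0,-1,0,-1,-1]"]
      facet_in_frontier[of 3 5 6 "[1,1,1,0,1,0,0,1]"] facet_in_frontier[of 0 5 6 "[0,-1,-1,-1,-1,0,0,-1]"]
    by (simp_all add: facet_planes_def upt_rec[of _ "8::nat"])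
  \<comment> \<open>Each of the ten remaining triangles contains one of the edges 3-4, 0-2, 5-7,
    0-1, 6-7. Every row lists three vertices that surround one of these edges.\<close>
  have "vol p 3 4 0 2 > 0" "vol p 3 4 2 6 > 0" "vol p 3 4 6 0 > 0"
    "vol p 0 2 3 4 > 0" "vol p 0 2 4 7 > 0" "vol p 0 2 7 3 > 0"
    "vol p 7 5 4 3 > 0" "vol p 7 5 3 0 > 0" "vol p 7 5 0 4 > 0"
    "vol p 0 1 2 4 > 0" "vol p 0 1 4 7 > 0" "vol p 0 1 7 2 > 0"
    "vol p 7 6 5 3 > 0" "vol p 7 6 3 0 > 0" "vol p 7 6 0 5 > 0"
    using vol_signs by (simp_all add: vol_sort)
  note edges = edge_not_in_frontier[OF this(1-3)] edge_not_in_frontier[OF this(4-6)]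
     edge_not_in_frontier[OF this(7-9)] edge_not_in_frontier[OF this(10-12)] edge_not_in_frontier[OF this(13-15)]
  have "\<not> ?F {0,1,3}" "\<not> ?F {0,2,3}" "\<not> ?F {1,3,4}" "\<not> ?F {3,4,6}" "\<not> ?F {4,5,7}" "\<not> ?F {4,6,7}"
    "\<not> ?F {0,5,7}" "\<not> ?F {1,6,7}" "\<not> ?F {0,1,6}" "\<not> ?F {0,2,7}"
    by (rule edges; simp; fail)+
  note nonfacets = this
  have *: "{t \<in> K. P t} = {{1,2,7}, {1,2,4}, {2,4,5}, {2,3,5}, {3,5,6}, {0,5,6}}"
    if "P {1,2,7}" "P {1,2,4}" "P {2,4,5}" "P {2,3,5}" "P {3,5,6}" "P {0,5,6}"
      "\<not> P {0,1,3}" "\<not> P {0,2,3}" "\<not> P {1,3,4}" "\<not> P {3,4,6}" "\<not> P {4,5,7}" "\<not> P {4,6,7}"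
      "\<not> P {0,5,7}" "\<not> P {1,6,7}" "\<not> P {0,1,6}" "\<not> P {0,2,7}" for P :: "8 set \<Rightarrow> bool"
  proof -
    have filter: "{t \<in> insert a A. P t} = (if P a then insert a {t \<in> A. P t} else {t \<in> A. P t})" for a A
      by auto
    show ?thesis
      using that unfolding K_eq filter by (simp add: insert_commute)
  qed
  show ?thesis
    by (rule *[of ?F]; fact facets nonfacets)
qed

theorem \<rho>_image_torus: "\<rho> ` image_torus p = image_torus p"
proof -
  have lin: "linear \<rho>"
    by (rule linearI) (simp_all add: vec_eq_iff forall_3)
  have K7: "(`) ((-) 7) ` K = K"
    unfolding K_eq by (simp add: insert_commute)
  have "\<rho> ` (convex hull (($) p ` t)) = convex hull (($) p ` ((-) 7 ` t))" for t
    unfolding convex_hull_linear_image[OF lin] image_image sym ..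
  then have "\<rho> ` image_torus p = (\<Union>t\<in>K. convex hull (($) p ` ((-) 7 ` t)))"
    unfolding image_torus_eq image_UN by simp
  also have "\<dots> = (\<Union>t\<in>(`) ((-) 7) ` K. convex hull (($) p ` t))" by simp
  finally show ?thesis unfolding K7 image_torus_eq .
qed

end

section \<open>Piecewise linear interpolation on the integer lattice\<close>

text \<open>The square is cut along the diagonal from \<open>(i + 1, j)\<close> to
  \<open>(i, j + 1)\<close>, whose labels will differ by 2, so that it is an edge of
  \<open>K\<close>. Labels at the ends of the other diagonal differ by 4 and span no edge.\<close>

definition cell :: "(int \<times> int \<Rightarrow> 'v::real_vector) \<Rightarrow> int \<Rightarrow> int \<Rightarrow> real \<Rightarrow> real \<Rightarrow> 'v" where
  "cell P i j t s = (if t + s \<le> 1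
     then (1 - t - s) *\<^sub>R P (i, j) + t *\<^sub>R P (i + 1, j) + s *\<^sub>R P (i, j + 1)
     else (t + s - 1) *\<^sub>R P (i + 1, j + 1) + (1 - s) *\<^sub>R P (i + 1, j) + (1 - t) *\<^sub>R P (i, j + 1))"

definition pl :: "(int \<times> int \<Rightarrow> 'v::real_vector) \<Rightarrow> real \<times> real \<Rightarrow> 'v" where
  "pl P r = cell P \<lfloor>fst r\<rfloor> \<lfloor>snd r\<rfloor> (frac (fst r)) (frac (snd r))"

lemma cell_1: "0 \<le> s \<Longrightarrow> s \<le> 1 \<Longrightarrow> cell P i j 1 s = cell P (i + 1) j 0 s"
  by (cases "s = 0") (auto simp: cell_def algebra_simps)

lemma cell_2: "0 \<le> t \<Longrightarrow> t \<le> 1 \<Longrightarrow> cell P i j t 1 = cell P i (j + 1) t 0"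
  by (cases "t = 0") (auto simp: cell_def algebra_simps)

text \<open>\<open>pl\<close> is defined by half-open cells. The formulas of neighbouring cells
  agree on the common side, so each is valid on its closed square.\<close>

lemma pl_cell:
  fixes t s :: real
  assumes "0 \<le> t" "t \<le> 1" "0 \<le> s" "s \<le> 1"
  shows "pl P (of_int i + t, of_int j + s) = cell P i j t s"
proof -
  have fl: "\<lfloor>of_int k + u\<rfloor> = k" "frac (of_int k + u) = u" if "0 \<le> u" "u < 1" for k and u :: real
  proof -
    show "\<lfloor>of_int k + u\<rfloor> = k" by (rule floor_unique) (use that in auto)
    then show "frac (of_int k + u) = u" by (simp add: frac_def)
  qed
  have fl1: "\<lfloor>of_int k + 1 :: real\<rfloor> = k + 1" "frac (of_int k + 1 :: real) = 0" for k
    by (simp_all add: frac_def)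
  consider "t < 1" "s < 1" | "t = 1" "s < 1" | "t < 1" "s = 1" | "t = 1" "s = 1"
    using assms by linarith
  then show ?thesis
  proof cases
    case 1
    then show ?thesis using assms by (simp only: pl_def fst_conv snd_conv fl)
  next
    case 2
    show ?thesis unfolding 2(1) using assms 2(2)
      by (simp only: pl_def fst_conv snd_conv fl fl1) (simp add: cell_1)
  next
    case 3
    show ?thesis unfolding 3(2) using assms 3(1)
      by (simp only: pl_def fst_conv snd_conv fl fl1) (simp add: cell_2)
  next
    case 4
    then show ?thesis by (simp add: pl_def fl1 cell_1 cell_2)
  qed
qed

lemma cell_coords:
  fixes r :: "real \<times> real"
  obtains i j t s where "r = (of_int i + t, of_int j + s)" "0 \<le> t" "t < 1" "0 \<le> s" "s < 1"
proof -
  have "r = (of_int \<lfloor>fst r\<rfloor> + frac (fst r), of_int \<lfloor>snd r\<rfloor> + frac (snd r))"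
    by (simp add: frac_def)
  then show ?thesis using that frac_ge_0 frac_lt_1 by blast
qed

lemma pl_lower:
  assumes "0 \<le> a" "0 \<le> b" "0 \<le> c" "a + b + c = 1"
  shows "pl P (of_int i + b, of_int j + c) = a *\<^sub>R P (i, j) + b *\<^sub>R P (i + 1, j) + c *\<^sub>R P (i, j + 1)"
proof -
  have "a = 1 - b - c" using assms by simp
  then show ?thesis using assms by (simp add: pl_cell cell_def)
qed

lemma pl_upper:
  assumes "0 \<le> a" "0 \<le> b" "0 \<le> c" "a + b + c = 1"
  shows "pl P (of_int i + 1 - b, of_int j + 1 - c) = a *\<^sub>R P (i + 1, j + 1) + b *\<^sub>R P (i, j + 1) + c *\<^sub>R P (i + 1, j)"
proof -
  have a: "a = 1 - b - c" using assms by simp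
  have "pl P (of_int i + (1 - b), of_int j + (1 - c)) = a *\<^sub>R P (i + 1, j + 1) + b *\<^sub>R P (i, j + 1) + c *\<^sub>R P (i + 1, j)"
  proof (cases "b + c = 1")
    case True
    then have "a = 0" "b = 1 - c" using a by simp_all
    then show ?thesis using assms by (subst pl_cell) (auto simp: cell_def)
  next
    case False
    then show ?thesis using assms(1-3) unfolding a by (subst pl_cell) (auto simp: cell_def algebra_simps)
  qed
  then show ?thesis by (simp add: add_diff_eq)
qed

lemma pl_cases:
  fixes r :: "real \<times> real"
  obtains (lower) i j t s where "r = (of_int i + t, of_int j + s)" "0 \<le> t" "0 \<le> s" "t + s \<le> 1"
      "\<And>P :: int \<times> int \<Rightarrow> 'v::real_vector. pl P r = (1 - t - s) *\<^sub>R P (i, j) + t *\<^sub>R P (i + 1, j) + s *\<^sub>R P (i, j + 1)"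
      "\<And>P :: int \<times> int \<Rightarrow> 'w::real_vector. pl P r = (1 - t - s) *\<^sub>R P (i, j) + t *\<^sub>R P (i + 1, j) + s *\<^sub>R P (i, j + 1)"
  | (upper) i j t s where "r = (of_int i + 1 - t, of_int j + 1 - s)" "0 \<le> t" "0 \<le> s" "t + s \<le> 1"
      "\<And>P :: int \<times> int \<Rightarrow> 'v::real_vector. pl P r = (1 - t - s) *\<^sub>R P (i + 1, j + 1) + t *\<^sub>R P (i, j + 1) + s *\<^sub>R P (i + 1, j)"
      "\<And>P :: int \<times> int \<Rightarrow> 'w::real_vector. pl P r = (1 - t - s) *\<^sub>R P (i + 1, j + 1) + t *\<^sub>R P (i, j + 1) + s *\<^sub>R P (i + 1, j)"
proof -
  obtain i j t s where r: "r = (of_int i + t, of_int j + s)" "0 \<le> t" "t < 1" "0 \<le> s" "s < (1::real)"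
    using cell_coords .
  show ?thesis
  proof (cases "t + s \<le> 1")
    case True
    show ?thesis
      by (rule lower[of i t j s]) (use r True in \<open>simp_all add: pl_lower[of "1 - t - s" t s]\<close>)
  next
    case False
    have e: "r = (of_int i + 1 - (1 - t), of_int j + 1 - (1 - s))" using r by simp
    show ?thesis
      by (rule upper[of i "1 - t" j "1 - s", OF e]; (unfold e)?; (rule pl_upper)?) (use r False in simp_all)
  qed
qed

lemma linear_pl: "linear f \<Longrightarrow> f (pl P r) = pl (f \<circ> P) r"
  by (simp add: pl_def cell_def linear_add linear_scale)

lemma pl_add: "pl (\<lambda>v. P v + Q v) r = pl P r + pl Q r"
  by (simp add: pl_def cell_def algebra_simps)

lemma pl_diff: "pl (\<lambda>v. P v - Q v) r = pl P r - pl Q r"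
  by (simp add: pl_def cell_def algebra_simps)

lemma pl_linear: "pl (\<lambda>(i, j). of_int i *\<^sub>R a + of_int j *\<^sub>R b) (t, s) = t *\<^sub>R a + s *\<^sub>R b"
proof -
  have "t = of_int \<lfloor>t\<rfloor> + frac t" "s = of_int \<lfloor>s\<rfloor> + frac s" by (simp_all add: frac_def)
  then have "t *\<^sub>R a + s *\<^sub>R b = (of_int \<lfloor>t\<rfloor> + frac t) *\<^sub>R a + (of_int \<lfloor>s\<rfloor> + frac s) *\<^sub>R b" by simp
  also have "\<dots> = pl (\<lambda>(i, j). of_int i *\<^sub>R a + of_int j *\<^sub>R b) (t, s)"
    by (simp add: pl_def cell_def algebra_simps)
  finally show ?thesis ..
qed

lemma pl_shift: "pl P (t + of_int m, s + of_int n) = pl (\<lambda>(i, j). P (i + m, j + n)) (t, s)"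
  by (simp add: pl_def cell_def ac_simps)

lemma norm_pl_le:
  fixes P :: "int \<times> int \<Rightarrow> 'v::real_normed_vector"
  assumes "\<And>v. norm (P v) \<le> C"
  shows "norm (pl P r) \<le> C"
proof (cases rule: pl_cases[where r = r and 'v = 'v and 'w = 'v])
  have *: "norm (a *\<^sub>R P u + b *\<^sub>R P v + c *\<^sub>R P w) \<le> C"
    if "0 \<le> a" "0 \<le> b" "0 \<le> c" "a + b + c = 1" for a b c u v w
  proof -
    have "norm (a *\<^sub>R P u + b *\<^sub>R P v + c *\<^sub>R P w) \<le> a * norm (P u) + b * norm (P v) + c * norm (P w)"
      using that by (intro order_trans[OF norm_triangle_ineq] add_mono norm_triangle_ineq) (auto simp: norm_triangle_ineq)
    also have "\<dots> \<le> a * C + b * C + c * C"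
      using that assms by (intro add_mono mult_left_mono) auto
    also have "\<dots> = C" using that by (simp flip: distrib_right)
    finally show ?thesis .
  qed
  {
    case (lower i j t s)
    then show ?thesis using *[of "1 - t - s" t s] by simp
  next
    case (upper i j t s)
    then show ?thesis using *[of "1 - t - s" t s] by simp
  }
qed

lemma tendsto_pl:
  fixes P :: "int \<times> int \<Rightarrow> 'v::real_normed_vector"
  assumes "\<And>v. ((\<lambda>n. Q n v) \<longlongrightarrow> P v) F"
  shows "((\<lambda>n. pl (Q n) r) \<longlongrightarrow> pl P r) F"
  unfolding pl_def cell_def by (auto intro!: tendsto_intros assms)

text \<open>A bounded set meets finitely many closed lattice triangles, and the affine formulas on
  these can be pasted.\<close>

lemma continuous_on_pl_bounded:
  fixes P :: "int \<times> int \<Rightarrow> 'v::real_normed_vector"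
  assumes "bounded S"
  shows "continuous_on S (pl P)"
proof -
  obtain B where B: "\<And>r. r \<in> S \<Longrightarrow> norm r \<le> B" using assms by (auto simp: bounded_iff)
  define N where "N = \<lceil>B\<rceil> + 1"
  define C where "C = (\<lambda>(i :: int, j :: int). {of_int i..of_int i + 1 :: real} \<times> {of_int j..of_int j + 1 :: real})"
  define Lo where "Lo = (\<lambda>(i :: int, j :: int). C (i, j) \<inter> {r. fst r + snd r \<le> of_int i + of_int j + 1})"
  define Up where "Up = (\<lambda>(i :: int, j :: int). C (i, j) \<inter> {r. fst r + snd r \<ge> of_int i + of_int j + 1})"
  have clC: "closed (C ij)" for ij by (cases ij) (auto simp: C_def intro: closed_Times)
  have cl: "closed (Lo ij)" "closed (Up ij)" for ij
    by (cases ij; auto simp: Lo_def Up_def intro!: closed_Int clC closed_Collect_le continuous_intros)+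
  have co: "continuous_on (Lo ij) (pl P)" "continuous_on (Up ij) (pl P)" for ij
  proof -
    obtain i j where ij: "ij = (i, j)" by (cases ij)
    have "continuous_on (Lo ij) (\<lambda>r. (1 - (fst r - of_int i) - (snd r - of_int j)) *\<^sub>R P (i, j)
        + (fst r - of_int i) *\<^sub>R P (i + 1, j) + (snd r - of_int j) *\<^sub>R P (i, j + 1))"
      by (intro continuous_intros)
    then show "continuous_on (Lo ij) (pl P)"
    proof (rule continuous_on_eq)
      fix r assume r: "r \<in> Lo ij"
      have "r = (of_int i + (fst r - of_int i), of_int j + (snd r - of_int j))" by simp
      then show "(1 - (fst r - of_int i) - (snd r - of_int j)) *\<^sub>R P (i, j)
        + (fst r - of_int i) *\<^sub>R P (i + 1, j) + (snd r - of_int j) *\<^sub>R P (i, j + 1) = pl P r"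
        using r pl_lower[of "1 - (fst r - of_int i) - (snd r - of_int j)" "fst r - of_int i" "snd r - of_int j" P i j]
        by (auto simp: ij Lo_def C_def)
    qed
    have "continuous_on (Up ij) (\<lambda>r. (1 - (of_int i + 1 - fst r) - (of_int j + 1 - snd r)) *\<^sub>R P (i + 1, j + 1)
        + (of_int i + 1 - fst r) *\<^sub>R P (i, j + 1) + (of_int j + 1 - snd r) *\<^sub>R P (i + 1, j))"
      by (intro continuous_intros)
    then show "continuous_on (Up ij) (pl P)"
    proof (rule continuous_on_eq)
      fix r assume r: "r \<in> Up ij"
      show "(1 - (of_int i + 1 - fst r) - (of_int j + 1 - snd r)) *\<^sub>R P (i + 1, j + 1)
        + (of_int i + 1 - fst r) *\<^sub>R P (i, j + 1) + (of_int j + 1 - snd r) *\<^sub>R P (i + 1, j) = pl P r"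
        using r pl_upper[of "1 - (of_int i + 1 - fst r) - (of_int j + 1 - snd r)" "of_int i + 1 - fst r" "of_int j + 1 - snd r" P i j]
        by (auto simp: ij Up_def C_def)
    qed
  qed
  define I where "I = {-N..N} \<times> {-N..N}"
  have "continuous_on (\<Union>ij\<in>I. Lo ij) (pl P)" "continuous_on (\<Union>ij\<in>I. Up ij) (pl P)"
    by (intro continuous_on_closed_Union; auto simp: I_def cl co)+
  then have "continuous_on ((\<Union>ij\<in>I. Lo ij) \<union> (\<Union>ij\<in>I. Up ij)) (pl P)"
    by (intro continuous_on_closed_Un closed_UN ballI cl) (auto simp: I_def)
  moreover have "S \<subseteq> (\<Union>ij\<in>I. Lo ij) \<union> (\<Union>ij\<in>I. Up ij)"
  proof
    fix r assume "r \<in> S"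
    then have "\<bar>fst r\<bar> \<le> B" "\<bar>snd r\<bar> \<le> B"
      using B[of r] norm_fst_le[of "fst r" "snd r"] norm_snd_le[of "snd r" "fst r"] by (auto intro: order_trans)
    then have "(\<lfloor>fst r\<rfloor>, \<lfloor>snd r\<rfloor>) \<in> I"
      unfolding I_def N_def mem_Times_iff by (simp add: abs_le_iff) linarith
    moreover have "r \<in> C (\<lfloor>fst r\<rfloor>, \<lfloor>snd r\<rfloor>)"
      by (simp add: C_def mem_Times_iff real_of_int_floor_add_one_ge)
    then have "r \<in> Lo (\<lfloor>fst r\<rfloor>, \<lfloor>snd r\<rfloor>) \<union> Up (\<lfloor>fst r\<rfloor>, \<lfloor>snd r\<rfloor>)"
      by (auto simp: Lo_def Up_def)
    ultimately show "r \<in> (\<Union>ij\<in>I. Lo ij) \<union> (\<Union>ij\<in>I. Up ij)" by blast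
  qed
  ultimately show ?thesis by (rule continuous_on_subset)
qed

section \<open>Monotone interpolants\<close>

lemma strict_mono_int_pieces:
  fixes f :: "real \<Rightarrow> real"
  assumes "\<And>(i::int) t t'. 0 \<le> t \<Longrightarrow> t < t' \<Longrightarrow> t' \<le> 1 \<Longrightarrow> f (of_int i + t) < f (of_int i + t')"
  shows "x < y \<Longrightarrow> f x < f y"
proof -
  have int: "f (of_int i) \<le> f (of_int (i + int n))" for i n
  proof (induction n)
    case (Suc n)
    have "f (of_int (i + int n) + 0) < f (of_int (i + int n) + 1)" by (intro assms) auto
    with Suc show ?case by (simp add: add.assoc add.commute[of 1])
  qed simp
  assume "x < y"
  show "f x < f y"
  proof (cases "\<lfloor>x\<rfloor> = \<lfloor>y\<rfloor>")
    case True
    have "f (of_int \<lfloor>x\<rfloor> + frac x) < f (of_int \<lfloor>x\<rfloor> + frac y)"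
      using \<open>x < y\<close> True less_imp_le[OF frac_lt_1[of y]] of_int_floor_le[of x] by (intro assms) (auto simp: frac_def)
    then show ?thesis using True by (simp add: frac_def)
  next
    case False
    then have lt: "\<lfloor>x\<rfloor> + 1 \<le> \<lfloor>y\<rfloor>" using \<open>x < y\<close> floor_mono[of x y] by linarith
    have "f (of_int \<lfloor>x\<rfloor> + frac x) < f (of_int \<lfloor>x\<rfloor> + 1)"
      by (intro assms) (auto simp: frac_lt_1)
    also have "\<dots> \<le> f (of_int \<lfloor>y\<rfloor>)"
      using int[of "\<lfloor>x\<rfloor> + 1" "nat (\<lfloor>y\<rfloor> - (\<lfloor>x\<rfloor> + 1))"] lt by simp
    also have "\<dots> \<le> f (of_int \<lfloor>y\<rfloor> + frac y)"
    proof (cases "frac y = 0")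
      case False
      then have "f (of_int \<lfloor>y\<rfloor> + 0) < f (of_int \<lfloor>y\<rfloor> + frac y)"
        using frac_ge_0[of y] frac_lt_1[of y] by (intro assms) linarith+
      then show ?thesis by simp
    next
      case True
      then show ?thesis unfolding True by simp
    qed
    finally show ?thesis by (simp add: frac_def)
  qed
qed

text \<open>Along a horizontal line the slope within a cell is the increment of \<open>Q\<close> on
  the lower side before the diagonal and on the upper side after it.\<close>

lemma pl_strict_mono_1:
  fixes Q :: "int \<times> int \<Rightarrow> real"
  assumes "\<And>i j. Q (i, j) < Q (i + 1, j)" and "t < t'"
  shows "pl Q (t, s) < pl Q (t', s)"
proof -
  obtain j u where s: "s = of_int j + u" "0 \<le> u" "u < 1"
    by (rule that[of "\<lfloor>s\<rfloor>" "frac s"]) (auto simp: frac_def frac_lt_1, linarith+)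
  show ?thesis
  proof (rule strict_mono_int_pieces[of "\<lambda>t. pl Q (t, s)", OF _ assms(2)])
    fix i :: int and t t' :: real assume t: "0 \<le> t" "t < t'" "t' \<le> 1"
    define M where "M = (1 - u) * Q (i + 1, j) + u * Q (i, j + 1)"
    define d0 d1 where "d0 = Q (i + 1, j) - Q (i, j)" and "d1 = Q (i + 1, j + 1) - Q (i, j + 1)"
    have d: "d0 > 0" "d1 > 0" using assms(1) by (simp_all add: d0_def d1_def)
    have c: "cell Q i j x u = M + (if x + u - 1 \<le> 0 then (x + u - 1) * d0 else (x + u - 1) * d1)" for x
      by (simp add: cell_def M_def d0_def d1_def algebra_simps)
    have "cell Q i j t u < cell Q i j t' u"
    proof -
      consider "t' + u - 1 \<le> 0" | "t + u - 1 \<le> 0" "t' + u - 1 > 0" | "t + u - 1 > 0" by linarith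
      then show ?thesis
      proof cases
        case 2
        then have "(t + u - 1) * d0 \<le> 0" "(t' + u - 1) * d1 > 0" using d by (simp_all add: mult_nonpos_nonneg)
        then show ?thesis using 2 by (simp add: c)
      qed (use d t in \<open>simp_all add: c\<close>)
    qed
    then show "pl Q (of_int i + t, s) < pl Q (of_int i + t', s)"
      using t s by (simp add: pl_cell)
  qed
qed

lemma pl_swap: "pl Q (t, s) = pl (\<lambda>(i, j). Q (j, i)) (s, t)"
  by (simp add: pl_def cell_def algebra_simps)

lemma pl_strict_mono_2:
  fixes Q :: "int \<times> int \<Rightarrow> real"
  assumes "\<And>i j. Q (i, j) < Q (i, j + 1)" and "s < s'"
  shows "pl Q (t, s) < pl Q (t, s')"
  using pl_strict_mono_1[of "\<lambda>(i, j). Q (j, i)" s s' t] assms by (simp add: pl_swap[of Q])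

text \<open>For two distinct parameters either both coordinates change weakly in the same direction,
  and \<open>X\<close> separates the values, or they change in opposite directions, and
  \<open>Y\<close> does.\<close>

lemma inj_pl:
  fixes P :: "int \<times> int \<Rightarrow> 'v::real_vector" and X Y :: "'v \<Rightarrow> real"
  assumes "linear X" "linear Y"
    and "\<And>i j. X (P (i, j)) < X (P (i + 1, j))" "\<And>i j. X (P (i, j)) < X (P (i, j + 1))"
    and "\<And>i j. Y (P (i + 1, j)) < Y (P (i, j))" "\<And>i j. Y (P (i, j)) < Y (P (i, j + 1))"
  shows "inj (pl P)"
proof (rule injI)
  fix r r' assume eq: "pl P r = pl P r'"
  define Z where "Z v = - Y v" for v
  have "linear Z" unfolding Z_def using assms(2) linear_compose_neg by blast
  have X1: "t < t' \<Longrightarrow> X (pl P (t, s)) < X (pl P (t', s))" for t t' s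
    using assms by (simp add: linear_pl pl_strict_mono_1)
  have X2: "s < s' \<Longrightarrow> X (pl P (t, s)) < X (pl P (t, s'))" for t s s'
    using assms by (simp add: linear_pl pl_strict_mono_2)
  have Y1: "t < t' \<Longrightarrow> Y (pl P (t', s)) < Y (pl P (t, s))" for t t' s
  proof -
    assume "t < t'"
    then have "pl (Z \<circ> P) (t, s) < pl (Z \<circ> P) (t', s)"
      using assms(5) by (intro pl_strict_mono_1) (simp_all add: Z_def)
    then have "Z (pl P (t, s)) < Z (pl P (t', s))"
      by (simp only: linear_pl[OF \<open>linear Z\<close>])
    then show ?thesis by (simp add: Z_def)
  qed
  have Y2: "s < s' \<Longrightarrow> Y (pl P (t, s)) < Y (pl P (t, s'))" for t s s'
    using assms by (simp add: linear_pl pl_strict_mono_2)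
  have X: "X (pl P (t, s)) < X (pl P (t', s'))" if "t \<le> t'" "s \<le> s'" "(t, s) \<noteq> (t', s')" for t s t' s'
    using X1[of t t' s] X2[of s s' t'] that by (cases "t = t'"; cases "s = s'") auto
  have Y: "Y (pl P (t', s)) < Y (pl P (t, s'))" if "t \<le> t'" "s \<le> s'" "(t', s) \<noteq> (t, s')" for t s t' s'
    using Y1[of t t' s] Y2[of s s' t] that by (cases "t = t'"; cases "s = s'") auto
  obtain t s t' s' where r: "r = (t, s)" "r' = (t', s')" by (cases r, cases r')
  show "r = r'"
    using X[of t t' s s'] X[of t' t s' s] Y[of t t' s' s] Y[of t' t s s'] eq
    unfolding r by (metis less_irrefl linear)
qed

section \<open>Developed triangulations\<close>

text \<open>
  In the basis of the two edge directions \<open>a \<rightarrow> a + 1\<close> and \<open>a \<rightarrow> a + 3\<close> the universal cover of the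
  triangulated torus is the standard triangulation of the integer lattice. The deck group consists
  of the translations that preserve labels and is generated by \<open>(3, -1)\<close> and \<open>(-1, 3)\<close>.
\<close>

definition lab :: "int \<times> int \<Rightarrow> 8" where
  "lab v = of_int (fst v + 3 * snd v)"

text \<open>A periodic part plus a linear part under which the deck translations (3, -1) and (-1, 3)
  become \<open>- fst L\<close> and \<open>snd L\<close>. The minus sign makes
  \<open>(a, a + 3, a + 1)\<close> counterclockwise.\<close>

definition dev :: "basis \<Rightarrow> (8 \<Rightarrow> complex) \<Rightarrow> int \<times> int \<Rightarrow> complex" where
  "dev L \<zeta> v = \<zeta> (lab v) - (of_int (3 * fst v + snd v) / 8) *\<^sub>R fst L + (of_int (fst v + 3 * snd v) / 8) *\<^sub>R snd L"

definition bary :: "real \<times> real \<Rightarrow> real^8" where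
  "bary = pl (\<lambda>v. axis (lab v) 1)"

lemma of_int_8_eq_iff: "(of_int a :: 8) = of_int b \<longleftrightarrow> 8 dvd b - a"
proof -
  have "(of_int (b - a) :: 8) = 0 \<longleftrightarrow> 8 dvd b - a"
    using of_int_eq_0_iff_char_dvd[where 'a = 8, of "b - a"] by simp
  then show ?thesis by (metis eq_iff_diff_eq_0 of_int_diff)
qed

lemma lab_shift: "lab (i + 3 * m - n, j - m + 3 * n) = lab (i, j)"
  unfolding lab_def of_int_8_eq_iff by (simp add: algebra_simps)

lemma lab_eqE:
  assumes "lab (i, j) = lab (i', j')"
  obtains m n where "i' = i + 3 * m - n" "j' = j - m + 3 * n"
proof -
  obtain k where k: "i' + 3 * j' - (i + 3 * j) = 8 * k"
    using assms unfolding lab_def of_int_8_eq_iff by (auto elim: dvdE)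
  show ?thesis
    by (rule that[of "3 * k - (j' - j)" k]) (use k in simp_all)
qed

lemma lab_steps:
  "lab (i + 1, j) = lab (i, j) + 1" "lab (i, j + 1) = lab (i, j) + 3" "lab (i + 1, j + 1) = lab (i, j) + 4"
  by (simp_all add: lab_def)

lemma dev_shift: "dev L \<zeta> (i + 3 * m - n, j - m + 3 * n) = dev L \<zeta> (i, j) - of_int m *\<^sub>R fst L + of_int n *\<^sub>R snd L"
  unfolding dev_def lab_shift by (simp add: algebra_simps add_divide_distrib diff_divide_distrib)

lemma pl_dev_shift:
  "pl (dev L \<zeta>) (t + of_int (3 * m - n), s + of_int (3 * n - m)) = pl (dev L \<zeta>) (t, s) - of_int m *\<^sub>R fst L + of_int n *\<^sub>R snd L"
proof -
  have "pl (dev L \<zeta>) (t + of_int (3 * m - n), s + of_int (3 * n - m))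
     = pl (\<lambda>(i, j). dev L \<zeta> (i + (3 * m - n), j + (3 * n - m))) (t, s)"
    by (rule pl_shift)
  also have "(\<lambda>(i, j). dev L \<zeta> (i + (3 * m - n), j + (3 * n - m)))
     = (\<lambda>v. dev L \<zeta> v + (\<lambda>_. - of_int m *\<^sub>R fst L + of_int n *\<^sub>R snd L) v)"
    using dev_shift[of L \<zeta> _ m n] by (auto simp: fun_eq_iff algebra_simps)
  finally show ?thesis unfolding pl_add by (simp add: pl_def cell_def algebra_simps)
qed

lemma pl_periodic:
  "pl (F \<circ> lab) (t + of_int (3 * m - n), s + of_int (3 * n - m)) = pl (F \<circ> lab) (t, s)"
proof -
  have "pl (F \<circ> lab) (t + of_int (3 * m - n), s + of_int (3 * n - m))
     = pl (\<lambda>(i, j). (F \<circ> lab) (i + (3 * m - n), j + (3 * n - m))) (t, s)"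
    by (rule pl_shift)
  also have "(\<lambda>(i, j). (F \<circ> lab) (i + (3 * m - n), j + (3 * n - m))) = F \<circ> lab"
    using lab_shift[of _ m n] by (auto simp: fun_eq_iff algebra_simps)
  finally show ?thesis .
qed

lemma bary_eq_pl: "bary = pl ((\<lambda>i. axis i 1) \<circ> lab)"
  by (simp add: bary_def comp_def)

lemma affine_extension_bary: "affine_extension p (bary r) = pl (($) p \<circ> lab) r"
  unfolding bary_def linear_pl[OF linear_affine_extension] by (simp add: comp_def)

subsection \<open>Barycentric coordinates determine points up to deck transformations\<close>

text \<open>The lattice step to the neighbour whose label is larger by \<open>d\<close>. The
  difference 4 belongs to no edge and gets the default 0.\<close>

definition dir :: "8 \<Rightarrow> real \<times> real" where
  "dir d = (if d = 1 then (1, 0) else if d = 7 then (-1, 0) else if d = 3 then (0, 1) else if d = 5 then (0, -1)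
     else if d = 2 then (-1, 1) else if d = 6 then (1, -1) else 0)"

definition star_map :: "8 \<Rightarrow> real^8 \<Rightarrow> real \<times> real" where
  "star_map b x = (\<Sum>d\<in>UNIV. x $ (b + d) *\<^sub>R dir d)"

lemma linear_star_map: "linear (star_map b)"
  by (rule linearI) (simp_all add: star_map_def algebra_simps sum.distrib scaleR_sum_right)

lemma star_map_axis: "star_map b (axis (b + d) 1) = dir d"
  by (simp add: star_map_def axis_def if_distrib[of "\<lambda>z. z *\<^sub>R _"] cong: if_cong)

lemma star_map_axis': "star_map b (axis (b - d) 1) = dir (- d)"
  using star_map_axis[of b "- d"] by simp

lemma dir_simps: "dir 0 = 0" "dir 1 = (1, 0)" "dir (-1) = (-1, 0)" "dir 3 = (0, 1)" "dir (-3) = (0, -1)"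
    "dir 2 = (-1, 1)" "dir (-2) = (1, -1)"
  by (simp_all add: dir_def)

text \<open>Within the star of a lattice vertex labelled \<open>b\<close> the offset from that
  vertex is linear in the barycentric coordinates alone. Points with equal coordinates hence differ
  by a translation between equally labelled vertices, which is a deck transformation.\<close>

lemma star_map_bary:
  assumes "0 < bary r $ b"
  obtains i j where "lab (i, j) = b" "r = (of_int i, of_int j) + star_map b (bary r)"
proof (cases rule: pl_cases[where r = r and 'v = "real^8" and 'w = "real^8"])
  note lin = linear_add[OF linear_star_map] linear_scale[OF linear_star_map]
  {
    case (lower i j t s)
    define a where "a = lab (i, j)"
    have x: "bary r = (1 - t - s) *\<^sub>R axis a 1 + t *\<^sub>R axis (a + 1) 1 + s *\<^sub>R axis (a + 3) 1"
      by (simp only: bary_def lower(5) lab_steps a_def)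
    consider "b = a" | "b = a + 1" | "b = a + 3"
      using assms unfolding x by (auto simp: axis_def split: if_splits)
    then show ?thesis
    proof cases
      case 1
      have e: "axis a 1 = axis (b + 0) 1" "axis (a + 1) 1 = axis (b + 1) 1" "axis (a + 3) 1 = axis (b + 3) 1"
        unfolding 1 by (simp_all add: algebra_simps)
      have st: "star_map b (bary r) = (1 - t - s) *\<^sub>R dir 0 + t *\<^sub>R dir 1 + s *\<^sub>R dir 3"
        unfolding x e lin star_map_axis star_map_axis' ..
      show ?thesis
      proof (rule that[of i j])
        show "lab (i, j) = b" using 1 by (simp add: lab_steps a_def add.assoc)
        show "r = (of_int (i), of_int (j)) + star_map b (bary r)"
          unfolding st dir_simps by (subst lower(1)) (simp add: zero_prod_def algebra_simps)
      qed
    next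
      case 2
      have e: "axis a 1 = axis (b - 1) 1" "axis (a + 1) 1 = axis (b + 0) 1" "axis (a + 3) 1 = axis (b + 2) 1"
        unfolding 2 by (simp_all add: algebra_simps)
      have st: "star_map b (bary r) = (1 - t - s) *\<^sub>R dir (- 1) + t *\<^sub>R dir 0 + s *\<^sub>R dir 2"
        unfolding x e lin star_map_axis star_map_axis' ..
      show ?thesis
      proof (rule that[of "i + 1" j])
        show "lab (i + 1, j) = b" using 2 by (simp add: lab_steps a_def add.assoc)
        show "r = (of_int (i + 1), of_int (j)) + star_map b (bary r)"
          unfolding st dir_simps by (subst lower(1)) (simp add: zero_prod_def algebra_simps)
      qed
    next
      case 3
      have e: "axis a 1 = axis (b - 3) 1" "axis (a + 1) 1 = axis (b - 2) 1" "axis (a + 3) 1 = axis (b + 0) 1"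
        unfolding 3 by (simp_all add: algebra_simps)
      have st: "star_map b (bary r) = (1 - t - s) *\<^sub>R dir (- 3) + t *\<^sub>R dir (- 2) + s *\<^sub>R dir 0"
        unfolding x e lin star_map_axis star_map_axis' ..
      show ?thesis
      proof (rule that[of i "j + 1"])
        show "lab (i, j + 1) = b" using 3 by (simp add: lab_steps a_def add.assoc)
        show "r = (of_int (i), of_int (j + 1)) + star_map b (bary r)"
          unfolding st dir_simps by (subst lower(1)) (simp add: zero_prod_def algebra_simps)
      qed
    qed
  next
    case (upper i j t s)
    define a where "a = lab (i, j)"
    have x: "bary r = (1 - t - s) *\<^sub>R axis (a + 4) 1 + t *\<^sub>R axis (a + 3) 1 + s *\<^sub>R axis (a + 1) 1"
      by (simp only: bary_def upper(5) lab_steps a_def) (simp add: add.assoc)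
    consider "b = a + 4" | "b = a + 3" | "b = a + 1"
      using assms unfolding x by (auto simp: axis_def split: if_splits)
    then show ?thesis
    proof cases
      case 1
      have e: "axis (a + 4) 1 = axis (b + 0) 1" "axis (a + 3) 1 = axis (b - 1) 1" "axis (a + 1) 1 = axis (b - 3) 1"
        unfolding 1 by (simp_all add: algebra_simps)
      have st: "star_map b (bary r) = (1 - t - s) *\<^sub>R dir 0 + t *\<^sub>R dir (- 1) + s *\<^sub>R dir (- 3)"
        unfolding x e lin star_map_axis star_map_axis' ..
      show ?thesis
      proof (rule that[of "i + 1" "j + 1"])
        show "lab (i + 1, j + 1) = b" using 1 by (simp add: lab_steps a_def add.assoc)
        show "r = (of_int (i + 1), of_int (j + 1)) + star_map b (bary r)"
          unfolding st dir_simps by (subst upper(1)) (simp add: zero_prod_def algebra_simps)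
      qed
    next
      case 2
      have e: "axis (a + 4) 1 = axis (b + 1) 1" "axis (a + 3) 1 = axis (b + 0) 1" "axis (a + 1) 1 = axis (b - 2) 1"
        unfolding 2 by (simp_all add: algebra_simps)
      have st: "star_map b (bary r) = (1 - t - s) *\<^sub>R dir 1 + t *\<^sub>R dir 0 + s *\<^sub>R dir (- 2)"
        unfolding x e lin star_map_axis star_map_axis' ..
      show ?thesis
      proof (rule that[of i "j + 1"])
        show "lab (i, j + 1) = b" using 2 by (simp add: lab_steps a_def add.assoc)
        show "r = (of_int (i), of_int (j + 1)) + star_map b (bary r)"
          unfolding st dir_simps by (subst upper(1)) (simp add: zero_prod_def algebra_simps)
      qed
    next
      case 3
      have e: "axis (a + 4) 1 = axis (b + 3) 1" "axis (a + 3) 1 = axis (b + 2) 1" "axis (a + 1) 1 = axis (b + 0) 1"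
        unfolding 3 by (simp_all add: algebra_simps)
      have st: "star_map b (bary r) = (1 - t - s) *\<^sub>R dir 3 + t *\<^sub>R dir 2 + s *\<^sub>R dir 0"
        unfolding x e lin star_map_axis star_map_axis' ..
      show ?thesis
      proof (rule that[of "i + 1" j])
        show "lab (i + 1, j) = b" using 3 by (simp add: lab_steps a_def add.assoc)
        show "r = (of_int (i + 1), of_int (j)) + star_map b (bary r)"
          unfolding st dir_simps by (subst upper(1)) (simp add: zero_prod_def algebra_simps)
      qed
    qed
  }
qed

lemma pl_const: "pl (\<lambda>_. c) r = c"
  by (simp add: pl_def cell_def algebra_simps)

lemma bary_nonneg: "0 \<le> bary r $ i"
proof (cases rule: pl_cases[where r = r and 'v = "real^8" and 'w = "real^8"])
  case (lower i j t s)
  show ?thesis unfolding bary_def lower(5) using lower(2-4) by (auto simp: axis_def)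
next
  case (upper i j t s)
  show ?thesis unfolding bary_def upper(5) using upper(2-4) by (auto simp: axis_def)
qed

lemma sum_bary: "sum (($) (bary r)) UNIV = 1"
proof -
  have "linear (\<lambda>x :: real^8. sum (($) x) UNIV)"
    by (rule linearI) (simp_all add: sum.distrib sum_distrib_left)
  then have "sum (($) (bary r)) UNIV = pl ((\<lambda>x. sum (($) x) UNIV) \<circ> (\<lambda>v. axis (lab v) 1)) r"
    unfolding bary_def by (rule linear_pl)
  also have "(\<lambda>x. sum (($) x) UNIV) \<circ> (\<lambda>v. axis (lab v) (1::real)) = (\<lambda>_. 1)"
    by (auto simp: fun_eq_iff axis_def)
  finally show ?thesis by (simp only: pl_const)
qed

lemma bary_eqE:
  assumes "bary r = bary r'"
  obtains m n where "r' = r + (of_int (3 * m - n), of_int (3 * n - m))"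
proof -
  obtain b where b: "0 < bary r $ b"
    using sum_bary[of r] bary_nonneg[of r] by (metis less_eq_real_def order_refl sum_nonpos zero_less_one not_less)
  obtain i j where 1: "lab (i, j) = b" "r = (of_int i, of_int j) + star_map b (bary r)"
    using star_map_bary[OF b] .
  obtain i' j' where 2: "lab (i', j') = b" "r' = (of_int i', of_int j') + star_map b (bary r)"
  proof -
    have "0 < bary r' $ b" using b assms by simp
    from star_map_bary[OF this] that show ?thesis unfolding assms by blast
  qed
  have "lab (i, j) = lab (i', j')" using 1 2 by simp
  then obtain m n where mn: "i' = i + 3 * m - n" "j' = j - m + 3 * n"
    by (rule lab_eqE)
  have "r' = r + (of_int (3 * m - n), of_int (3 * n - m))"
    by (subst 2(2), subst 1(2)) (simp add: mn)
  then show ?thesis using that by blast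
qed

lemma bary_shift: "bary (r + (of_int (3 * m - n), of_int (3 * n - m))) = bary r"
  using pl_periodic by (cases r) (simp add: bary_eq_pl)

lemma range_bary: "range bary = realization"
proof
  show "range bary \<subseteq> realization"
  proof
    fix x assume "x \<in> range bary"
    then obtain r where r: "x = bary r" by auto
    have "\<exists>t\<in>K. \<forall>i. i \<notin> t \<longrightarrow> x $ i = 0"
    proof (cases rule: pl_cases[where r = r and 'v = "real^8" and 'w = "real^8"])
      case (lower i j t s)
      have "{lab (i, j), lab (i, j) + 1, lab (i, j) + 3} \<in> K" unfolding K_def by blast
      then show ?thesis unfolding r bary_def lower(5) lab_steps by (rule bexI[rotated]) (auto simp: axis_def)
    next
      case (upper i j t s)
      have "{lab (i, j) + 1, lab (i, j) + 1 + 2, lab (i, j) + 1 + 3} \<in> K" unfolding K_def by blast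
      then show ?thesis unfolding r bary_def upper(5) lab_steps by (rule bexI[rotated]) (auto simp: axis_def)
    qed
    then show "x \<in> realization"
      unfolding mem_realization_iff using bary_nonneg sum_bary r by blast
  qed
next
  show "realization \<subseteq> range bary"
  proof
    fix x assume "x \<in> realization"
    then obtain t where t: "t \<in> K" "\<And>i. 0 \<le> x $ i" "\<And>i. i \<notin> t \<Longrightarrow> x $ i = 0" "sum (($) x) UNIV = 1"
      unfolding mem_realization_iff by blast
    from t(1) obtain a where a: "t = {a, a + 1, a + 3} \<or> t = {a, a + 2, a + 3}" unfolding K_def by blast
    obtain z where z: "a = of_int z" by (cases a) auto
    from a show "x \<in> range bary"
    proof
      assume ta: "t = {a, a + 1, a + 3}"
      have "sum (($) x) UNIV = sum (($) x) t" by (rule sum.mono_neutral_right) (use t in auto)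
      then have s: "x $ a + x $ (a + 1) + x $ (a + 3) = 1" using t(4) by (simp add: ta add.assoc)
      have "bary (of_int z + x $ (a + 1), of_int 0 + x $ (a + 3)) =
          x $ a *\<^sub>R axis (lab (z, 0)) 1 + x $ (a + 1) *\<^sub>R axis (lab (z, 0) + 1) 1 + x $ (a + 3) *\<^sub>R axis (lab (z, 0) + 3) 1"
        unfolding bary_def lab_steps[symmetric] by (rule pl_lower) (use t s in auto)
      also have "lab (z, 0) = a" by (simp add: lab_def z)
      also have "x $ a *\<^sub>R axis a 1 + x $ (a + 1) *\<^sub>R axis (a + 1) 1 + x $ (a + 3) *\<^sub>R axis (a + 3) 1 = x"
        using t(3) by (auto simp: vec_eq_iff axis_def ta)
      finally show ?thesis by (metis rangeI)
    next
      assume ta: "t = {a, a + 2, a + 3}"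
      have "sum (($) x) UNIV = sum (($) x) t" by (rule sum.mono_neutral_right) (use t in auto)
      then have s: "x $ (a + 3) + x $ (a + 2) + x $ a = 1" using t(4) by (simp add: ta add_ac)
      have "bary (of_int (z - 1) + 1 - x $ (a + 2), of_int 0 + 1 - x $ a) =
          x $ (a + 3) *\<^sub>R axis (lab (z - 1, 0) + 4) 1 + x $ (a + 2) *\<^sub>R axis (lab (z - 1, 0) + 3) 1 + x $ a *\<^sub>R axis (lab (z - 1, 0) + 1) 1"
        unfolding bary_def lab_steps[symmetric] by (rule pl_upper) (use t s in auto)
      also have "lab (z - 1, 0) = a - 1" by (simp add: lab_def z)
      also have "x $ (a + 3) *\<^sub>R axis (a - 1 + 4) 1 + x $ (a + 2) *\<^sub>R axis (a - 1 + 3) 1 + x $ a *\<^sub>R axis (a - 1 + 1) 1 = x"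
      proof -
        have e: "a - 1 + 4 = a + 3" "a - 1 + 3 = a + 2" "a - 1 + 1 = a" by simp_all
        show ?thesis unfolding e using t(3) by (auto simp: vec_eq_iff axis_def ta)
      qed
      finally show ?thesis by (metis rangeI)
    qed
  qed
qed

section \<open>The developed map\<close>

lemma torus_point_mem: "w \<in> torus_point L z \<longleftrightarrow> (\<exists>m n :: int. w = z + of_int m * fst L + of_int n * snd L)"
  by (auto simp: torus_point_def)

lemma torus_point_eq_iff:
  "torus_point L z = torus_point L z' \<longleftrightarrow> (\<exists>m n :: int. z' = z + of_int m * fst L + of_int n * snd L)"
proof
  assume "torus_point L z = torus_point L z'"
  moreover have "z' \<in> torus_point L z'"
    unfolding torus_point_mem by (rule exI[of _ 0], rule exI[of _ 0]) simp
  ultimately have "z' \<in> torus_point L z" by simp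
  then show "\<exists>m n :: int. z' = z + of_int m * fst L + of_int n * snd L"
    by (simp only: torus_point_mem)
next
  assume "\<exists>m n :: int. z' = z + of_int m * fst L + of_int n * snd L"
  then obtain m n :: int where z': "z' = z + of_int m * fst L + of_int n * snd L" by blast
  have "w \<in> torus_point L z \<longleftrightarrow> w \<in> torus_point L z'" for w
  proof
    assume "w \<in> torus_point L z"
    then obtain k l :: int where "w = z + of_int k * fst L + of_int l * snd L" by (auto simp: torus_point_mem)
    then show "w \<in> torus_point L z'" unfolding torus_point_mem
      by (intro exI[of _ "k - m"] exI[of _ "l - n"]) (simp add: z' algebra_simps)
  next
    assume "w \<in> torus_point L z'"
    then obtain k l :: int where "w = z' + of_int k * fst L + of_int l * snd L" by (auto simp: torus_point_mem)
    then show "w \<in> torus_point L z" unfolding torus_point_mem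
      by (intro exI[of _ "k + m"] exI[of _ "l + n"]) (simp add: z' algebra_simps)
  qed
  then show "torus_point L z = torus_point L z'" by blast
qed

lemma oriented_basis_nonzero: "oriented_basis L \<Longrightarrow> fst L \<noteq> 0"
  by (auto simp: oriented_basis_def)

lemma oriented_basis_independent:
  assumes "oriented_basis L" "a *\<^sub>R fst L + b *\<^sub>R snd L = 0"
  shows "a = 0" "b = 0"
proof -
  define w where "w = snd L / fst L"
  have "a *\<^sub>R fst L + b *\<^sub>R snd L = fst L * (of_real a + of_real b * w)"
    using oriented_basis_nonzero[OF assms(1)] by (simp add: w_def field_simps scaleR_conv_of_real)
  then have *: "of_real a + of_real b * w = 0"
    using assms oriented_basis_nonzero by auto
  from arg_cong[OF *, of Im] have "b * Im w = 0" by simp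
  then show "b = 0" using assms(1) by (auto simp: oriented_basis_def w_def)
  with * show "a = 0" by simp
qed

text \<open>The development is a linear isomorphism plus the bounded term
  \<open>pl (\<zeta> \<circ> lab)\<close>, and \<open>N\<close> inverts the isomorphism. Bounded
  distance from the identity yields surjectivity and properness whatever \<open>\<zeta>\<close>
  is.\<close>

lemma pl_dev_near_linear:
  assumes "oriented_basis L"
  obtains N C where "linear N" "inj N" "C > 0" "\<And>r. norm (N (pl (dev L \<zeta>) r) - r) \<le> (C::real)"
proof -
  define M where "M r = - ((3 * fst r + snd r) / 8) *\<^sub>R fst L + ((fst r + 3 * snd r) / 8) *\<^sub>R snd L" for r :: "real \<times> real"
  have linM: "linear M"
    by (rule linearI) (simp_all add: M_def algebra_simps add_divide_distrib)
  have "inj M"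
    unfolding linear_injective_0[OF linM]
  proof (intro allI impI)
    fix r assume "M r = 0"
    then have "3 * fst r + snd r = 0" "fst r + 3 * snd r = 0"
      using oriented_basis_independent[OF assms, of "- ((3 * fst r + snd r) / 8)" "(fst r + 3 * snd r) / 8"] by (simp_all add: M_def)
    then show "r = 0" by (simp add: prod_eq_iff)
  qed
  then obtain N where N: "linear N" "\<And>x. N (M x) = x" "\<And>x. M (N x) = x"
    using linear_injective_isomorphism[OF linM] by auto
  obtain B where B: "B > 0" "\<And>x. norm (N x) \<le> norm x * B"
    using linear_bounded_pos[OF N(1)] by (metis mult.commute)
  have dec: "pl (dev L \<zeta>) r = pl (\<zeta> \<circ> lab) r + M r" for r
  proof -
    have "M r = pl (\<lambda>(i, j). of_int i *\<^sub>R M (1, 0) + of_int j *\<^sub>R M (0, 1)) (fst r, snd r)"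
      unfolding pl_linear by (simp flip: linear_scale[OF linM] linear_add[OF linM])
    also have "\<dots> = pl (\<lambda>v. M (of_int (fst v), of_int (snd v))) r"
      by (rule arg_cong2[where f = pl]) (auto simp: fun_eq_iff simp flip: linear_scale[OF linM] linear_add[OF linM])
    finally have "pl (\<zeta> \<circ> lab) r + M r = pl (\<lambda>v. (\<zeta> \<circ> lab) v + M (of_int (fst v), of_int (snd v))) r"
      by (simp only: pl_add)
    also have "(\<lambda>v. (\<zeta> \<circ> lab) v + M (of_int (fst v), of_int (snd v))) = dev L \<zeta>"
      by (auto simp: fun_eq_iff dev_def M_def)
    finally show ?thesis ..
  qed
  define C where "C = Max (range (\<lambda>i. norm (\<zeta> i))) + 1"
  have C: "norm (\<zeta> i) \<le> C" for i
    unfolding C_def by (rule order_trans[OF Max_ge[of "range (\<lambda>i. norm (\<zeta> i))"]]) auto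
  have C': "norm (pl (\<zeta> \<circ> lab) r) \<le> C" for r
    by (rule norm_pl_le) (simp add: C)
  have "C > 0" using C[of 0] norm_ge_zero[of "\<zeta> 0"] unfolding C_def
    by (metis C_def Max_ge add_strict_increasing2 finite_imageI finite order.trans rangeI zero_less_one)
  show ?thesis
  proof (rule that[of N "C * B"])
    show "linear N" by (rule N)
    show "inj N" by (metis N(3) injI)
    show "0 < C * B" using \<open>C > 0\<close> B(1) by simp
    show "norm (N (pl (dev L \<zeta>) r) - r) \<le> C * B" for r
    proof -
      have "norm (N (pl (dev L \<zeta>) r) - r) = norm (N (pl (\<zeta> \<circ> lab) r))"
        by (simp add: dec linear_add[OF N(1)] N(2))
      also have "\<dots> \<le> norm (pl (\<zeta> \<circ> lab) r) * B" by (rule B)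
      also have "\<dots> \<le> C * B" using C' B by (intro mult_right_mono) auto
      finally show ?thesis .
    qed
  qed
qed

lemma surj_pl_dev:
  assumes "oriented_basis L"
  shows "surj (pl (dev L \<zeta>))"
proof -
  obtain N C where N: "linear N" "inj N" "C > 0" "\<And>r. norm (N (pl (dev L \<zeta>) r) - r) \<le> C"
    using pl_dev_near_linear[OF assms, where \<zeta> = \<zeta>] by metis
  have "\<exists>r. pl (dev L \<zeta>) r = z" for z
  proof -
    define f where "f r = N (pl (dev L \<zeta>) r)" for r
    have "\<exists>r\<in>cball (N z) C. f r = N z"
    proof (rule brouwer_surjective_cball[where S = "{N z}"])
      show "continuous_on (cball (N z) C) f"
        unfolding f_def using linear_continuous_on[OF linear_conv_bounded_linear[THEN iffD1, OF N(1)]]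
        by (intro continuous_on_compose2[OF _ continuous_on_pl_bounded]) auto
      show "x + (r - f r) \<in> cball (N z) C" if "x \<in> {N z}" for x r
        using that N(4)[of r] by (simp add: f_def dist_norm algebra_simps)
    qed (use N in auto)
    then obtain r where "N (pl (dev L \<zeta>) r) = N z" by (auto simp: f_def)
    then show ?thesis using N(2) by (metis injD)
  qed
  then show ?thesis unfolding surj_def by metis
qed

lemma pl_dev_proper:
  assumes "oriented_basis L"
  obtains B where "\<And>r. norm r \<le> B * (norm (pl (dev L \<zeta>) r) + B)"
proof -
  obtain N C where N: "linear N" "inj N" "C > 0" "\<And>r. norm (N (pl (dev L \<zeta>) r) - r) \<le> C"
    using pl_dev_near_linear[OF assms, where \<zeta> = \<zeta>] by metis
  obtain K where K: "K > 0" "\<And>x. norm (N x) \<le> K * norm x"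
    using linear_bounded_pos[OF N(1)] by metis
  show ?thesis
  proof (rule that[of "K + C + 1"])
    fix r
    have "norm r \<le> norm (N (pl (dev L \<zeta>) r)) + norm (N (pl (dev L \<zeta>) r) - r)"
      using norm_triangle_ineq4[of "N (pl (dev L \<zeta>) r)" "N (pl (dev L \<zeta>) r) - r"] by simp
    also have "\<dots> \<le> K * norm (pl (dev L \<zeta>) r) + C" using K(2) N(4) by (intro add_mono)
    also have "\<dots> \<le> (K + C + 1) * norm (pl (dev L \<zeta>) r) + (K + C + 1) * 1"
      using K(1) N(3) by (intro add_mono mult_right_mono) auto
    also have "\<dots> \<le> (K + C + 1) * (norm (pl (dev L \<zeta>) r) + (K + C + 1))"
      using K(1) N(3) by (simp add: distrib_left)
    finally show "norm r \<le> (K + C + 1) * (norm (pl (dev L \<zeta>) r) + (K + C + 1))" .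
  qed
qed

section \<open>Lengths of paths under piecewise isometric maps\<close>

fun csum :: "('a \<Rightarrow> 'a \<Rightarrow> real) \<Rightarrow> 'a list \<Rightarrow> real" where
  "csum d (x # y # zs) = d x y + csum d (y # zs)"
| "csum d zs = 0"

lemma csum_eq: "csum d ts = (\<Sum>i<length ts - 1. d (ts ! i) (ts ! Suc i))"
proof (induction d ts rule: csum.induct)
  case (1 d x y zs)
  then show ?case by (simp add: sum.lessThan_Suc_shift del: sum.lessThan_Suc)
qed simp_all

lemma csum_append: "xs \<noteq> [] \<Longrightarrow> csum d (xs @ ys) = csum d xs + csum d (last xs # ys)"
proof (induction d xs rule: csum.induct)
  case ("2_2" d v)
  then show ?case by (cases ys) auto
qed auto

lemma csum_cong_successively:
  "successively P ts \<Longrightarrow> (\<And>x y. P x y \<Longrightarrow> x \<in> set ts \<Longrightarrow> y \<in> set ts \<Longrightarrow> d x y = d' x y) \<Longrightarrow> csum d ts = csum d' ts"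
proof (induction d ts rule: csum.induct)
  case (1 d x y zs)
  have "csum d (y # zs) = csum d' (y # zs)"
    by (rule 1(1)) (use 1(2,3) in auto)
  then show ?case using 1(2,3) by auto
qed auto

lemma csum_triangle: "ts \<noteq> [] \<Longrightarrow> dist (\<gamma> (hd ts)) (\<gamma> (last ts)) \<le> csum (\<lambda>x y. dist (\<gamma> x) (\<gamma> y)) ts"
proof (induction "\<lambda>x y. dist (\<gamma> x) (\<gamma> y)" ts rule: csum.induct)
  case (1 x y zs)
  then show ?case using dist_triangle[of "\<gamma> x" "\<gamma> (last (y # zs))" "\<gamma> y"] by auto
qed auto

lemma path_length_eq: "path_length \<gamma> = (SUP ts \<in> {ts. sorted ts \<and> set ts \<subseteq> {0..1}}. ereal (csum (\<lambda>x y. dist (\<gamma> x) (\<gamma> y)) ts))"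
  by (simp add: path_length_def csum_eq)

lemma path_length_mono:
  assumes refine: "\<And>s t. 0 \<le> s \<Longrightarrow> s \<le> t \<Longrightarrow> t \<le> 1 \<Longrightarrow> \<exists>us. us \<noteq> [] \<and> hd us = s \<and> last us = t \<and> sorted us \<and>
      dist (\<gamma> s) (\<gamma> t) \<le> csum (\<lambda>x y. dist (\<gamma>' x) (\<gamma>' y)) us"
  shows "path_length \<gamma> \<le> path_length \<gamma>'"
proof -
  have "\<exists>us. sorted us \<and> set us \<subseteq> {0..1} \<and> (ts \<noteq> [] \<longrightarrow> us \<noteq> [] \<and> hd us = hd ts) \<and>
      csum (\<lambda>x y. dist (\<gamma> x) (\<gamma> y)) ts \<le> csum (\<lambda>x y. dist (\<gamma>' x) (\<gamma>' y)) us"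
    if "sorted ts" "set ts \<subseteq> {0..1}" for ts
    using that
  proof (induction "\<lambda>x y. dist (\<gamma> x) (\<gamma> y)" ts rule: csum.induct)
    case (1 x y zs)
    then obtain us where us: "sorted us" "set us \<subseteq> {0..1}" "us \<noteq> []" "hd us = y"
        "csum (\<lambda>x y. dist (\<gamma> x) (\<gamma> y)) (y # zs) \<le> csum (\<lambda>x y. dist (\<gamma>' x) (\<gamma>' y)) us"
      by auto
    have "0 \<le> x" "x \<le> y" "y \<le> 1" using 1 by auto
    from refine[OF this] obtain vs where vs: "vs \<noteq> []" "hd vs = x" "last vs = y" "sorted vs"
        "dist (\<gamma> x) (\<gamma> y) \<le> csum (\<lambda>x y. dist (\<gamma>' x) (\<gamma>' y)) vs" by blast
    have bounds: "x \<le> v \<and> v \<le> y" if v: "v \<in> set vs" for v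
    proof -
      obtain k where "k < length vs" "v = vs ! k" using v by (auto simp: in_set_conv_nth)
      then show ?thesis using vs(1-4) sorted_nth_mono[OF vs(4), of 0 k] sorted_nth_mono[OF vs(4), of k "length vs - 1"]
        by (simp add: hd_conv_nth last_conv_nth)
    qed
    obtain us' where us': "us = y # us'" using us by (cases us) auto
    have "sorted (vs @ us')"
      using vs us(1) bounds unfolding sorted_append us' by force
    moreover have "set (vs @ us') \<subseteq> {0..1}"
      using us(2) us' bounds \<open>0 \<le> x\<close> \<open>y \<le> 1\<close> by force
    moreover have "hd (vs @ us') = x" using vs by simp
    moreover have "csum (\<lambda>x y. dist (\<gamma> x) (\<gamma> y)) (x # y # zs) \<le> csum (\<lambda>x y. dist (\<gamma>' x) (\<gamma>' y)) (vs @ us')"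
      using vs us us' by (simp add: csum_append)
    ultimately show ?case using vs(1) by (intro exI[of _ "vs @ us'"]) auto
  next
    case "2_1"
    then show ?case by (intro exI[of _ "[]"]) auto
  next
    case ("2_2" v)
    then show ?case by (intro exI[of _ "[v]"]) auto
  qed
  then show ?thesis
    unfolding path_length_eq by (intro SUP_mono) force
qed

text \<open>
  Leaving each set for the last time, a path visits finitely many closed sets that cover it in
  finitely many steps, whatever it does in between.
\<close>

lemma closed_cover_chain:
  fixes \<gamma> :: "real \<Rightarrow> 'a::topological_space"
  assumes "finite I" "\<And>i. i \<in> I \<Longrightarrow> closed (S i)" "s \<le> t" "continuous_on {s..t} \<gamma>" "\<gamma> ` {s..t} \<subseteq> (\<Union>i\<in>I. S i)"
  shows "\<exists>us. us \<noteq> [] \<and> hd us = s \<and> last us = t \<and> sorted us \<and> set us \<subseteq> {s..t} \<and>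
    successively (\<lambda>x y. \<exists>i\<in>I. \<gamma> x \<in> S i \<and> \<gamma> y \<in> S i) us"
  using assms
proof (induction "card I" arbitrary: I s)
  case 0
  then show ?case by auto
next
  case (Suc n)
  have "\<gamma> s \<in> \<gamma> ` {s..t}" using Suc.prems(3) by simp
  then obtain i where i: "i \<in> I" "\<gamma> s \<in> S i" using Suc.prems(5) by blast
  define A where "A = {x \<in> {s..t}. \<gamma> x \<in> S i}"
  have "closed A"
    unfolding A_def using continuous_closed_preimage[OF Suc.prems(4) closed_atLeastAtMost Suc.prems(2)[OF i(1)]]
    by (simp add: vimage_def Int_def)
  have "s \<in> A" using i Suc.prems by (simp add: A_def)
  have bdd: "bdd_above A" unfolding A_def by (auto intro: bdd_aboveI[of _ t])
  define u where "u = Sup A"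
  have "u \<in> A" unfolding u_def using closed_contains_Sup[OF _ bdd \<open>closed A\<close>] \<open>s \<in> A\<close> by blast
  have after: "\<gamma> x \<notin> S i" if "u < x" "x \<le> t" for x
  proof
    assume "\<gamma> x \<in> S i"
    then have "x \<in> A" using that \<open>u \<in> A\<close> by (auto simp: A_def)
    then show False using cSup_upper[OF _ bdd, of x] that by (simp add: u_def)
  qed
  have u: "s \<le> u" "u \<le> t" "\<gamma> u \<in> S i" using \<open>u \<in> A\<close> by (auto simp: A_def)
  show ?case
  proof (cases "u = t")
    case True
    then show ?thesis using u i Suc.prems(3) by (intro exI[of _ "[s, t]"]) auto
  next
    case False
    have "u < t" using u False by simp
    have cont: "continuous_on {u..t} \<gamma>" using Suc.prems(4) u by (auto intro: continuous_on_subset)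
    have cl: "closed (\<Union>j\<in>I - {i}. S j)" using Suc.prems by (intro closed_UN) auto
    have sub: "\<gamma> ` {u<..t} \<subseteq> (\<Union>j\<in>I - {i}. S j)"
    proof
      fix y assume "y \<in> \<gamma> ` {u<..t}"
      then obtain x where "u < x" "x \<le> t" "y = \<gamma> x" by auto
      moreover then have "x \<in> {s..t}" using u by simp
      then have "\<gamma> x \<in> (\<Union>j\<in>I. S j)" using Suc.prems(5) by blast
      ultimately show "y \<in> (\<Union>j\<in>I - {i}. S j)" using after by auto
    qed
    \<comment> \<open>The point \<open>u\<close> is itself a limit of later points, so by closedness
      it also lies in one of the other sets and can start the remaining chain.\<close>
    have "closure {u<..t} = {u..t}" using \<open>u < t\<close> by simp
    then have "\<gamma> ` {u..t} \<subseteq> (\<Union>j\<in>I - {i}. S j)"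
      using image_closure_subset[of "{u<..t}" \<gamma> "\<Union>j\<in>I - {i}. S j"] cont cl sub by simp
    then obtain us where us: "us \<noteq> []" "hd us = u" "last us = t" "sorted us" "set us \<subseteq> {u..t}"
        "successively (\<lambda>x y. \<exists>j\<in>I - {i}. \<gamma> x \<in> S j \<and> \<gamma> y \<in> S j) us"
    proof -
      have "n = card (I - {i})"
        using Suc.hyps(2) i Suc.prems(1) by (metis card_Diff_singleton diff_Suc_1)
      from Suc.hyps(1)[OF this, of u] show ?thesis
        using that Suc.prems(1,2) u cont \<open>\<gamma> ` {u..t} \<subseteq> (\<Union>j\<in>I - {i}. S j)\<close> by auto
    qed
    have "successively (\<lambda>x y. \<exists>j\<in>I. \<gamma> x \<in> S j \<and> \<gamma> y \<in> S j) us"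
      using us(6) by (rule successively_mono) auto
    then have "successively (\<lambda>x y. \<exists>j\<in>I. \<gamma> x \<in> S j \<and> \<gamma> y \<in> S j) (s # us)"
      using us(1,2) i u by (cases us) auto
    then show ?thesis using us u by (intro exI[of _ "s # us"]) auto
  qed
qed

locale piecewise_isometry =
  fixes I :: "'i set" and S :: "'i \<Rightarrow> 'a::metric_space set" and f :: "'a \<Rightarrow> 'b::metric_space" and \<gamma> :: "real \<Rightarrow> 'a"
  assumes finite: "finite I" and closed: "\<And>i. i \<in> I \<Longrightarrow> closed (S i)"
    and path: "path \<gamma>" and cover: "path_image \<gamma> \<subseteq> (\<Union>i\<in>I. S i)"
    and isometry: "\<And>i x y. i \<in> I \<Longrightarrow> x \<in> S i \<Longrightarrow> y \<in> S i \<Longrightarrow> dist (f x) (f y) = dist x y"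
begin

lemma chain:
  assumes "0 \<le> s" "s \<le> t" "t \<le> 1"
  obtains us where "us \<noteq> []" "hd us = s" "last us = t" "sorted us"
    "csum (\<lambda>x y. dist (\<gamma> x) (\<gamma> y)) us = csum (\<lambda>x y. dist ((f \<circ> \<gamma>) x) ((f \<circ> \<gamma>) y)) us"
proof -
  have "continuous_on {s..t} \<gamma>"
    using path assms by (auto simp: path_def intro: continuous_on_subset)
  moreover have "\<gamma> ` {s..t} \<subseteq> (\<Union>i\<in>I. S i)"
    using cover assms by (auto simp: path_image_def)
  ultimately obtain us where us: "us \<noteq> []" "hd us = s" "last us = t" "sorted us"
      "successively (\<lambda>x y. \<exists>i\<in>I. \<gamma> x \<in> S i \<and> \<gamma> y \<in> S i) us"
    using closed_cover_chain[of I S s t \<gamma>] finite closed assms by auto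
  show ?thesis
    using us by (intro that[of us] csum_cong_successively[OF us(5)]) (auto simp: isometry)
qed

text \<open>Every interval of a partition is refined by a chain on which \<open>f\<close> preserves
  each step; the triangle inequality, applied on either side, compares the lengths both
  ways.\<close>

lemma path_length_image: "path_length (f \<circ> \<gamma>) = path_length \<gamma>"
proof (rule antisym)
  show "path_length (f \<circ> \<gamma>) \<le> path_length \<gamma>"
  proof (rule path_length_mono)
    fix s t :: real assume "0 \<le> s" "s \<le> t" "t \<le> 1"
    then obtain us where us: "us \<noteq> []" "hd us = s" "last us = t" "sorted us"
      "csum (\<lambda>x y. dist (\<gamma> x) (\<gamma> y)) us = csum (\<lambda>x y. dist ((f \<circ> \<gamma>) x) ((f \<circ> \<gamma>) y)) us" by (rule chain)
    then show "\<exists>us. us \<noteq> [] \<and> hd us = s \<and> last us = t \<and> sorted us \<and>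
        dist ((f \<circ> \<gamma>) s) ((f \<circ> \<gamma>) t) \<le> csum (\<lambda>x y. dist (\<gamma> x) (\<gamma> y)) us"
      using csum_triangle[OF us(1), of "f \<circ> \<gamma>"] by (intro exI[of _ us]) auto
  qed
  show "path_length \<gamma> \<le> path_length (f \<circ> \<gamma>)"
  proof (rule path_length_mono)
    fix s t :: real assume "0 \<le> s" "s \<le> t" "t \<le> 1"
    then obtain us where us: "us \<noteq> []" "hd us = s" "last us = t" "sorted us"
      "csum (\<lambda>x y. dist (\<gamma> x) (\<gamma> y)) us = csum (\<lambda>x y. dist ((f \<circ> \<gamma>) x) ((f \<circ> \<gamma>) y)) us" by (rule chain)
    then show "\<exists>us. us \<noteq> [] \<and> hd us = s \<and> last us = t \<and> sorted us \<and>
        dist (\<gamma> s) (\<gamma> t) \<le> csum (\<lambda>x y. dist ((f \<circ> \<gamma>) x) ((f \<circ> \<gamma>) y)) us"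
      using csum_triangle[OF us(1), of "\<gamma>"] by (intro exI[of _ us]) auto
  qed
qed

end

lemma csum_sorted: "sorted us \<Longrightarrow> us \<noteq> [] \<Longrightarrow> csum (\<lambda>x y. \<bar>x - y\<bar> * c) us = (last us - hd us) * (c::real)"
proof (induction "\<lambda>x y. \<bar>x - y\<bar> * c" us rule: csum.induct)
  case (1 x y zs)
  then have "x \<le> y" by auto
  then show ?case using 1 by (simp add: algebra_simps)
qed auto

text \<open>On a straight segment the steps of the chain add up to exactly
  \<open>dist x y\<close>.\<close>

lemma piecewise_isometry_segment:
  fixes x y :: "'a::real_normed_vector"
  assumes "piecewise_isometry I S f (linepath x y)"
  shows "dist (f x) (f y) \<le> dist x y"
proof -
  interpret piecewise_isometry I S f "linepath x y" by fact
  obtain us where us: "us \<noteq> []" "hd us = 0" "last us = 1" "sorted us"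
      "csum (\<lambda>s t. dist (linepath x y s) (linepath x y t)) us = csum (\<lambda>s t. dist ((f \<circ> linepath x y) s) ((f \<circ> linepath x y) t)) us"
    by (rule chain[of 0 1]) auto
  have "dist (linepath x y s) (linepath x y t) = \<bar>s - t\<bar> * dist x y" for s t
  proof -
    have "linepath x y s - linepath x y t = (s - t) *\<^sub>R (y - x)"
      by (simp add: linepath_def algebra_simps)
    then show ?thesis by (simp add: dist_norm norm_minus_commute)
  qed
  then have "csum (\<lambda>s t. dist (linepath x y s) (linepath x y t)) us = dist x y"
    using csum_sorted[OF us(4,1)] us(2,3) by simp
  then show ?thesis using csum_triangle[OF us(1), of "f \<circ> linepath x y"] us by (simp add: linepath_def)
qed

section \<open>Maps that are isometric on every triangle\<close>

text \<open>By polarization three side lengths determine all inner products.\<close>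

lemma norm_linear_combination_eq:
  fixes u v :: "'a::real_inner" and u' v' :: "'b::real_inner"
  assumes "norm u = norm u'" "norm v = norm v'" "norm (u - v) = norm (u' - v')"
  shows "norm (\<alpha> *\<^sub>R u + \<beta> *\<^sub>R v) = norm (\<alpha> *\<^sub>R u' + \<beta> *\<^sub>R v')"
proof -
  have "u \<bullet> v = u' \<bullet> v'"
    using assms unfolding dot_norm_neg by simp
  moreover have "u \<bullet> u = u' \<bullet> u'" "v \<bullet> v = v' \<bullet> v'"
    using assms by (simp_all add: dot_square_norm)
  ultimately show ?thesis
    by (simp add: norm_eq_sqrt_inner inner_add_left inner_add_right inner_commute)
qed

text \<open>Equal norms carry every linear relation between \<open>u\<close> and \<open>v\<close>
  over to \<open>u'\<close> and \<open>v'\<close>. The dependent cases matter, since triangles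
  collapse over part of the boundary of the domain.\<close>

lemma linear_extension_two:
  fixes u v :: "'a::real_normed_vector" and u' v' :: "'b::real_normed_vector"
  assumes "\<And>\<alpha> \<beta>. norm (\<alpha> *\<^sub>R u + \<beta> *\<^sub>R v) = norm (\<alpha> *\<^sub>R u' + \<beta> *\<^sub>R v')"
  shows "\<exists>f. linear f \<and> f u = u' \<and> f v = v'"
proof -
  have u0: "u' = 0" if "u = 0" using assms[of 1 0] that by simp
  have v0: "v' = 0" if "v = 0" using assms[of 0 1] that by simp
  consider "u = 0" "v = 0" | "u = 0" "v \<noteq> 0" | "u \<noteq> 0" "v \<in> span {u}" | "u \<noteq> 0" "v \<notin> span {u}" by blast
  then show ?thesis
  proof cases
    case 1
    then show ?thesis using u0 v0 by (intro exI[of _ "\<lambda>_. 0"]) (auto intro: linearI)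
  next
    case 2
    then have "independent {v}" by simp
    then obtain g where g: "linear g" "\<forall>x\<in>{v}. g x = v'"
      using linear_independent_extend[of "{v}" "\<lambda>_. v'"] by blast
    then show ?thesis using 2 u0 by (intro exI[of _ g]) (auto simp: linear_0)
  next
    case 3
    then obtain k where k: "v = k *\<^sub>R u" by (auto simp: span_singleton)
    have "independent {u}" using 3 by simp
    then obtain g where g: "linear g" "\<forall>x\<in>{u}. g x = u'"
      using linear_independent_extend[of "{u}" "\<lambda>_. u'"] by blast
    have "v' = k *\<^sub>R u'" using assms[of k "-1"] k by simp
    then show ?thesis using g k by (intro exI[of _ g]) (auto simp: linear_scale)
  next
    case 4
    then have "independent {v, u}" by (simp add: independent_insert)
    moreover have "u \<noteq> v" using 4 span_base[of v "{v}"] by auto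
    ultimately obtain g where "linear g" "\<forall>x\<in>{v, u}. g x = (if x = u then u' else v')"
      using linear_independent_extend[of "{v, u}" "\<lambda>x. if x = u then u' else v'"] by blast
    then show ?thesis using \<open>u \<noteq> v\<close> by (intro exI[of _ g]) auto
  qed
qed

definition edge1 :: "basis \<Rightarrow> (8 \<Rightarrow> complex) \<Rightarrow> 8 \<Rightarrow> complex" where
  "edge1 L \<zeta> a = \<zeta> (a + 1) - \<zeta> a - (3/8) *\<^sub>R fst L + (1/8) *\<^sub>R snd L"

definition edge3 :: "basis \<Rightarrow> (8 \<Rightarrow> complex) \<Rightarrow> 8 \<Rightarrow> complex" where
  "edge3 L \<zeta> a = \<zeta> (a + 3) - \<zeta> a - (1/8) *\<^sub>R fst L + (3/8) *\<^sub>R snd L"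

lemma dev_edges:
  "dev L \<zeta> (i + 1, j) = dev L \<zeta> (i, j) + edge1 L \<zeta> (lab (i, j))"
  "dev L \<zeta> (i, j + 1) = dev L \<zeta> (i, j) + edge3 L \<zeta> (lab (i, j))"
  unfolding dev_def edge1_def edge3_def lab_steps by (simp_all add: scaleR_conv_of_real field_simps)

definition cell_triangle :: "bool \<times> int \<times> int \<Rightarrow> (real \<times> real) set" where
  "cell_triangle = (\<lambda>(lo, i, j). (if lo then (\<lambda>(b, c). (of_int i + b, of_int j + c))
      else (\<lambda>(b, c). (of_int i + 1 - b, of_int j + 1 - c))) ` {(b, c). 0 \<le> b \<and> 0 \<le> c \<and> b + c \<le> 1})"

definition cell_vertex :: "bool \<times> int \<times> int \<Rightarrow> nat \<Rightarrow> int \<times> int" where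
  "cell_vertex = (\<lambda>(lo, i, j) k. if lo then (if k = 0 then (i, j) else if k = 1 then (i + 1, j) else (i, j + 1))
      else (if k = 0 then (i + 1, j + 1) else if k = 1 then (i, j + 1) else (i + 1, j)))"

text \<open>An obtained fact has a fixed type, so the formula is given for two types of values at
  once: the plane and space.\<close>

lemma cell_triangleE:
  assumes "r \<in> cell_triangle k"
  obtains b c where "0 \<le> b" "0 \<le> c" "b + c \<le> 1"
    "\<And>P :: int \<times> int \<Rightarrow> 'v::real_vector. pl P r = P (cell_vertex k 0) + b *\<^sub>R (P (cell_vertex k 1) - P (cell_vertex k 0)) + c *\<^sub>R (P (cell_vertex k 2) - P (cell_vertex k 0))"
    "\<And>P :: int \<times> int \<Rightarrow> 'w::real_vector. pl P r = P (cell_vertex k 0) + b *\<^sub>R (P (cell_vertex k 1) - P (cell_vertex k 0)) + c *\<^sub>R (P (cell_vertex k 2) - P (cell_vertex k 0))"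
proof -
  obtain lo i j where k: "k = (lo, i, j)" by (cases k)
  show ?thesis
  proof (cases lo)
    case True
    then obtain b c where r: "r = (of_int i + b, of_int j + c)" "0 \<le> b" "0 \<le> c" "b + c \<le> 1"
      using assms by (auto simp: k cell_triangle_def)
    have nn: "0 \<le> 1 - b - c" "1 - b - c + b + c = 1" using r by auto
    note plr = pl_lower[OF nn(1) r(2,3) nn(2)]
    show ?thesis
      by (rule that[of b c]; (fact r)?; simp only: r(1) plr; simp add: k cell_vertex_def True algebra_simps)
  next
    case False
    then obtain b c where r: "r = (of_int i + 1 - b, of_int j + 1 - c)" "0 \<le> b" "0 \<le> c" "b + c \<le> 1"
      using assms by (auto simp: k cell_triangle_def)
    have nn: "0 \<le> 1 - b - c" "1 - b - c + b + c = 1" using r by auto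
    note plr = pl_upper[OF nn(1) r(2,3) nn(2)]
    show ?thesis
      by (rule that[of b c]; (fact r)?; simp only: r(1) plr; simp add: k cell_vertex_def False algebra_simps)
  qed
qed

lemma cell_triangle_combination:
  assumes "0 \<le> b" "0 \<le> c" "b + c \<le> 1"
  obtains r where "r \<in> cell_triangle k"
    "\<And>P :: int \<times> int \<Rightarrow> 'v::real_vector. pl P r = P (cell_vertex k 0) + b *\<^sub>R (P (cell_vertex k 1) - P (cell_vertex k 0)) + c *\<^sub>R (P (cell_vertex k 2) - P (cell_vertex k 0))"
    "\<And>P :: int \<times> int \<Rightarrow> 'w::real_vector. pl P r = P (cell_vertex k 0) + b *\<^sub>R (P (cell_vertex k 1) - P (cell_vertex k 0)) + c *\<^sub>R (P (cell_vertex k 2) - P (cell_vertex k 0))"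
proof -
  obtain lo i j where k: "k = (lo, i, j)" by (cases k)
  have nn: "0 \<le> 1 - b - c" "1 - b - c + b + c = 1" using assms by auto
  show ?thesis
  proof (cases lo)
    case True
    have mem: "(of_int i + b, of_int j + c) \<in> cell_triangle k"
      using assms True by (auto simp: k cell_triangle_def)
    note plr = pl_lower[OF nn(1) assms(1,2) nn(2)]
    show ?thesis
      by (rule that[OF mem]; simp only: plr; simp add: k cell_vertex_def True algebra_simps)
  next
    case False
    have mem: "(of_int i + 1 - b, of_int j + 1 - c) \<in> cell_triangle k"
      using assms False by (auto simp: k cell_triangle_def)
    note plr = pl_upper[OF nn(1) assms(1,2) nn(2)]
    show ?thesis
      by (rule that[OF mem]; simp only: plr; simp add: k cell_vertex_def False algebra_simps)
  qed
qed

lemma compact_cell_triangle: "compact (cell_triangle k)"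
proof -
  have "{(b, c). 0 \<le> b \<and> 0 \<le> c \<and> b + c \<le> 1} = ({0..1} \<times> {0..1}) \<inter> {x :: real \<times> real. fst x + snd x \<le> 1}"
    by auto
  moreover have "closed {x :: real \<times> real. fst x + snd x \<le> 1}"
    by (intro closed_Collect_le continuous_intros)
  ultimately have "compact {(b, c). 0 \<le> b \<and> 0 \<le> c \<and> b + c \<le> (1::real)}"
    by (simp add: compact_Times compact_Int_closed)
  then show ?thesis
    unfolding cell_triangle_def split_def
    by (auto intro!: compact_continuous_image continuous_intros split: if_splits)
qed

lemma cell_triangle_floor:
  obtains lo where "r \<in> cell_triangle (lo, \<lfloor>fst r\<rfloor>, \<lfloor>snd r\<rfloor>)"
proof -
  define t s where "t = frac (fst r)" "s = frac (snd r)"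
  have r: "r = (of_int \<lfloor>fst r\<rfloor> + t, of_int \<lfloor>snd r\<rfloor> + s)" by (simp add: t_s_def frac_def)
  have ts: "0 \<le> t" "t < 1" "0 \<le> s" "s < 1" by (simp_all add: t_s_def frac_lt_1)
  show ?thesis
  proof (cases "t + s \<le> 1")
    case True
    have "r \<in> cell_triangle (True, \<lfloor>fst r\<rfloor>, \<lfloor>snd r\<rfloor>)"
      unfolding cell_triangle_def split_conv if_True
      by (rule image_eqI[of _ _ "(t, s)"], unfold split_conv, rule r) (use ts True in simp)
    then show ?thesis by (rule that)
  next
    case False
    have "r \<in> cell_triangle (False, \<lfloor>fst r\<rfloor>, \<lfloor>snd r\<rfloor>)"
      unfolding cell_triangle_def split_conv if_False
    proof (rule image_eqI[of _ _ "(1 - t, 1 - s)"])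
      show "r = (case (1 - t, 1 - s) of (b, c) \<Rightarrow> (of_int \<lfloor>fst r\<rfloor> + 1 - b, of_int \<lfloor>snd r\<rfloor> + 1 - c))"
        using r by simp
    qed (use ts False in simp)
    then show ?thesis by (rule that)
  qed
qed

text \<open>When edges collapse, the development is no longer injective. What survives is
  \<open>consistent\<close>: the map to space factors through the plane.\<close>

locale flat_map =
  fixes L :: basis and \<zeta> :: "8 \<Rightarrow> complex" and p :: "real^3^8"
  assumes oriented: "oriented_basis L"
    and norm_edge1: "norm (edge1 L \<zeta> a) = dist (p $ a) (p $ (a + 1))"
    and norm_edge3: "norm (edge3 L \<zeta> a) = dist (p $ a) (p $ (a + 3))"
    and norm_edge2: "norm (edge3 L \<zeta> a - edge1 L \<zeta> a) = dist (p $ (a + 1)) (p $ (a + 3))"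
    and consistent: "pl (dev L \<zeta>) r = pl (dev L \<zeta>) r' \<Longrightarrow> pl (($) p \<circ> lab) r = pl (($) p \<circ> lab) r'"
begin

abbreviation "G \<equiv> pl (dev L \<zeta>)"
abbreviation "F \<equiv> pl (($) p \<circ> lab)"

lemma cell_edges:
  fixes k
  defines "u \<equiv> dev L \<zeta> (cell_vertex k 1) - dev L \<zeta> (cell_vertex k 0)"
    and "v \<equiv> dev L \<zeta> (cell_vertex k 2) - dev L \<zeta> (cell_vertex k 0)"
    and "u' \<equiv> p $ lab (cell_vertex k 1) - p $ lab (cell_vertex k 0)"
    and "v' \<equiv> p $ lab (cell_vertex k 2) - p $ lab (cell_vertex k 0)"
  shows "norm (\<alpha> *\<^sub>R u + \<beta> *\<^sub>R v) = norm (\<alpha> *\<^sub>R u' + \<beta> *\<^sub>R v')"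
proof -
  obtain lo i j where k: "k = (lo, i, j)" by (cases k)
  define a where "a = lab (i, j)"
  have d11: "dev L \<zeta> (i + 1, j + 1) = dev L \<zeta> (i + 1, j) + edge3 L \<zeta> (a + 1)"
    "dev L \<zeta> (i + 1, j + 1) = dev L \<zeta> (i, j + 1) + edge1 L \<zeta> (a + 3)"
    unfolding a_def using dev_edges(2)[of L \<zeta> "i + 1" j] dev_edges(1)[of L \<zeta> i "j + 1"] by (simp_all add: lab_steps)
  have e: "edge3 L \<zeta> (a + 1) - edge1 L \<zeta> (a + 3) = edge3 L \<zeta> a - edge1 L \<zeta> a"
    using d11 dev_edges[of L \<zeta> i j] by (simp add: a_def algebra_simps)
  have num: "a + 1 + 3 = a + 4" "a + 3 + 1 = a + 4" by simp_all
  show ?thesis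
  proof (cases lo)
    case True
    have "u = edge1 L \<zeta> a" "v = edge3 L \<zeta> a"
      using True dev_edges[of L \<zeta> i j] by (simp_all add: u_def v_def k cell_vertex_def a_def)
    moreover have "u' = p $ (a + 1) - p $ a" "v' = p $ (a + 3) - p $ a"
      using True by (simp_all add: u'_def v'_def k cell_vertex_def a_def lab_steps)
    ultimately show ?thesis
      using norm_edge1[of a] norm_edge3[of a] norm_edge2[of a]
      by (intro norm_linear_combination_eq) (simp_all add: dist_norm norm_minus_commute)
  next
    case False
    have "u = - edge1 L \<zeta> (a + 3)"
      using False d11(2) by (simp add: u_def k cell_vertex_def)
    moreover have "v = - edge3 L \<zeta> (a + 1)"
      using False d11(1) by (simp add: v_def k cell_vertex_def)
    moreover have "lab (i + 1, j + 1) = a + 4" "lab (i, j + 1) = a + 3" "lab (i + 1, j) = a + 1"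
      unfolding a_def by (fact lab_steps)+
    then have "u' = p $ (a + 3) - p $ (a + 4)" "v' = p $ (a + 1) - p $ (a + 4)"
      using False by (simp_all add: u'_def v'_def k cell_vertex_def)
    ultimately show ?thesis
      using norm_edge1[of "a + 3"] norm_edge3[of "a + 1"] norm_edge2[of a] e
      by (intro norm_linear_combination_eq) (simp_all add: num dist_norm norm_minus_commute)
  qed
qed

lemma dist_cell:
  assumes "r \<in> cell_triangle k" "r' \<in> cell_triangle k"
  shows "dist (F r) (F r') = dist (G r) (G r')"
proof -
  show ?thesis using assms(1)
  proof (cases rule: cell_triangleE[where 'v = complex and 'w = "real^3"])
    case r: (1 b c)
    show ?thesis using assms(2)
    proof (cases rule: cell_triangleE[where 'v = complex and 'w = "real^3"])
      case r': (1 b' c')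
      have "G r - G r' = (b - b') *\<^sub>R (dev L \<zeta> (cell_vertex k 1) - dev L \<zeta> (cell_vertex k 0)) + (c - c') *\<^sub>R (dev L \<zeta> (cell_vertex k 2) - dev L \<zeta> (cell_vertex k 0))"
        unfolding r(4) r'(4) by (simp add: algebra_simps)
      moreover have "F r - F r' = (b - b') *\<^sub>R (p $ lab (cell_vertex k 1) - p $ lab (cell_vertex k 0)) + (c - c') *\<^sub>R (p $ lab (cell_vertex k 2) - p $ lab (cell_vertex k 0))"
        unfolding r(5) r'(5) by (simp add: algebra_simps)
      ultimately show ?thesis by (simp only: dist_norm cell_edges)
    qed
  qed
qed

definition "flat z = F (SOME r. G r = z)"

lemma flat_G: "flat (G r) = F r"
  unfolding flat_def by (rule consistent) (rule someI[of _ r], rule refl)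

lemma surj_G: obtains r where "z = G r"
  using surj_pl_dev[OF oriented, of \<zeta>] by (metis surjD)

text \<open>Properness of the development bounds the parameters of all points over a compact path,
  so finitely many triangles cover it.\<close>

lemma flat_piecewise_isometry:
  assumes "path \<gamma>"
  obtains I where "piecewise_isometry I (\<lambda>k. G ` cell_triangle k) flat \<gamma>"
proof -
  obtain C where C: "\<And>z. z \<in> path_image \<gamma> \<Longrightarrow> norm z \<le> C"
    using compact_imp_bounded[OF compact_path_image[OF assms]] by (auto simp: bounded_iff)
  obtain B where B: "\<And>r. norm r \<le> B * (norm (G r) + B)"
    using pl_dev_proper[OF oriented, where \<zeta> = \<zeta>] by metis
  define N where "N = \<lceil>\<bar>B\<bar> * (C + \<bar>B\<bar>)\<rceil> + 1"
  define I where "I = (UNIV :: bool set) \<times> {-N..N} \<times> {-N..N}"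
  show ?thesis
  proof (rule that[of I], unfold_locales)
    show "finite I" by (simp add: I_def)
    show "closed (G ` cell_triangle k)" for k
      by (intro compact_imp_closed compact_continuous_image compact_cell_triangle
          continuous_on_pl_bounded compact_imp_bounded)
    show "path \<gamma>" by fact
    show "path_image \<gamma> \<subseteq> (\<Union>k\<in>I. G ` cell_triangle k)"
    proof
      fix z assume z: "z \<in> path_image \<gamma>"
      obtain r where r: "z = G r" using surj_G .
      obtain lo where lo: "r \<in> cell_triangle (lo, \<lfloor>fst r\<rfloor>, \<lfloor>snd r\<rfloor>)" using cell_triangle_floor .
      have "norm r \<le> \<bar>B\<bar> * (norm (G r) + \<bar>B\<bar>)"
      proof -
        have "norm r \<le> B * (norm (G r) + B)" by (rule B)
        also have "\<dots> \<le> \<bar>B\<bar> * \<bar>norm (G r) + B\<bar>" by (simp flip: abs_mult)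
        also have "\<dots> \<le> \<bar>B\<bar> * (norm (G r) + \<bar>B\<bar>)"
          using norm_ge_zero[of "G r"] by (intro mult_left_mono) arith+
        finally show ?thesis .
      qed
      also have "\<dots> \<le> \<bar>B\<bar> * (C + \<bar>B\<bar>)" using C[OF z] r by (intro mult_left_mono) auto
      finally have "\<bar>fst r\<bar> \<le> \<bar>B\<bar> * (C + \<bar>B\<bar>)" "\<bar>snd r\<bar> \<le> \<bar>B\<bar> * (C + \<bar>B\<bar>)"
        using norm_fst_le[of "fst r" "snd r"] norm_snd_le[of "snd r" "fst r"] by auto
      then have "(lo, \<lfloor>fst r\<rfloor>, \<lfloor>snd r\<rfloor>) \<in> I"
        unfolding I_def N_def mem_Times_iff by (simp add: abs_le_iff) linarith
      then show "z \<in> (\<Union>k\<in>I. G ` cell_triangle k)" using lo r by blast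
    qed
    show "dist (flat x) (flat y) = dist x y" if "x \<in> G ` cell_triangle k" "y \<in> G ` cell_triangle k" for k x y
      using that by (auto simp: flat_G dist_cell)
  qed
qed

lemma flat_lipschitz: "dist (flat x) (flat y) \<le> dist x y"
  by (rule flat_piecewise_isometry[OF path_linepath[of x y]], rule piecewise_isometry_segment)

text \<open>Unlike injectivity of the development, this estimate passes to limits, where it implies
  \<open>consistent\<close>.\<close>

lemma dist_F_le: "dist (F r) (F r') \<le> dist (G r) (G r')"
  using flat_lipschitz[of "G r" "G r'"] by (simp add: flat_G)

lemma flat_periodic: "flat (z + of_int m * fst L + of_int n * snd L) = flat z"
proof -
  obtain r where r: "z = G r" using surj_G .
  have "flat (G (fst r + of_int (3 * - m - n), snd r + of_int (3 * n - - m))) = flat (G (fst r, snd r))"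
    unfolding flat_G by (rule pl_periodic)
  then show ?thesis unfolding pl_dev_shift by (simp add: r scaleR_conv_of_real)
qed

definition "torus_map x = flat (SOME z. torus_point L z = x)"

lemma torus_map: "torus_map (torus_point L z) = flat z"
proof -
  have "torus_point L (SOME z'. torus_point L z' = torus_point L z) = torus_point L z"
    by (rule someI[of _ z]) (rule refl)
  then obtain m n :: int where "z = (SOME z'. torus_point L z' = torus_point L z) + of_int m * fst L + of_int n * snd L"
    unfolding torus_point_eq_iff by blast
  then show ?thesis
    unfolding torus_map_def using flat_periodic[of "SOME z'. torus_point L z' = torus_point L z" m n] by simp
qed

lemma torus_map_G: "torus_map (torus_point L (G r)) = F r"
  by (simp add: torus_map flat_G)

lemma preserves_path_lengths_torus_map: "preserves_path_lengths L torus_map"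
  unfolding preserves_path_lengths_def
proof (intro allI impI)
  fix \<gamma> :: "real \<Rightarrow> complex" assume "path \<gamma>"
  then obtain I where "piecewise_isometry I (\<lambda>k. G ` cell_triangle k) flat \<gamma>"
    using flat_piecewise_isometry by blast
  then have "path_length (flat \<circ> \<gamma>) = path_length \<gamma>"
    by (rule piecewise_isometry.path_length_image)
  moreover have "torus_map \<circ> torus_point L \<circ> \<gamma> = flat \<circ> \<gamma>"
    by (simp add: fun_eq_iff torus_map)
  ultimately show "path_length (torus_map \<circ> torus_point L \<circ> \<gamma>) = path_length \<gamma>" by simp
qed

lemma G_cell_triangle: "G ` cell_triangle k = convex hull {dev L \<zeta> (cell_vertex k 0), dev L \<zeta> (cell_vertex k 1), dev L \<zeta> (cell_vertex k 2)}"
proof (intro antisym subsetI)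
  fix z assume "z \<in> G ` cell_triangle k"
  then obtain r where z: "z = G r" "r \<in> cell_triangle k" by auto
  show "z \<in> convex hull {dev L \<zeta> (cell_vertex k 0), dev L \<zeta> (cell_vertex k 1), dev L \<zeta> (cell_vertex k 2)}"
    using z(2)
  proof (cases rule: cell_triangleE[where 'v = complex and 'w = complex])
    case (1 b c)
    then show ?thesis unfolding convex_hull_3 z(1) mem_Collect_eq
      by (intro exI[of _ "1 - b - c"] exI[of _ b] exI[of _ c]) (auto simp: algebra_simps)
  qed
next
  fix z assume "z \<in> convex hull {dev L \<zeta> (cell_vertex k 0), dev L \<zeta> (cell_vertex k 1), dev L \<zeta> (cell_vertex k 2)}"
  then obtain a b c where abc: "0 \<le> a" "0 \<le> b" "0 \<le> c" "a + b + c = 1"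
      "z = a *\<^sub>R dev L \<zeta> (cell_vertex k 0) + b *\<^sub>R dev L \<zeta> (cell_vertex k 1) + c *\<^sub>R dev L \<zeta> (cell_vertex k 2)"
    unfolding convex_hull_3 by blast
  have a: "a = 1 - b - c" using abc by simp
  have "b + c \<le> 1" using abc by simp
  with abc(2,3) show "z \<in> G ` cell_triangle k"
  proof (cases rule: cell_triangle_combination[where 'v = complex and 'w = complex and k = k])
    case (1 r)
    have "z = G r" unfolding 1 abc(5) a by (simp add: algebra_simps)
    then show ?thesis using 1(1) by blast
  qed
qed

lemma flat_affine_on_triangle: "\<exists>f d. linear f \<and> (\<forall>z\<in>G ` cell_triangle k. flat z = f z + d)"
proof -
  obtain f where f: "linear f" "f (dev L \<zeta> (cell_vertex k 1) - dev L \<zeta> (cell_vertex k 0)) = p $ lab (cell_vertex k 1) - p $ lab (cell_vertex k 0)"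
      "f (dev L \<zeta> (cell_vertex k 2) - dev L \<zeta> (cell_vertex k 0)) = p $ lab (cell_vertex k 2) - p $ lab (cell_vertex k 0)"
    using linear_extension_two[OF cell_edges[where k = k]] by blast
  have "flat z = f z + (p $ lab (cell_vertex k 0) - f (dev L \<zeta> (cell_vertex k 0)))" if "z \<in> G ` cell_triangle k" for z
  proof -
    from that obtain r where z: "z = G r" "r \<in> cell_triangle k" by blast
    show ?thesis using z(2)
    proof (cases rule: cell_triangleE[where 'v = complex and 'w = "real^3"])
      case (1 b c)
      have "f (G r) = f (dev L \<zeta> (cell_vertex k 0)) + b *\<^sub>R (p $ lab (cell_vertex k 1) - p $ lab (cell_vertex k 0))
         + c *\<^sub>R (p $ lab (cell_vertex k 2) - p $ lab (cell_vertex k 0))"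
        unfolding 1(4) linear_add[OF f(1)] linear_scale[OF f(1)] f(2,3) ..
      then show ?thesis unfolding z(1) flat_G 1(5) by simp
    qed
  qed
  with f(1) show ?thesis by blast
qed

lemma piecewise_linear_torus_map: "piecewise_linear L torus_map"
  unfolding piecewise_linear_def
proof (rule exI[of _ "(\<lambda>k. G ` cell_triangle k) ` ((UNIV :: bool set) \<times> {0..<8 :: int} \<times> {0 :: int})"], intro conjI ballI)
  let ?T = "(\<lambda>k. G ` cell_triangle k) ` ((UNIV :: bool set) \<times> {0..<8 :: int} \<times> {0 :: int})"
  show "finite ?T" by simp
  show "\<exists>a b c. t = convex hull {a, b, c}" if "t \<in> ?T" for t
    using that by (auto simp: G_cell_triangle)
  show "\<exists>f d. linear f \<and> (\<forall>z\<in>t. torus_map (torus_point L z) = f z + d)" if "t \<in> ?T" for t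
    using that flat_affine_on_triangle by (auto simp: torus_map)
  show "torus L = torus_point L ` \<Union> ?T"
  proof (intro antisym subsetI)
    fix x assume "x \<in> torus L"
    then obtain z where x: "x = torus_point L z" by (auto simp: torus_def)
    obtain r where z: "z = G r" using surj_G .
    \<comment> \<open>The eight cells \<open>(0, 0)\<close> to \<open>(7, 0)\<close> are a
      fundamental domain: the deck translation by \<open>(3 * j - 8 * q, - j)\<close> moves the cell
      \<open>(i, j)\<close> to \<open>((i + 3 * j) mod 8, 0)\<close>.\<close>
    define i j q where "i = \<lfloor>fst r\<rfloor>" "j = \<lfloor>snd r\<rfloor>" "q = (i + 3 * j) div 8"
    define r' where "r' = (fst r + of_int (3 * (j - 3 * q) - (- q)), snd r + of_int (3 * (- q) - (j - 3 * q)))"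
    have "G r' = z - of_int (j - 3 * q) *\<^sub>R fst L + of_int (- q) *\<^sub>R snd L"
      unfolding r'_def pl_dev_shift z by simp
    note Gr' = this
    have "torus_point L z = torus_point L (G r')"
      unfolding torus_point_eq_iff Gr' by (rule exI[of _ "- (j - 3 * q)"], rule exI[of _ "- q"]) (simp add: scaleR_conv_of_real algebra_simps)
    moreover have fl: "\<lfloor>fst r'\<rfloor> = (i + 3 * j) mod 8" "\<lfloor>snd r'\<rfloor> = 0"
      unfolding r'_def fst_conv snd_conv floor_add_int[symmetric] minus_div_mult_eq_mod[symmetric] by (simp_all add: i_j_q_def)
    obtain lo where "r' \<in> cell_triangle (lo, \<lfloor>fst r'\<rfloor>, \<lfloor>snd r'\<rfloor>)" using cell_triangle_floor .
    then have "G r' \<in> \<Union> ?T" unfolding fl by force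
    ultimately show "x \<in> torus_point L ` \<Union> ?T" unfolding x by blast
  qed (auto simp: torus_def)
qed

end

section \<open>Angles in the plane and in space\<close>

lemma Im_divide_pos_iff:
  assumes "u \<noteq> 0"
  shows "0 < Im (v / u) \<longleftrightarrow> 0 < Im (cnj u * v)"
proof -
  have "Im (v / u) = Im (cnj u * v) / (norm u)\<^sup>2"
    by (simp add: Im_divide cmod_power2 algebra_simps)
  then show ?thesis using assms by (simp add: zero_less_divide_iff)
qed

lemma angle_eq_Arg:
  fixes u v :: complex and a b c :: "real^3"
  assumes "norm u = dist a b" "norm v = dist a c" "norm (v - u) = dist b c" and pos: "0 < Im (cnj u * v)"
  shows "angle b a c = Arg (v / u)"
proof -
  have nz: "u \<noteq> 0" "v \<noteq> 0" using pos by auto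
  have "(b - a) \<bullet> (c - a) = u \<bullet> v"
    unfolding dot_norm_neg using assms(1-3) by (simp add: dist_norm norm_minus_commute)
  moreover have "norm (b - a) = norm u" "norm (c - a) = norm v"
    using assms by (simp_all add: dist_norm norm_minus_commute)
  ultimately have "angle b a c = arccos (u \<bullet> v / (norm u * norm v))"
    by (simp add: angle_def)
  also have "u \<bullet> v / (norm u * norm v) = cos (Arg (v / u))"
  proof -
    have "cos (Arg (v / u)) = Re (v / u) / norm (v / u)"
      using nz by (simp add: cos_Arg)
    also have "Re (v / u) = (u \<bullet> v) / (norm u)\<^sup>2"
      by (simp add: Re_divide inner_complex_def cmod_power2 mult.commute)
    finally show ?thesis using nz by (simp add: norm_divide power2_eq_square)
  qed
  also have "arccos (cos (Arg (v / u))) = Arg (v / u)"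
    using Arg_lt_pi[of "v / u"] pos nz by (intro arccos_cos) (auto simp: Im_divide_pos_iff)
  finally show ?thesis .
qed

lemma Arg_quotient_bounds:
  assumes "0 < Im (cnj u * v)"
  shows "0 < Arg (v / u)" "Arg (v / u) < pi"
proof -
  have "u \<noteq> 0" using assms by auto
  then show "0 < Arg (v / u)" "Arg (v / u) < pi"
    using Arg_lt_pi[of "v / u"] assms by (auto simp: Im_divide_pos_iff)
qed

text \<open>Angles are added modulo \<open>2 * pi\<close> by multiplying quotients; a bound then
  fixes the multiple.\<close>

lemma cis_eq_1_bounded:
  assumes "cis t = 1" "-2 * pi < t" "t < 2 * pi"
  shows "t = 0"
proof -
  have "cos t = 1" using assms(1) by (metis cis.simps(1) one_complex.simps(1))
  then obtain n :: int where n: "t = of_int n * 2 * pi" by (auto simp: cos_one_2pi_int)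
  have "(2 * pi) * (- 1) < (2 * pi) * real_of_int n" "(2 * pi) * real_of_int n < (2 * pi) * 1"
    using assms(2,3) unfolding n by (simp_all add: mult_ac)
  then have "-1 < real_of_int n" "real_of_int n < 1"
    by (simp_all only: mult_less_cancel_left_pos[of "2 * pi"] pi_gt_zero zero_less_mult_iff zero_less_numeral simp_thms)
  then have "n = 0" by linarith
  then show ?thesis using n by simp
qed

lemma cis_Arg_divide: "u \<noteq> 0 \<Longrightarrow> v \<noteq> 0 \<Longrightarrow> cis (Arg (v / u)) = sgn v / sgn u"
  by (simp add: cis_Arg sgn_divide)

lemma Arg_quotient_add:
  assumes "0 < Im (cnj u * v)" "0 < Im (cnj v * w)" "0 < Im (cnj u * w)"
  shows "Arg (v / u) + Arg (w / v) = Arg (w / u)"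
proof -
  have nz: "u \<noteq> 0" "v \<noteq> 0" "w \<noteq> 0" using assms by auto
  have "cis (Arg (v / u) + Arg (w / v) - Arg (w / u)) = 1"
    using nz by (simp add: cis_divide[symmetric] cis_mult[symmetric] cis_Arg_divide sgn_eq_0_iff)
  then have "Arg (v / u) + Arg (w / v) - Arg (w / u) = 0"
    using Arg_quotient_bounds[OF assms(1)] Arg_quotient_bounds[OF assms(2)] Arg_quotient_bounds[OF assms(3)]
    by (intro cis_eq_1_bounded) auto
  then show ?thesis by simp
qed

text \<open>Four angles between 0 and \<open>pi\<close> add up to less than \<open>4 * pi\<close>,
  so their sum, a positive multiple of \<open>2 * pi\<close>, is \<open>2 * pi\<close>. For six
  angles the bound would be too weak, so pairs are merged beforehand by
  \<open>Arg_quotient_add\<close>.\<close>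

lemma Arg_quotient_cycle:
  assumes "0 < Im (cnj a * b)" "0 < Im (cnj b * c)" "0 < Im (cnj c * d)" "0 < Im (cnj d * a)"
  shows "Arg (b / a) + Arg (c / b) + Arg (d / c) + Arg (a / d) = 2 * pi"
proof -
  have nz: "a \<noteq> 0" "b \<noteq> 0" "c \<noteq> 0" "d \<noteq> 0" using assms by auto
  have "cis (Arg (b / a) + Arg (c / b) + Arg (d / c) + Arg (a / d) - 2 * pi) = 1"
    using nz by (simp add: cis_divide[symmetric] cis_mult[symmetric] cis_Arg_divide sgn_eq_0_iff)
  then have "Arg (b / a) + Arg (c / b) + Arg (d / c) + Arg (a / d) - 2 * pi = 0"
    using Arg_quotient_bounds[OF assms(1)] Arg_quotient_bounds[OF assms(2)]
      Arg_quotient_bounds[OF assms(3)] Arg_quotient_bounds[OF assms(4)]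
    by (intro cis_eq_1_bounded) auto
  then show ?thesis by simp
qed

section \<open>Tilings of flat tori by the uniform triangulation\<close>

text \<open>
  In the coordinates \<open>X = Im z - f Re z\<close> and \<open>Y = Im z + f Re z\<close> the two cone conditions say that the
  developed map is strictly increasing or decreasing in each lattice direction, hence injective.
\<close>

locale tiled =
  fixes L :: basis and \<zeta> :: "8 \<Rightarrow> complex" and p :: "real^3^8" and f :: real
  assumes oriented: "oriented_basis L"
    and norm_edge1: "norm (edge1 L \<zeta> a) = dist (p $ a) (p $ (a + 1))"
    and norm_edge3: "norm (edge3 L \<zeta> a) = dist (p $ a) (p $ (a + 3))"
    and norm_edge2: "norm (edge3 L \<zeta> a - edge1 L \<zeta> a) = dist (p $ (a + 1)) (p $ (a + 3))"
    and f_pos: "f > 0"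
    and cone1: "\<bar>Im (edge1 L \<zeta> a)\<bar> < - (f * Re (edge1 L \<zeta> a))"
    and cone3: "f * \<bar>Re (edge3 L \<zeta> a)\<bar> < Im (edge3 L \<zeta> a)"
begin

lemma inj_G: "inj (pl (dev L \<zeta>))"
proof (rule inj_pl[where X = "\<lambda>z. Im z - f * Re z" and Y = "\<lambda>z. Im z + f * Re z"])
  show "linear (\<lambda>z. Im z - f * Re z)" "linear (\<lambda>z. Im z + f * Re z)"
    by (auto intro!: linearI simp: algebra_simps)
  have abs: "\<bar>f * Re z\<bar> = f * \<bar>Re z\<bar>" for z using f_pos by (simp add: abs_mult)
  fix i j
  define e g where "e = edge1 L \<zeta> (lab (i, j))" "g = edge3 L \<zeta> (lab (i, j))"
  have "f * Re e < Im e" "Im e < - (f * Re e)" "f * Re g < Im g" "- (f * Re g) < Im g"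
    using cone1[of "lab (i, j)"] cone3[of "lab (i, j)"] unfolding e_g_def abs[symmetric] by (auto simp: abs_less_iff)
  then show "Im (dev L \<zeta> (i, j)) - f * Re (dev L \<zeta> (i, j)) < Im (dev L \<zeta> (i + 1, j)) - f * Re (dev L \<zeta> (i + 1, j))"
    "Im (dev L \<zeta> (i + 1, j)) + f * Re (dev L \<zeta> (i + 1, j)) < Im (dev L \<zeta> (i, j)) + f * Re (dev L \<zeta> (i, j))"
    "Im (dev L \<zeta> (i, j)) - f * Re (dev L \<zeta> (i, j)) < Im (dev L \<zeta> (i, j + 1)) - f * Re (dev L \<zeta> (i, j + 1))"
    "Im (dev L \<zeta> (i, j)) + f * Re (dev L \<zeta> (i, j)) < Im (dev L \<zeta> (i, j + 1)) + f * Re (dev L \<zeta> (i, j + 1))"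
    unfolding dev_edges e_g_def[symmetric] by (simp_all add: distrib_left)
qed

sublocale flat_map L \<zeta> p
  by unfold_locales (use oriented norm_edge1 norm_edge2 norm_edge3 inj_G in \<open>auto dest: injD\<close>)

text \<open>All \<open>edge3\<close> vectors lie in a cone around the upward direction and all
  \<open>edge1\<close> vectors in the adjacent cone to the left. The turn is therefore positive even
  for different labels.\<close>

lemma edges_oriented: "0 < Im (cnj (edge3 L \<zeta> a) * edge1 L \<zeta> b)"
proof -
  define x y where "x = edge3 L \<zeta> a" "y = edge1 L \<zeta> b"
  have "(f * \<bar>Re x\<bar>) * \<bar>Im y\<bar> < Im x * - (f * Re y)"
    using cone3[of a] cone1[of b] f_pos by (intro mult_strict_mono') (auto simp: x_y_def)
  moreover have "- (f * (Re x * Im y)) \<le> \<bar>f * (Re x * Im y)\<bar>" by (rule abs_ge_minus_self)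
  moreover have "\<bar>f * (Re x * Im y)\<bar> = (f * \<bar>Re x\<bar>) * \<bar>Im y\<bar>"
    using f_pos by (simp add: abs_mult)
  ultimately have "- (f * (Re x * Im y)) < Im x * - (f * Re y)" by linarith
  then have "f * (Im x * Re y) < f * (Re x * Im y)" by (simp add: algebra_simps)
  then show ?thesis using f_pos by (simp add: x_y_def mult_less_cancel_left_pos)
qed

lemma edge_relations:
  "edge3 L \<zeta> (a + 1) = edge3 L \<zeta> a - edge1 L \<zeta> a + edge1 L \<zeta> (a + 3)"
  by (simp add: edge1_def edge3_def algebra_simps)

lemma cone_angle_eq: "cone_angle p i = 2 * pi"
proof -
  define c e where "c = edge1 L \<zeta>" and "e = edge3 L \<zeta>"
  have pos: "0 < Im (cnj (e a) * c b)" for a b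
    using edges_oriented by (simp add: c_def e_def)
  have pos': "Im (cnj (c a) * e b) < 0" for a b using pos[of b a] by (simp add: mult.commute)
  have rel: "e (a + 1) = e a - c a + c (a + 3)" for a
    using edge_relations by (simp add: c_def e_def)
  have n1: "norm (c a) = dist (p $ a) (p $ (a + 1))" and n3: "norm (e a) = dist (p $ a) (p $ (a + 3))"
    and n2: "norm (e a - c a) = dist (p $ (a + 1)) (p $ (a + 3))" for a
    using norm_edge1 norm_edge2 norm_edge3 by (simp_all add: c_def e_def)
  \<comment> \<open>The vectors from a vertex labelled \<open>i\<close> to its six neighbours;
    primes mark the neighbours \<open>i - 1\<close>, \<open>i - 2\<close>,
    \<open>i - 3\<close>.\<close>
  define E1 E3 E2 E1' E3' E2' where E: "E1 = c i" "E3 = e i" "E2 = e (i - 1) - c (i - 1)"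
    "E1' = - c (i - 1)" "E3' = - e (i - 3)" "E2' = c (i - 3) - e (i - 3)"
  have E2: "E2 = E3 - c (i + 2)" using rel[of "i - 1"] by (simp add: E algebra_simps)
  have E2': "E2' = E1 - e (i - 2)" using rel[of "i - 3"] by (simp add: E algebra_simps)
  have norms: "norm E1 = dist (p $ i) (p $ (i + 1))" "norm E3 = dist (p $ i) (p $ (i + 3))"
    "norm E2 = dist (p $ i) (p $ (i + 2))" "norm E1' = dist (p $ i) (p $ (i - 1))"
    "norm E3' = dist (p $ i) (p $ (i - 3))" "norm E2' = dist (p $ i) (p $ (i - 2))"
    using n1[of i] n3[of i] n2[of "i - 1"] n1[of "i - 1"] n3[of "i - 3"] n2[of "i - 3"]
    by (simp_all add: E dist_commute norm_minus_commute add.commute)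
  have opp: "norm (E3 - E2) = dist (p $ (i + 2)) (p $ (i + 3))" "norm (E1 - E3) = dist (p $ (i + 3)) (p $ (i + 1))"
    "norm (E2' - E1) = dist (p $ (i + 1)) (p $ (i - 2))" "norm (E3' - E2') = dist (p $ (i - 2)) (p $ (i - 3))"
    "norm (E1' - E3') = dist (p $ (i - 3)) (p $ (i - 1))" "norm (E2 - E1') = dist (p $ (i - 1)) (p $ (i + 2))"
  proof -
    show "norm (E3 - E2) = dist (p $ (i + 2)) (p $ (i + 3))" using n1[of "i + 2"] by (simp add: E2 add.commute)
    show "norm (E1 - E3) = dist (p $ (i + 3)) (p $ (i + 1))" using n2[of i] by (simp add: E dist_commute norm_minus_commute)
    show "norm (E2' - E1) = dist (p $ (i + 1)) (p $ (i - 2))" using n3[of "i - 2"] by (simp add: E2' dist_commute add.commute)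
    show "norm (E3' - E2') = dist (p $ (i - 2)) (p $ (i - 3))" using n1[of "i - 3"] by (simp add: E dist_commute add.commute)
    have "E1' - E3' = e (i - 3) - c (i - 1)" by (simp add: E)
    also have "\<dots> = e (i - 4) - c (i - 4)" using rel[of "i - 4"] by (simp add: algebra_simps)
    finally show "norm (E1' - E3') = dist (p $ (i - 3)) (p $ (i - 1))" using n2[of "i - 4"] by (simp add: add.commute)
    show "norm (E2 - E1') = dist (p $ (i - 1)) (p $ (i + 2))" using n3[of "i - 1"] by (simp add: E add.commute)
  qed
  have im: "0 < Im (cnj E2 * E3)" "0 < Im (cnj E3 * E1)" "0 < Im (cnj E1 * E2')" "0 < Im (cnj E2' * E3')"
    "0 < Im (cnj E3' * E1')" "0 < Im (cnj E1' * E2)" "0 < Im (cnj E1' * E3)" "0 < Im (cnj E1 * E3')"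
  proof -
    show "0 < Im (cnj E2 * E3)" using pos'[of "i + 2" i] unfolding E2 E(2) by (simp add: algebra_simps)
    show "0 < Im (cnj E3 * E1)" using pos[of i i] unfolding E(1,2) .
    show "0 < Im (cnj E1 * E2')" using pos'[of i "i - 2"] unfolding E2' E(1) by (simp add: algebra_simps)
    show "0 < Im (cnj E2' * E3')" using pos'[of "i - 3" "i - 3"] unfolding E(5,6) by (simp add: algebra_simps)
    show "0 < Im (cnj E3' * E1')" using pos[of "i - 3" "i - 1"] unfolding E(4,5) by (simp add: algebra_simps)
    show "0 < Im (cnj E1' * E2)" using pos'[of "i - 1" "i - 1"] unfolding E(3,4) by (simp add: algebra_simps)
    show "0 < Im (cnj E1' * E3)" using pos'[of "i - 1" i] unfolding E(2,4) by (simp add: algebra_simps)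
    show "0 < Im (cnj E1 * E3')" using pos'[of i "i - 3"] unfolding E(1,5) by (simp add: algebra_simps)
  qed
  note angles = angle_eq_Arg[OF norms(3) norms(2) opp(1) im(1)] angle_eq_Arg[OF norms(2) norms(1) opp(2) im(2)]
    angle_eq_Arg[OF norms(1) norms(6) opp(3) im(3)] angle_eq_Arg[OF norms(6) norms(5) opp(4) im(4)]
    angle_eq_Arg[OF norms(5) norms(4) opp(5) im(5)] angle_eq_Arg[OF norms(4) norms(3) opp(6) im(6)]
  have set: "{(j, k). (i, j, k) \<in> positive_triples} =
      {(i + 2, i + 3), (i + 3, i + 1), (i + 1, i - 2), (i - 2, i - 3), (i - 3, i - 1), (i - 1, i + 2)}" (is "?A = ?B")
  proof (rule set_eqI)
    fix jk :: "8 \<times> 8" obtain j k where jk: "jk = (j, k)" by (cases jk)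
    have sw: "i = a + c \<longleftrightarrow> a = i - c" for a c :: 8 by (auto simp: algebra_simps)
    have num: "i - 2 + 3 = i + 1" "i - 3 + 2 = i - 1" "i - 3 + 1 = i - 2" "i - 1 + 3 = i + 2" by simp_all
    have "(i, j, k) \<in> positive_triples \<longleftrightarrow>
       (\<exists>a. a = i \<and> j = a + 2 \<and> k = a + 3) \<or> (\<exists>a. i = a + 2 \<and> j = a + 3 \<and> k = a) \<or>
       (\<exists>a. i = a + 3 \<and> j = a \<and> k = a + 2) \<or> (\<exists>a. a = i \<and> j = a + 3 \<and> k = a + 1) \<or>
       (\<exists>a. i = a + 3 \<and> j = a + 1 \<and> k = a) \<or> (\<exists>a. i = a + 1 \<and> j = a \<and> k = a + 3)"
      unfolding positive_triples_def UN_iff insert_iff empty_iff prod.inject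
      by (simp only: HOL.simp_thms bex_UNIV ex_disj_distrib eq_commute[of i])
    then have "(i, j, k) \<in> positive_triples \<longleftrightarrow> (j = i + 2 \<and> k = i + 3) \<or> (j = i + 1 \<and> k = i - 2) \<or>
       (j = i - 3 \<and> k = i - 1) \<or> (j = i + 3 \<and> k = i + 1) \<or> (j = i - 2 \<and> k = i - 3) \<or> (j = i - 1 \<and> k = i + 2)"
      by (simp only: sw num simp_thms)
    then show "jk \<in> ?A \<longleftrightarrow> jk \<in> ?B"
      unfolding jk mem_Collect_eq split_conv insert_iff empty_iff prod.inject by argo
  qed
  have "cone_angle p i = angle (vec_nth p (i + 2)) (vec_nth p i) (vec_nth p (i + 3)) + angle (vec_nth p (i + 3)) (vec_nth p i) (vec_nth p (i + 1))
      + angle (vec_nth p (i + 1)) (vec_nth p i) (vec_nth p (i - 2)) + angle (vec_nth p (i - 2)) (vec_nth p i) (vec_nth p (i - 3))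
      + angle (vec_nth p (i - 3)) (vec_nth p i) (vec_nth p (i - 1)) + angle (vec_nth p (i - 1)) (vec_nth p i) (vec_nth p (i + 2))"
  proof -
    have m: "i - 1 = i + 7" "i - 2 = i + 6" "i - 3 = i + 5"
      by (simp_all only: diff_eq_eq add.assoc) simp_all
    have dis: "distinct [(i + 2, i + 3), (i + 3, i + 1), (i + 1, i - 2), (i - 2, i - 3), (i - 3, i - 1), (i - 1, i + 2)]"
      unfolding m by (simp only: distinct.simps set_simps insert_iff empty_iff prod.inject add_left_cancel) simp
    have set': "{(j, k). (i, j, k) \<in> positive_triples} =
      set [(i + 2, i + 3), (i + 3, i + 1), (i + 1, i - 2), (i - 2, i - 3), (i - 3, i - 1), (i - 1, i + 2)]"
      unfolding set by (simp only: list.set)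
    show ?thesis
      unfolding cone_angle_def set' sum.distinct_set_conv_list[OF dis]
      by (simp only: list.map sum_list.Cons sum_list.Nil split_conv add_0_right add.assoc)
  qed
  \<comment> \<open>Eliminating \<open>E2\<close> and \<open>E2'\<close> leaves the cycle
    \<open>E1'\<close>, \<open>E3\<close>, \<open>E1\<close>, \<open>E3'\<close> of four
    directions.\<close>
  also have "\<dots> = (Arg (E2 / E1') + Arg (E3 / E2)) + Arg (E1 / E3) + (Arg (E2' / E1) + Arg (E3' / E2')) + Arg (E1' / E3')"
    unfolding angles by simp
  also have "\<dots> = Arg (E3 / E1') + Arg (E1 / E3) + Arg (E3' / E1) + Arg (E1' / E3')"
    using Arg_quotient_add[OF im(6) im(1) im(7)] Arg_quotient_add[OF im(3) im(4) im(8)] by simp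
  also have "\<dots> = 2 * pi"
    by (rule Arg_quotient_cycle) (fact im)+
  finally show ?thesis .
qed

lemma G_shift: "G (r + (of_int (3 * m - n), of_int (3 * n - m))) = G r - of_int m *\<^sub>R fst L + of_int n *\<^sub>R snd L"
  using pl_dev_shift[of L \<zeta> "fst r" m n "snd r"] by (cases r) simp

lemma torus_point_G_eq_iff: "torus_point L (G r) = torus_point L (G r') \<longleftrightarrow> bary r = bary r'"
proof
  assume "torus_point L (G r) = torus_point L (G r')"
  then obtain m n :: int where "G r' = G r + of_int m * fst L + of_int n * snd L"
    unfolding torus_point_eq_iff by blast
  then have "G r' = G (r + (of_int (3 * (- m) - n), of_int (3 * n - (- m))))"
    unfolding G_shift by (simp add: scaleR_conv_of_real)
  then have "r' = r + (of_int (3 * (- m) - n), of_int (3 * n - (- m)))"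
    using inj_G by (rule injD[rotated])
  then show "bary r = bary r'" by (simp only: bary_shift)
next
  assume "bary r = bary r'"
  then obtain m n where r': "r' = r + (of_int (3 * m - n), of_int (3 * n - m))" by (rule bary_eqE)
  show "torus_point L (G r) = torus_point L (G r')"
    unfolding torus_point_eq_iff r' G_shift
    by (rule exI[of _ "- m"], rule exI[of _ n]) (simp add: scaleR_conv_of_real)
qed

definition "mark x = torus_point L (G (SOME r. bary r = x))"

lemma mark_bary: "mark (bary r) = torus_point L (G r)"
  unfolding mark_def torus_point_G_eq_iff by (rule someI[of _ r]) (rule refl)

lemma bij_betw_mark: "bij_betw mark realization (torus L)"
  unfolding bij_betw_def
proof
  show "inj_on mark realization"
    unfolding range_bary[symmetric] by (auto intro!: inj_onI simp: mark_bary torus_point_G_eq_iff)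
  show "mark ` realization = torus L"
  proof -
    have "mark ` realization = range (\<lambda>r. torus_point L (G r))"
      unfolding range_bary[symmetric] image_image mark_bary ..
    also have "\<dots> = torus_point L ` range G" by (simp add: image_image)
    also have "range G = UNIV" by (rule surj_pl_dev[OF oriented])
    finally show ?thesis by (simp add: torus_def)
  qed
qed

lemma torus_map_mark: "x \<in> realization \<Longrightarrow> torus_map (mark x) = affine_extension p x"
  unfolding range_bary[symmetric] by (auto simp: mark_bary torus_map_G affine_extension_bary)

text \<open>The clause of \<open>pup_tent_map\<close> for one positive triple. It is invariant under
  rotation, so two families of triples suffice.\<close>

definition placed :: "8 \<Rightarrow> 8 \<Rightarrow> 8 \<Rightarrow> bool" where
  "placed i j k \<longleftrightarrow> (\<exists>u v w.
     dist u v = dist (p $ i) (p $ j) \<and> dist v w = dist (p $ j) (p $ k) \<and>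
     dist w u = dist (p $ k) (p $ i) \<and> Im (cnj (v - u) * (w - u)) > 0 \<and>
     (\<forall>a b c. 0 \<le> a \<and> 0 \<le> b \<and> 0 \<le> c \<and> a + b + c = 1 \<longrightarrow>
        mark (a *\<^sub>R axis i 1 + b *\<^sub>R axis j 1 + c *\<^sub>R axis k 1) = torus_point L (a *\<^sub>R u + b *\<^sub>R v + c *\<^sub>R w)))"

lemma placed_rotate: "placed i j k \<Longrightarrow> placed j k i"
  unfolding placed_def
proof (elim exE conjE)
  fix u v w
  assume d: "dist u v = dist (p $ i) (p $ j)" "dist v w = dist (p $ j) (p $ k)" "dist w u = dist (p $ k) (p $ i)"
    and im: "Im (cnj (v - u) * (w - u)) > 0"
    and m: "\<forall>a b c. 0 \<le> a \<and> 0 \<le> b \<and> 0 \<le> c \<and> a + b + c = 1 \<longrightarrow>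
        mark (a *\<^sub>R axis i 1 + b *\<^sub>R axis j 1 + c *\<^sub>R axis k 1) = torus_point L (a *\<^sub>R u + b *\<^sub>R v + c *\<^sub>R w)"
  have "Im (cnj (w - v) * (u - v)) = Im (cnj (v - u) * (w - u))"
    by (simp add: algebra_simps)
  moreover have "mark (a *\<^sub>R axis j 1 + b *\<^sub>R axis k 1 + c *\<^sub>R axis i 1) = torus_point L (a *\<^sub>R v + b *\<^sub>R w + c *\<^sub>R u)"
    if "0 \<le> a" "0 \<le> b" "0 \<le> c" "a + b + c = 1" for a b c
    using m[rule_format, of c a b] that by (simp add: ac_simps)
  ultimately show "\<exists>u v w.
     dist u v = dist (p $ j) (p $ k) \<and> dist v w = dist (p $ k) (p $ i) \<and>
     dist w u = dist (p $ i) (p $ j) \<and> Im (cnj (v - u) * (w - u)) > 0 \<and>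
     (\<forall>a b c. 0 \<le> a \<and> 0 \<le> b \<and> 0 \<le> c \<and> a + b + c = 1 \<longrightarrow>
        mark (a *\<^sub>R axis j 1 + b *\<^sub>R axis k 1 + c *\<^sub>R axis i 1) = torus_point L (a *\<^sub>R u + b *\<^sub>R v + c *\<^sub>R w))"
    using d im by (intro exI[of _ v] exI[of _ w] exI[of _ u]) auto
qed

lemma placed_lower: "placed a (a + 3) (a + 1)"
proof -
  obtain z where z: "a = of_int z" by (cases a) auto
  have l: "lab (z, 0) = a" "lab (z, 0 + 1) = a + 3" "lab (z + 1, 0) = a + 1"
    by (simp_all add: lab_def z)
  let ?u = "dev L \<zeta> (z, 0)" and ?v = "dev L \<zeta> (z, 0 + 1)" and ?w = "dev L \<zeta> (z + 1, 0)"
  have d: "?v - ?u = edge3 L \<zeta> a" "?w - ?u = edge1 L \<zeta> a"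
    unfolding dev_edges l(1) by simp_all
  have vw: "?v - ?w = edge3 L \<zeta> a - edge1 L \<zeta> a" using d by (simp add: algebra_simps)
  have "dist ?u ?v = dist (p $ a) (p $ (a + 3))" "dist ?v ?w = dist (p $ (a + 3)) (p $ (a + 1))"
    "dist ?w ?u = dist (p $ (a + 1)) (p $ a)"
    using norm_edge1[of a] norm_edge2[of a] norm_edge3[of a] d vw
    by (simp_all add: dist_norm norm_minus_commute)
  moreover have "Im (cnj (?v - ?u) * (?w - ?u)) > 0"
    unfolding d by (rule edges_oriented)
  moreover have "mark (x *\<^sub>R axis a 1 + y *\<^sub>R axis (a + 3) 1 + t *\<^sub>R axis (a + 1) 1) = torus_point L (x *\<^sub>R ?u + y *\<^sub>R ?v + t *\<^sub>R ?w)"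
    if "0 \<le> x" "0 \<le> y" "0 \<le> t" "x + y + t = 1" for x y t
  proof -
    have s: "x + t + y = 1" using that by simp
    have "bary (of_int z + t, of_int 0 + y) = x *\<^sub>R axis a 1 + t *\<^sub>R axis (a + 1) 1 + y *\<^sub>R axis (a + 3) 1"
      unfolding bary_def pl_lower[OF that(1) that(3) that(2) s] l ..
    moreover have "G (of_int z + t, of_int 0 + y) = x *\<^sub>R ?u + t *\<^sub>R ?w + y *\<^sub>R ?v"
      by (rule pl_lower[OF that(1) that(3) that(2) s])
    ultimately show ?thesis using mark_bary[of "(of_int z + t, of_int 0 + y)"] by (simp only: add_ac)
  qed
  ultimately show ?thesis unfolding placed_def by blast
qed

lemma placed_upper: "placed a (a + 2) (a + 3)"
proof -
  obtain z where z: "a = of_int z" by (cases a) auto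
  have l: "lab (z - 1 + 1, 0) = a" "lab (z - 1, 0 + 1) = a + 2" "lab (z - 1 + 1, 0 + 1) = a + 3" "lab (z - 1, 0) = a - 1"
    by (simp_all add: lab_def z)
  let ?u = "dev L \<zeta> (z - 1 + 1, 0)" and ?v = "dev L \<zeta> (z - 1, 0 + 1)" and ?w = "dev L \<zeta> (z - 1 + 1, 0 + 1)"
  have d1: "?w - ?u = edge3 L \<zeta> a"
    using dev_edges(2)[of L \<zeta> "z - 1 + 1" 0] unfolding l by simp
  have "?w - ?v = edge1 L \<zeta> (a + 2)"
    using dev_edges(1)[of L \<zeta> "z - 1" "0 + 1"] unfolding l by simp
  note d = d1 this
  have vu: "?v - ?u = edge3 L \<zeta> (a - 1) - edge1 L \<zeta> (a - 1)"
    using dev_edges(1)[of L \<zeta> "z - 1" 0] dev_edges(2)[of L \<zeta> "z - 1" 0] unfolding l by simp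
  have vu': "?v - ?u = edge3 L \<zeta> a - edge1 L \<zeta> (a + 2)" using d by (simp add: algebra_simps)
  have "dist ?u ?v = dist (p $ a) (p $ (a + 2))" "dist ?v ?w = dist (p $ (a + 2)) (p $ (a + 3))"
    "dist ?w ?u = dist (p $ (a + 3)) (p $ a)"
  proof -
    have "dist ?u ?v = norm (?v - ?u)" "dist ?v ?w = norm (?w - ?v)" "dist ?w ?u = norm (?w - ?u)"
      by (simp_all add: dist_norm norm_minus_commute)
    then show "dist ?u ?v = dist (p $ a) (p $ (a + 2))" "dist ?v ?w = dist (p $ (a + 2)) (p $ (a + 3))"
      "dist ?w ?u = dist (p $ (a + 3)) (p $ a)"
      unfolding vu d using norm_edge1[of "a + 2"] norm_edge2[of "a - 1"] norm_edge3[of a]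
      by (simp_all add: dist_commute add.commute)
  qed
  moreover have "Im (cnj (?v - ?u) * (?w - ?u)) > 0"
    unfolding vu' d(1) using edges_oriented[of a "a + 2"] by (simp add: algebra_simps)
  moreover have "mark (x *\<^sub>R axis a 1 + y *\<^sub>R axis (a + 2) 1 + t *\<^sub>R axis (a + 3) 1) = torus_point L (x *\<^sub>R ?u + y *\<^sub>R ?v + t *\<^sub>R ?w)"
    if "0 \<le> x" "0 \<le> y" "0 \<le> t" "x + y + t = 1" for x y t
  proof -
    have s: "t + y + x = 1" using that by simp
    have "bary (of_int (z - 1) + 1 - y, of_int 0 + 1 - x) = t *\<^sub>R axis (a + 3) 1 + y *\<^sub>R axis (a + 2) 1 + x *\<^sub>R axis a 1"
      unfolding bary_def pl_upper[OF that(3) that(2) that(1) s] l ..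
    moreover have "G (of_int (z - 1) + 1 - y, of_int 0 + 1 - x) = t *\<^sub>R ?w + y *\<^sub>R ?v + x *\<^sub>R ?u"
      by (rule pl_upper[OF that(3) that(2) that(1) s])
    ultimately show ?thesis using mark_bary[of "(of_int (z - 1) + 1 - y, of_int 0 + 1 - x)"] by (simp only: add_ac)
  qed
  ultimately show ?thesis unfolding placed_def by blast
qed

lemma placed_positive: "(i, j, k) \<in> positive_triples \<Longrightarrow> placed i j k"
  unfolding positive_triples_def
  using placed_lower placed_upper placed_rotate by blast

lemma pup_tent_map_torus_map:
  assumes "pup_tent p"
  shows "pup_tent_map L torus_map p"
  unfolding pup_tent_map_def
proof (intro conjI exI[of _ mark])
  show "\<forall>(i, j, k)\<in>positive_triples. \<exists>u v w.
           dist u v = dist (p $ i) (p $ j) \<and> dist v w = dist (p $ j) (p $ k) \<and>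
           dist w u = dist (p $ k) (p $ i) \<and> Im (cnj (v - u) * (w - u)) > 0 \<and>
           (\<forall>a b c. 0 \<le> a \<and> 0 \<le> b \<and> 0 \<le> c \<and> a + b + c = 1 \<longrightarrow>
              mark (a *\<^sub>R axis i 1 + b *\<^sub>R axis j 1 + c *\<^sub>R axis k 1) =
                torus_point L (a *\<^sub>R u + b *\<^sub>R v + c *\<^sub>R w))"
    using placed_positive unfolding placed_def by blast
qed (use oriented assms bij_betw_mark torus_map_mark in auto)

end

section \<open>Linear maps between flat tori\<close>

definition coord_y :: "basis \<Rightarrow> complex \<Rightarrow> real" where
  "coord_y L z = Im (z / fst L) / Im (snd L / fst L)"

definition coord_x :: "basis \<Rightarrow> complex \<Rightarrow> real" where
  "coord_x L z = Re (z / fst L) - coord_y L z * Re (snd L / fst L)"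

definition change :: "basis \<Rightarrow> basis \<Rightarrow> complex \<Rightarrow> complex" where
  "change L L' z = coord_x L z *\<^sub>R fst L' + coord_y L z *\<^sub>R snd L'"

lemma linear_coords: "linear (coord_x L)" "linear (coord_y L)"
proof -
  have sc: "(r *\<^sub>R b) / c = r *\<^sub>R (b / c)" for r and b c :: complex by (simp add: scaleR_conv_of_real)
  show y: "linear (coord_y L)"
    by (rule linearI) (simp_all add: coord_y_def add_divide_distrib sc)
  show "linear (coord_x L)"
    by (rule linearI) (simp_all add: coord_x_def linear_add[OF y] linear_scale[OF y] add_divide_distrib sc algebra_simps)
qed

lemma linear_change: "linear (change L L')"
  by (rule linearI) (simp_all add: change_def linear_add[OF linear_coords(1)] linear_add[OF linear_coords(2)]
      linear_scale[OF linear_coords(1)] linear_scale[OF linear_coords(2)] algebra_simps)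

lemma coords_combination:
  assumes "oriented_basis L"
  shows "coord_x L (a *\<^sub>R fst L + b *\<^sub>R snd L) = a" "coord_y L (a *\<^sub>R fst L + b *\<^sub>R snd L) = b"
proof -
  define w where "w = snd L / fst L"
  have nz: "fst L \<noteq> 0" "Im w \<noteq> 0" using assms oriented_basis_nonzero by (auto simp: oriented_basis_def w_def)
  have e: "(a *\<^sub>R fst L + b *\<^sub>R snd L) / fst L = of_real a + of_real b * w"
    using nz by (simp add: w_def scaleR_conv_of_real field_simps)
  show y: "coord_y L (a *\<^sub>R fst L + b *\<^sub>R snd L) = b"
    unfolding coord_y_def e w_def[symmetric] using nz by simp
  show "coord_x L (a *\<^sub>R fst L + b *\<^sub>R snd L) = a"
    unfolding coord_x_def y e w_def[symmetric] by simp
qed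

lemma change_combination:
  assumes "oriented_basis L"
  shows "change L L' (a *\<^sub>R fst L + b *\<^sub>R snd L) = a *\<^sub>R fst L' + b *\<^sub>R snd L'"
  by (simp add: change_def coords_combination[OF assms])

lemma combination_coords:
  assumes "oriented_basis L"
  shows "coord_x L z *\<^sub>R fst L + coord_y L z *\<^sub>R snd L = z"
proof -
  define w where "w = snd L / fst L"
  have nz: "fst L \<noteq> 0" "Im w \<noteq> 0" using assms oriented_basis_nonzero by (auto simp: oriented_basis_def w_def)
  have "of_real (coord_x L z) + of_real (coord_y L z) * w = z / fst L"
    unfolding coord_x_def coord_y_def w_def[symmetric] using nz by (simp add: complex_eq_iff)
  then have "fst L * (of_real (coord_x L z) + of_real (coord_y L z) * w) = z"
    using nz by simp
  then have "fst L * of_real (coord_x L z) + (fst L * w) * of_real (coord_y L z) = z" by (simp add: algebra_simps)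
  moreover have "fst L * w = snd L" using nz by (simp add: w_def)
  ultimately show ?thesis by (simp add: scaleR_conv_of_real mult.commute)
qed

lemma change_change:
  assumes "oriented_basis L" "oriented_basis L'"
  shows "change L' L (change L L' z) = z"
  unfolding change_def[of L L'] change_combination[OF assms(2)] combination_coords[OF assms(1)] ..

lemma torus_point_change:
  assumes "oriented_basis L"
  shows "change L L' ` torus_point L z = torus_point L' (change L L' z)"
proof -
  have e: "change L L' (z + of_int m * fst L + of_int n * snd L) = change L L' z + of_int m * fst L' + of_int n * snd L'" for m n
  proof -
    have "change L L' (z + of_int m * fst L + of_int n * snd L) = change L L' (z + (of_int m *\<^sub>R fst L + of_int n *\<^sub>R snd L))"
      by (simp add: scaleR_conv_of_real add.assoc)
    also have "\<dots> = change L L' z + (of_int m *\<^sub>R fst L' + of_int n *\<^sub>R snd L')"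
      unfolding linear_add[OF linear_change, of _ _ z] change_combination[OF assms] ..
    finally show ?thesis by (simp add: scaleR_conv_of_real add.assoc)
  qed
  show ?thesis
  proof (intro antisym subsetI)
    fix w assume "w \<in> change L L' ` torus_point L z"
    then obtain m n :: int where "w = change L L' (z + of_int m * fst L + of_int n * snd L)"
      by (auto simp: torus_point_mem)
    then show "w \<in> torus_point L' (change L L' z)" unfolding e torus_point_mem by blast
  next
    fix w assume "w \<in> torus_point L' (change L L' z)"
    then obtain m n :: int where w: "w = change L L' z + of_int m * fst L' + of_int n * snd L'"
      by (auto simp: torus_point_mem)
    have "z + of_int m * fst L + of_int n * snd L \<in> torus_point L z" unfolding torus_point_mem by blast
    then show "w \<in> change L L' ` torus_point L z" unfolding w e[symmetric] by (rule imageI)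
  qed
qed

definition induced :: "basis \<Rightarrow> basis \<Rightarrow> complex set \<Rightarrow> complex set" where
  "induced L L' x = change L L' ` x"

lemma induced: "oriented_basis L \<Longrightarrow> induced L L' (torus_point L z) = torus_point L' (change L L' z)"
  by (simp add: induced_def torus_point_change)

lemma bij_betw_induced:
  assumes "oriented_basis L" "oriented_basis L'"
  shows "bij_betw (induced L L') (torus L) (torus L')"
proof (rule bij_betw_byWitness[of _ "induced L' L"])
  show "\<forall>x\<in>torus L. induced L' L (induced L L' x) = x" "\<forall>x\<in>torus L'. induced L L' (induced L' L x) = x"
    using assms by (auto simp: torus_def induced change_change)
  show "induced L L' ` torus L \<subseteq> torus L'" "induced L' L ` torus L' \<subseteq> torus L"
    using assms by (auto simp: torus_def induced)
qed

lemma torus_dist_induced_le: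
  assumes "oriented_basis L" "x \<in> torus L" "y \<in> torus L" and c: "\<And>z. norm (change L L' z) \<le> c * norm z" "c > 0"
  shows "torus_dist (induced L L' x) (induced L L' y) \<le> c * torus_dist x y"
proof -
  have ne: "x \<noteq> {}" "y \<noteq> {}" using assms(2,3) by (auto simp: torus_def torus_point_def)
  have "setdist (induced L L' x) (induced L L' y) / c \<le> setdist x y"
  proof (rule le_setdistI)
    fix u v assume uv: "u \<in> x" "v \<in> y"
    have "setdist (induced L L' x) (induced L L' y) \<le> dist (change L L' u) (change L L' v)"
      using uv by (intro setdist_le_dist) (auto simp: induced_def)
    also have "\<dots> = norm (change L L' (u - v))"
      by (simp add: dist_norm linear_diff[OF linear_change])
    also have "\<dots> \<le> c * dist u v" using c(1)[of "u - v"] by (simp add: dist_norm)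
    finally show "setdist (induced L L' x) (induced L L' y) / c \<le> dist u v"
      using c(2) by (simp add: divide_le_eq mult.commute)
  qed (use ne in auto)
  then show ?thesis using c(2) by (simp add: torus_dist_def divide_le_eq mult.commute)
qed

lemma bilipschitz_induced:
  assumes "oriented_basis L" "oriented_basis L'"
    and "\<And>z. norm (change L L' z) \<le> c * norm z" "\<And>z. norm (change L' L z) \<le> c * norm z" "c > 0"
  shows "bilipschitz c L L' (induced L L')"
  unfolding bilipschitz_def
proof (intro conjI ballI)
  show "bij_betw (induced L L') (torus L) (torus L')" using assms by (intro bij_betw_induced)
  fix x y assume xy: "x \<in> torus L" "y \<in> torus L"
  show "torus_dist (induced L L' x) (induced L L' y) \<le> c * torus_dist x y"
    using assms xy by (intro torus_dist_induced_le) auto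
  have mem: "induced L L' x \<in> torus L'" "induced L L' y \<in> torus L'"
    using xy assms by (auto simp: torus_def induced)
  have "torus_dist (induced L' L (induced L L' x)) (induced L' L (induced L L' y)) \<le> c * torus_dist (induced L L' x) (induced L L' y)"
    using assms mem by (intro torus_dist_induced_le) auto
  moreover have "induced L' L (induced L L' x) = x" "induced L' L (induced L L' y) = y"
    using xy assms by (auto simp: torus_def induced change_change)
  ultimately show "torus_dist x y / c \<le> torus_dist (induced L L' x) (induced L L' y)"
    using assms(5) by (simp add: divide_le_eq mult.commute)
qed

text \<open>Each circle is moved by less than its radius relative to the translated circle, so the
  image winds around the centre equally often.\<close>

lemma orientation_preserving_induced:
  assumes "oriented_basis L" and d: "\<And>z. norm (change L L' z - z) \<le> d * norm z" "d < 1"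
  shows "orientation_preserving L L' (induced L L')"
  unfolding orientation_preserving_def
proof (intro exI[of _ "change L L'"] conjI allI impI)
  show cont: "continuous_on UNIV (change L L')"
    using linear_change by (simp add: linear_continuous_on linear_conv_bounded_linear)
  show "induced L L' (torus_point L z) = torus_point L' (change L L' z)" for z
    by (rule induced[OF assms(1)])
  fix z :: complex and r :: real assume "r > 0"
  let ?A = "change L L'"
  have "winding_number (?A \<circ> circlepath z r) (?A z) = winding_number (circlepath (?A z) r) (?A z)"
  proof (rule winding_number_nearby_loops_eq)
    show "path (circlepath (?A z) r)" by simp
    show "path (?A \<circ> circlepath z r)"
      using cont by (intro path_continuous_image) (auto intro: continuous_on_subset)
    show "pathfinish (circlepath (?A z) r) = pathstart (circlepath (?A z) r)" by simp
    show "pathfinish (?A \<circ> circlepath z r) = pathstart (?A \<circ> circlepath z r)"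
      by (simp add: pathfinish_compose pathstart_compose)
    fix t :: real
    define e where "e = of_real r * exp (2 * of_real pi * \<i> * of_real t)"
    have ne: "norm e = r" using \<open>r > 0\<close> by (simp add: e_def norm_mult)
    have c: "circlepath z r t = z + e" "circlepath (?A z) r t = ?A z + e"
      by (simp_all add: circlepath e_def)
    have "norm ((?A \<circ> circlepath z r) t - circlepath (?A z) r t) = norm (?A e - e)"
      by (simp add: c linear_add[OF linear_change])
    also have "\<dots> \<le> d * r" using d(1)[of e] by (simp add: ne)
    also have "\<dots> < r" using d(2) \<open>r > 0\<close> by simp
    also have "r = norm (circlepath (?A z) r t - ?A z)" by (simp add: c ne)
    finally show "norm ((?A \<circ> circlepath z r) t - circlepath (?A z) r t) < norm (circlepath (?A z) r t - ?A z)" .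
  qed
  also have "\<dots> = 1" using \<open>r > 0\<close> by (simp add: winding_number_circlepath_centre)
  finally show "winding_number (?A \<circ> circlepath z r) (?A z) = 1" .
qed

section \<open>Limits of tiled tori\<close>

lemma change_near_id:
  assumes "oriented_basis L"
  obtains K where "K > 0" "\<And>L' z. norm (change L L' z - z) \<le> K * (norm (fst L' - fst L) + norm (snd L' - snd L)) * norm z"
proof -
  obtain K1 where K1: "K1 > 0" "\<And>z. norm (coord_x L z) \<le> K1 * norm z"
    using linear_bounded_pos[OF linear_coords(1)] by metis
  obtain K2 where K2: "K2 > 0" "\<And>z. norm (coord_y L z) \<le> K2 * norm z"
    using linear_bounded_pos[OF linear_coords(2)] by metis
  show ?thesis
  proof (rule that[of "K1 + K2"])
    show "K1 + K2 > 0" using K1 K2 by simp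
    fix L' z
    have "change L L' z - z = coord_x L z *\<^sub>R (fst L' - fst L) + coord_y L z *\<^sub>R (snd L' - snd L)"
      by (subst (3) combination_coords[OF assms, symmetric]) (simp add: change_def algebra_simps)
    then have "norm (change L L' z - z) \<le> \<bar>coord_x L z\<bar> * norm (fst L' - fst L) + \<bar>coord_y L z\<bar> * norm (snd L' - snd L)"
      by (metis norm_scaleR norm_triangle_ineq)
    also have "\<dots> \<le> ((K1 + K2) * norm z) * norm (fst L' - fst L) + ((K1 + K2) * norm z) * norm (snd L' - snd L)"
      using K1 K2 K1(2)[of z] K2(2)[of z] by (intro add_mono mult_right_mono) (auto simp: distrib_right intro: order_trans add_increasing add_increasing2)
    finally show "norm (change L L' z - z) \<le> (K1 + K2) * (norm (fst L' - fst L) + norm (snd L' - snd L)) * norm z"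
      by (simp add: algebra_simps)
  qed
qed

text \<open>Here \<open>L'\<close> plays the role of the limit: the bound \<open>d\<close> is for
  the map starting at \<open>L'\<close>, for which \<open>change_near_id\<close> has a constant
  independent of the other basis. The factor 4 leaves room for inverting that map. Half of
  \<open>e\<close> pays for the difference of the vertices in space, half for that of the
  developments.\<close>

lemma uniform_distance_tiled_le:
  fixes p p' :: "real^3^8"
  assumes "flat_map L \<zeta> p" "flat_map L' \<zeta>' p'"
    and d: "\<And>z. norm (change L' L z - z) \<le> d * norm z" "0 \<le> d" "d \<le> 1 / 8"
    and e: "\<And>a. 4 * d * norm (\<zeta> a) + norm (\<zeta> a - \<zeta>' a) \<le> e / 2" "4 * d \<le> e" "\<And>a. norm (p $ a - p' $ a) \<le> e / 2"
  shows "uniform_distance L (flat_map.torus_map L \<zeta> p) L' (flat_map.torus_map L' \<zeta>' p') \<le> ereal e"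
proof -
  interpret A: flat_map L \<zeta> p by fact
  interpret B: flat_map L' \<zeta>' p' by fact
  note ob = A.oriented B.oriented
  let ?A = "change L L'"
  have dA: "norm (?A z - z) \<le> 4 * d * norm z \<and> norm (?A z) \<le> (1 + 4 * d) * norm z" for z
  proof -
    define w where "w = ?A z"
    have z: "z = change L' L w" by (simp add: w_def change_change[OF ob])
    have 1: "norm (z - w) \<le> d * norm w" unfolding z by (rule d(1))
    then have "norm w \<le> norm z + d * norm w"
      using norm_triangle_ineq4[of z "z - w"] by simp
    moreover have "d * norm w \<le> (1 / 4) * norm w" using d(3) by (intro mult_right_mono) auto
    ultimately have 2: "norm w \<le> 2 * norm z" using norm_ge_zero[of z] by linarith
    have "d * norm w \<le> d * (2 * norm z)" using 2 d(2) by (intro mult_left_mono)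
    moreover have "0 \<le> d * norm z" using d(2) by simp
    ultimately have 3: "norm (w - z) \<le> 4 * d * norm z" using 1 by (simp add: norm_minus_commute)
    have "norm w \<le> norm z + norm (w - z)" using norm_triangle_ineq[of z "w - z"] by simp
    with 3 show ?thesis by (simp add: w_def algebra_simps)
  qed
  have "bilipschitz (1 + e) L L' (induced L L')"
  proof (rule bilipschitz_induced[OF ob])
    show "norm (?A z) \<le> (1 + e) * norm z" for z
      using dA[of z] mult_right_mono[of "1 + 4 * d" "1 + e" "norm z"] e(2) by auto
    show "norm (change L' L z) \<le> (1 + e) * norm z" for z
    proof -
      have "norm (change L' L z) \<le> norm z + norm (change L' L z - z)"
        using norm_triangle_ineq[of z "change L' L z - z"] by simp
      also have "\<dots> \<le> norm z + d * norm z" using d(1) by simp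
      also have "\<dots> = (1 + d) * norm z" by (simp add: algebra_simps)
      also have "\<dots> \<le> (1 + e) * norm z" using d(2) e(2) by (intro mult_right_mono) auto
      finally show ?thesis .
    qed
    show "0 < 1 + e" using d(2) e(2) by linarith
  qed
  moreover have "orientation_preserving L L' (induced L L')"
    using dA d(3) by (intro orientation_preserving_induced[OF ob(1), of _ "4 * d"]) auto
  moreover have "dist (A.torus_map x) (B.torus_map (induced L L' x)) \<le> e" if mem: "x \<in> torus L" for x
  proof -
    obtain z where "x = torus_point L z" using mem by (auto simp: torus_def)
    moreover obtain r where "z = A.G r" using A.surj_G .
    ultimately have x: "x = torus_point L (A.G r)" by simp
    have "?A (A.G r) - B.G r = pl (\<lambda>v. (?A \<circ> dev L \<zeta>) v - dev L' \<zeta>' v) r"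
      unfolding pl_diff linear_pl[OF linear_change] ..
    \<comment> \<open>The linear parts of the developments correspond under \<open>?A\<close>, so
      that only bounded periodic terms remain.\<close>
    also have "(\<lambda>v. (?A \<circ> dev L \<zeta>) v - dev L' \<zeta>' v) = (\<lambda>v. ?A (\<zeta> (lab v)) - \<zeta>' (lab v))"
    proof
      fix v
      have c: "?A (a *\<^sub>R fst L) = a *\<^sub>R fst L'" "?A (a *\<^sub>R snd L) = a *\<^sub>R snd L'" for a
        using change_combination[OF ob(1), of L' a 0] change_combination[OF ob(1), of L' 0 a] by simp_all
      show "(?A \<circ> dev L \<zeta>) v - dev L' \<zeta>' v = ?A (\<zeta> (lab v)) - \<zeta>' (lab v)"
        unfolding comp_def dev_def linear_add[OF linear_change] linear_diff[OF linear_change] c by simp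
    qed
    finally have eq: "?A (A.G r) - B.G r = pl (\<lambda>v. ?A (\<zeta> (lab v)) - \<zeta>' (lab v)) r" .
    have "dist (A.torus_map x) (B.torus_map (induced L L' x)) = dist (A.F r) (B.flat (?A (A.G r)))"
      unfolding x induced[OF ob(1)] A.torus_map_G B.torus_map ..
    also have "\<dots> \<le> dist (A.F r) (B.F r) + dist (B.flat (B.G r)) (B.flat (?A (A.G r)))"
      unfolding B.flat_G by (rule dist_triangle)
    also have "\<dots> \<le> norm (A.F r - B.F r) + norm (?A (A.G r) - B.G r)"
      using B.flat_lipschitz[of "B.G r" "?A (A.G r)"] by (simp add: dist_norm norm_minus_commute)
    also have "\<dots> = norm (pl (\<lambda>v. p $ lab v - p' $ lab v) r) + norm (pl (\<lambda>v. ?A (\<zeta> (lab v)) - \<zeta>' (lab v)) r)"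
      unfolding eq pl_diff by (simp add: comp_def)
    also have "\<dots> \<le> e / 2 + e / 2"
    proof (intro add_mono norm_pl_le)
      show "norm (p $ lab v - p' $ lab v) \<le> e / 2" for v by (rule e(3))
      show "norm (?A (\<zeta> (lab v)) - \<zeta>' (lab v)) \<le> e / 2" for v
      proof -
        have "norm (?A (\<zeta> (lab v)) - \<zeta>' (lab v)) \<le> norm (?A (\<zeta> (lab v)) - \<zeta> (lab v)) + norm (\<zeta> (lab v) - \<zeta>' (lab v))"
          using norm_triangle_ineq[of "?A (\<zeta> (lab v)) - \<zeta> (lab v)" "\<zeta> (lab v) - \<zeta>' (lab v)"] by simp
        then show ?thesis using dA[of "\<zeta> (lab v)"] e(1)[of "lab v"] by linarith
      qed
    qed
    also have "\<dots> = e" by simp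
    finally show ?thesis .
  qed
  ultimately show ?thesis
    unfolding uniform_distance_def using d(2) e(2)
    by (intro Inf_lower) (auto intro!: exI[of _ e] exI[of _ "induced L L'"])
qed

text \<open>The length equations are closed, and so is the estimate \<open>dist_F_le\<close>, from
  which the limit inherits \<open>consistent\<close>.\<close>

theorem limit_of_tiled:
  assumes tiled: "\<And>n. tiled (Ls n) (\<zeta>s n) (ps n) (fs n)"
    and pups: "\<And>n. pup_tent (ps n)"
    and ob: "oriented_basis L"
    and lims: "(\<lambda>n. fst (Ls n)) \<longlonglongrightarrow> fst L" "(\<lambda>n. snd (Ls n)) \<longlonglongrightarrow> snd L"
      "\<And>a. (\<lambda>n. \<zeta>s n a) \<longlonglongrightarrow> \<zeta> a" "ps \<longlonglongrightarrow> p"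
  shows "flat_map L \<zeta> p"
    and "pup_tents_approximate Ls (\<lambda>n. flat_map.torus_map (Ls n) (\<zeta>s n) (ps n)) ps L (flat_map.torus_map L \<zeta> p)"
proof -
  have limp: "(\<lambda>n. ps n $ a) \<longlonglongrightarrow> p $ a" for a by (rule tendsto_vec_nth[OF lims(4)])
  have lim1: "(\<lambda>n. edge1 (Ls n) (\<zeta>s n) a) \<longlonglongrightarrow> edge1 L \<zeta> a"
    and lim3: "(\<lambda>n. edge3 (Ls n) (\<zeta>s n) a) \<longlonglongrightarrow> edge3 L \<zeta> a" for a
    unfolding edge1_def edge3_def by (intro tendsto_intros lims)+
  have limG: "(\<lambda>n. pl (dev (Ls n) (\<zeta>s n)) r) \<longlonglongrightarrow> pl (dev L \<zeta>) r" for r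
    by (intro tendsto_pl) (auto simp: dev_def intro!: tendsto_intros lims)
  have limF: "(\<lambda>n. pl (($) (ps n) \<circ> lab) r) \<longlonglongrightarrow> pl (($) p \<circ> lab) r" for r
    by (intro tendsto_pl) (auto intro!: limp)
  show flat: "flat_map L \<zeta> p"
  proof unfold_locales
    show "oriented_basis L" by fact
    fix a :: 8
    show "norm (edge1 L \<zeta> a) = dist (p $ a) (p $ (a + 1))"
    proof (rule LIMSEQ_unique)
      show "(\<lambda>n. norm (edge1 (Ls n) (\<zeta>s n) a)) \<longlonglongrightarrow> norm (edge1 L \<zeta> a)" by (intro tendsto_intros lim1)
      show "(\<lambda>n. norm (edge1 (Ls n) (\<zeta>s n) a)) \<longlonglongrightarrow> dist (p $ a) (p $ (a + 1))"
        unfolding tiled.norm_edge1[OF tiled] by (intro tendsto_dist limp)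
    qed
    show "norm (edge3 L \<zeta> a) = dist (p $ a) (p $ (a + 3))"
    proof (rule LIMSEQ_unique)
      show "(\<lambda>n. norm (edge3 (Ls n) (\<zeta>s n) a)) \<longlonglongrightarrow> norm (edge3 L \<zeta> a)" by (intro tendsto_intros lim3)
      show "(\<lambda>n. norm (edge3 (Ls n) (\<zeta>s n) a)) \<longlonglongrightarrow> dist (p $ a) (p $ (a + 3))"
        unfolding tiled.norm_edge3[OF tiled] by (intro tendsto_dist limp)
    qed
    show "norm (edge3 L \<zeta> a - edge1 L \<zeta> a) = dist (p $ (a + 1)) (p $ (a + 3))"
    proof (rule LIMSEQ_unique)
      show "(\<lambda>n. norm (edge3 (Ls n) (\<zeta>s n) a - edge1 (Ls n) (\<zeta>s n) a)) \<longlonglongrightarrow> norm (edge3 L \<zeta> a - edge1 L \<zeta> a)"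
        by (intro tendsto_intros lim1 lim3)
      show "(\<lambda>n. norm (edge3 (Ls n) (\<zeta>s n) a - edge1 (Ls n) (\<zeta>s n) a)) \<longlonglongrightarrow> dist (p $ (a + 1)) (p $ (a + 3))"
        unfolding tiled.norm_edge2[OF tiled] by (intro tendsto_dist limp)
    qed
  next
    fix r r' assume eq: "pl (dev L \<zeta>) r = pl (dev L \<zeta>) r'"
    have "dist (pl (($) p \<circ> lab) r) (pl (($) p \<circ> lab) r') \<le> dist (pl (dev L \<zeta>) r) (pl (dev L \<zeta>) r')"
    proof (rule LIMSEQ_le)
      show "(\<lambda>n. dist (pl (($) (ps n) \<circ> lab) r) (pl (($) (ps n) \<circ> lab) r')) \<longlonglongrightarrow> dist (pl (($) p \<circ> lab) r) (pl (($) p \<circ> lab) r')"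
        by (intro tendsto_dist limF)
      show "(\<lambda>n. dist (pl (dev (Ls n) (\<zeta>s n)) r) (pl (dev (Ls n) (\<zeta>s n)) r')) \<longlonglongrightarrow> dist (pl (dev L \<zeta>) r) (pl (dev L \<zeta>) r')"
        by (intro tendsto_dist limG)
      show "\<exists>N. \<forall>n\<ge>N. dist (pl (($) (ps n) \<circ> lab) r) (pl (($) (ps n) \<circ> lab) r') \<le> dist (pl (dev (Ls n) (\<zeta>s n)) r) (pl (dev (Ls n) (\<zeta>s n)) r')"
      proof (intro exI[of _ 0] allI impI)
        fix n :: nat
        interpret tiled "Ls n" "\<zeta>s n" "ps n" "fs n" by (rule tiled)
        show "dist (pl (($) (ps n) \<circ> lab) r) (pl (($) (ps n) \<circ> lab) r') \<le> dist (pl (dev (Ls n) (\<zeta>s n)) r) (pl (dev (Ls n) (\<zeta>s n)) r')"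
          by (rule dist_F_le)
      qed
    qed
    then show "pl (($) p \<circ> lab) r = pl (($) p \<circ> lab) r'" by (simp add: eq)
  qed
  have flats: "flat_map (Ls n) (\<zeta>s n) (ps n)" for n
  proof -
    interpret tiled "Ls n" "\<zeta>s n" "ps n" "fs n" by (rule tiled)
    show ?thesis by unfold_locales
  qed
  obtain K where K: "K > 0" "\<And>L' z. norm (change L L' z - z) \<le> K * (norm (fst L' - fst L) + norm (snd L' - snd L)) * norm z"
    using change_near_id[OF ob] by metis
  define d where "d n = K * (norm (fst (Ls n) - fst L) + norm (snd (Ls n) - snd L))" for n
  \<comment> \<open>Sums over all labels dominate each single vertex, and every summand tends to
    0.\<close>
  define e where "e n = 2 * (4 * d n * (\<Sum>a\<in>UNIV. norm (\<zeta>s n a)) + (\<Sum>a\<in>UNIV. norm (\<zeta>s n a - \<zeta> a)))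
      + 2 * (\<Sum>a\<in>UNIV. norm (ps n $ a - p $ a)) + 4 * d n" for n
  have d0: "0 \<le> d n" for n using K(1) by (simp add: d_def)
  have "d \<longlonglongrightarrow> K * (norm (fst L - fst L) + norm (snd L - snd L))"
    unfolding d_def by (intro tendsto_intros lims)
  then have limd: "d \<longlonglongrightarrow> 0" by simp
  have "e \<longlonglongrightarrow> 2 * (4 * 0 * (\<Sum>a\<in>UNIV. norm (\<zeta> a)) + (\<Sum>a\<in>UNIV. norm (\<zeta> a - \<zeta> a)))
      + 2 * (\<Sum>a\<in>UNIV. norm (p $ a - p $ a)) + 4 * 0"
    unfolding e_def by (intro tendsto_intros lims limd limp)
  then have lime: "(\<lambda>n. ereal (e n)) \<longlonglongrightarrow> 0" by (simp add: zero_ereal_def)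
  have "\<forall>\<^sub>F n in sequentially. d n < 1 / 8"
    using limd by (rule order_tendstoD) simp
  then have ev: "\<forall>\<^sub>F n in sequentially. uniform_distance (Ls n) (flat_map.torus_map (Ls n) (\<zeta>s n) (ps n)) L (flat_map.torus_map L \<zeta> p) \<le> ereal (e n)"
  proof eventually_elim
    case (elim n)
    have s: "norm (g a) \<le> (\<Sum>a\<in>UNIV. norm (g a))" for g :: "8 \<Rightarrow> 'z::real_normed_vector" and a
      by (rule member_le_sum) auto
    have s0: "0 \<le> (\<Sum>a\<in>UNIV. norm (g a))" for g :: "8 \<Rightarrow> 'z::real_normed_vector"
      by (rule sum_nonneg) auto
    have t0: "0 \<le> 4 * d n * (\<Sum>a\<in>UNIV. norm (\<zeta>s n a))" using d0[of n] s0[of "\<zeta>s n"] by (intro mult_nonneg_nonneg) auto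
    show ?case
    proof (rule uniform_distance_tiled_le[OF flats flat, of n "d n"])
      show "norm (change L (Ls n) z - z) \<le> d n * norm z" for z unfolding d_def by (rule K(2))
      show "0 \<le> d n" "d n \<le> 1 / 8" using d0 elim by auto
      show "4 * d n * norm (\<zeta>s n a) + norm (\<zeta>s n a - \<zeta> a) \<le> e n / 2" for a
      proof -
        have "4 * d n * norm (\<zeta>s n a) \<le> 4 * d n * (\<Sum>a\<in>UNIV. norm (\<zeta>s n a))"
          using d0[of n] s[of "\<zeta>s n" a] by (intro mult_left_mono) auto
        then show ?thesis
          using s[of "\<lambda>a. \<zeta>s n a - \<zeta> a" a] s0[of "\<lambda>a. ps n $ a - p $ a"] d0[of n] unfolding e_def by simp
      qed
      show "4 * d n \<le> e n"
        using s0[of "\<lambda>a. \<zeta>s n a - \<zeta> a"] s0[of "\<lambda>a. ps n $ a - p $ a"] t0 unfolding e_def by simp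
      show "norm (ps n $ a - p $ a) \<le> e n / 2" for a
        using s[of "\<lambda>a. ps n $ a - p $ a" a] s0[of "\<lambda>a. \<zeta>s n a - \<zeta> a"] t0 d0[of n] unfolding e_def by simp
    qed
  qed
  show "pup_tents_approximate Ls (\<lambda>n. flat_map.torus_map (Ls n) (\<zeta>s n) (ps n)) ps L (flat_map.torus_map L \<zeta> p)"
    unfolding pup_tents_approximate_def
  proof
    show "\<forall>n. pup_tent_map (Ls n) (flat_map.torus_map (Ls n) (\<zeta>s n) (ps n)) (ps n)"
      using tiled pups by (blast intro: tiled.pup_tent_map_torus_map)
    show "(\<lambda>n. uniform_distance (Ls n) (flat_map.torus_map (Ls n) (\<zeta>s n) (ps n)) L (flat_map.torus_map L \<zeta> p)) \<longlonglongrightarrow> 0"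
    proof (rule tendsto_sandwich[OF _ ev _ lime])
      show "\<forall>\<^sub>F n in sequentially. 0 \<le> uniform_distance (Ls n) (flat_map.torus_map (Ls n) (\<zeta>s n) (ps n)) L (flat_map.torus_map L \<zeta> p)"
        unfolding uniform_distance_def by (intro always_eventually allI Inf_greatest) auto
    qed auto
  qed
qed

corollary gracefully_immersed_limit:
  assumes "flat_map L \<zeta> p" "pup_tents_approximate Ls \<phi>s ps L (flat_map.torus_map L \<zeta> p)"
  shows "gracefully_immersed (L, flat_map.torus_map L \<zeta> p)"
proof -
  interpret flat_map L \<zeta> p by fact
  show ?thesis
    unfolding gracefully_immersed_def using oriented piecewise_linear_torus_map preserves_path_lengths_torus_map assms(2) by blast
qed

section \<open>Tuples in coordinates\<close>

definition point :: "real \<Rightarrow> real \<Rightarrow> real \<Rightarrow> real^3" where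
  "point x y z = vector [x, y, z]"

definition sym_tuple :: "real^3 \<Rightarrow> real^3 \<Rightarrow> real^3 \<Rightarrow> real^3 \<Rightarrow> real^3^8" where
  "sym_tuple p0 p1 p2 p3 = (\<chi> i. if i = 0 then p0 else if i = 1 then p1 else if i = 2 then p2 else if i = 3 then p3
     else if i = 4 then \<rho> p3 else if i = 5 then \<rho> p2 else if i = 6 then \<rho> p1 else \<rho> p0)"

lemma point_nth [simp]: "vec_nth (point x y z) 1 = x" "vec_nth (point x y z) 2 = y" "vec_nth (point x y z) 3 = z"
  by (simp_all add: point_def)

lemma \<rho>_point [simp]: "\<rho> (point x y z) = point (- x) (- y) z"
  by (simp add: vec_eq_iff forall_3)

lemma sym_tuple_nth:
  "vec_nth (sym_tuple p0 p1 p2 p3) 0 = p0" "vec_nth (sym_tuple p0 p1 p2 p3) 1 = p1"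
  "vec_nth (sym_tuple p0 p1 p2 p3) 2 = p2" "vec_nth (sym_tuple p0 p1 p2 p3) 3 = p3"
  "vec_nth (sym_tuple p0 p1 p2 p3) 4 = \<rho> p3" "vec_nth (sym_tuple p0 p1 p2 p3) 5 = \<rho> p2"
  "vec_nth (sym_tuple p0 p1 p2 p3) 6 = \<rho> p1" "vec_nth (sym_tuple p0 p1 p2 p3) 7 = \<rho> p0"
  by (simp_all add: sym_tuple_def)

lemma \<rho>_\<rho> [simp]: "\<rho> (\<rho> v) = v"
  by (simp add: vec_eq_iff forall_3)

lemma sym_tuple_symmetric: "vec_nth (sym_tuple p0 p1 p2 p3) (7 - j) = \<rho> (vec_nth (sym_tuple p0 p1 p2 p3) j)"
proof -
  have "\<forall>j. vec_nth (sym_tuple p0 p1 p2 p3) (7 - j) = \<rho> (vec_nth (sym_tuple p0 p1 p2 p3) j)"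
    unfolding all_8 by (simp add: sym_tuple_nth)
  then show ?thesis by blast
qed

definition signs_agree :: "(nat \<times> nat \<times> nat \<times> nat \<times> int) list \<Rightarrow> real^3^8 \<Rightarrow> bool" where
  "signs_agree qs p \<longleftrightarrow> (\<forall>(a, b, c, d, s) \<in> set qs. sgn (vol p a b c d) = of_int s)"

text \<open>
  The quadruples of vertices are sorted by their behaviour at the special configurations below:
  stable ones, those among the six floor vertices, and those in the plane of a tent wall.
\<close>

definition stable_quads :: "(nat \<times> nat \<times> nat \<times> nat \<times> int) list" where
  "stable_quads = [(0,1,2,4,1),(0,1,2,5,1),(0,1,2,6,1),(0,1,3,4,1),(0,1,3,5,1),(0,1,3,6,1),(0,1,4,6,-1),(0,1,4,7,1),(0,1,5,6,-1),(0,1,5,7,1),(0,1,6,7,1),(0,2,3,4,1),(0,2,3,5,1),(0,2,4,5,-1),(0,2,4,6,-1),(0,2,4,7,1),(0,2,5,6,-1),(0,2,5,7,1),(0,3,4,6,-1),(0,3,5,6,-1)]"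

definition floor_quads :: "(nat \<times> nat \<times> nat \<times> nat \<times> int) list" where
  "floor_quads = [(1,2,3,4,1),(1,2,3,5,1),(1,2,3,6,1),(1,2,4,5,-1),(1,2,4,6,-1),(1,3,4,5,1),(1,3,4,6,-1),(2,3,4,5,1)]"

definition wall_quads :: "(nat \<times> nat \<times> nat \<times> nat \<times> int) list" where
  "wall_quads = [(0,1,2,3,1),(0,1,2,7,-1),(0,1,3,7,-1),(0,2,3,7,-1),(0,4,5,6,-1)]"

lemma pup_chirotope_iff:
  "pup_chirotope p \<longleftrightarrow> signs_agree stable_quads p \<and> signs_agree floor_quads p \<and> signs_agree wall_quads p"
proof -
  have "set quads = set stable_quads \<union> set floor_quads \<union> set wall_quads"
    unfolding quads_def stable_quads_def floor_quads_def wall_quads_def by (simp add: insert_commute)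
  then show ?thesis unfolding pup_chirotope_def signs_agree_def by blast
qed

lemma tendsto_vol:
  assumes "(p \<longlongrightarrow> p0) F"
  shows "((\<lambda>n. vol (p n) a b c d) \<longlongrightarrow> vol p0 a b c d) F"
  unfolding vol_def orient_expand by (intro tendsto_intros assms)

lemma signs_agree_stable:
  assumes "signs_agree qs p0" "(p \<longlongrightarrow> p0) F" and nz: "list_all (\<lambda>(a, b, c, d, s). s \<noteq> 0) qs"
  shows "\<forall>\<^sub>F n in F. signs_agree qs (p n)"
proof -
  have "\<forall>\<^sub>F n in F. sgn (vol (p n) a b c d) = of_int s" if q: "(a, b, c, d, s) \<in> set qs" for a b c d s
  proof -
    have s: "sgn (vol p0 a b c d) = of_int s" "s \<noteq> 0"
      using assms(1) nz q unfolding signs_agree_def list_all_iff by blast+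
    then consider "vol p0 a b c d > 0" "of_int s = (1::real)" | "vol p0 a b c d < 0" "of_int s = (-1::real)"
      by (cases "vol p0 a b c d" "0::real" rule: linorder_cases) auto
    then show ?thesis
    proof cases
      case 1
      have "\<forall>\<^sub>F n in F. vol (p n) a b c d > 0"
        using order_tendstoD(1)[OF tendsto_vol[OF assms(2)] 1(1)] .
      then show ?thesis by eventually_elim (simp add: 1)
    next
      case 2
      have "\<forall>\<^sub>F n in F. vol (p n) a b c d < 0"
        using order_tendstoD(2)[OF tendsto_vol[OF assms(2)] 2(1)] .
      then show ?thesis by eventually_elim (simp add: 2)
    qed
  qed
  then have "\<forall>\<^sub>F n in F. \<forall>q\<in>set qs. case q of (a, b, c, d, s) \<Rightarrow> sgn (vol (p n) a b c d) = of_int s"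
    by (intro eventually_ball_finite ballI) auto
  then show ?thesis unfolding signs_agree_def .
qed

lemma quads_nonzero:
  "list_all (\<lambda>(a, b, c, d, s). s \<noteq> 0) stable_quads" "list_all (\<lambda>(a, b, c, d, s). s \<noteq> 0) floor_quads"
  "list_all (\<lambda>(a, b, c, d, s). s \<noteq> 0) wall_quads"
  by (simp_all add: stable_quads_def floor_quads_def wall_quads_def)

subsection \<open>The special configurations\<close>

text \<open>
  Up to an affine map a special configuration is a tent over a rectangle whose ridge, of relative
  length \<open>2 * x\<close>, is parallel to two of its sides.
\<close>

definition special :: "real \<Rightarrow> real \<Rightarrow> real \<Rightarrow> real \<Rightarrow> real \<Rightarrow> real \<Rightarrow> real \<Rightarrow> real^3^8" where
  "special g v x h0 h1 h2 h3 = sym_tuple (point (- x) (g * x) h0) (point (1/2) (- v - g / 2) h1) (point 0 (- v) h2) (point (- 1/2) (- v + g / 2) h3)"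

lemmas vol_coords = vol_def orient_expand sym_tuple_nth special_def

lemma special_stable_volumes:
  fixes g v x A :: real
  defines "p \<equiv> special g v x A 0 0 0"
  shows "vol p 0 1 2 4 = 1 * (A * v)"
    and "vol p 0 1 2 5 = 1 * (A * v)"
    and "vol p 0 1 2 6 = 1 * (A * v)"
    and "vol p 0 1 3 4 = 2 * (A * v)"
    and "vol p 0 1 3 5 = 2 * (A * v)"
    and "vol p 0 1 3 6 = 2 * (A * v)"
    and "vol p 0 1 4 6 = - (2 * (A * v))"
    and "vol p 0 1 4 7 = 4 * (A * v * x)"
    and "vol p 0 1 5 6 = - (1 * (A * v))"
    and "vol p 0 1 5 7 = 4 * (A * v * x)"
    and "vol p 0 1 6 7 = 4 * (A * v * x)"
    and "vol p 0 2 3 4 = 1 * (A * v)"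
    and "vol p 0 2 3 5 = 1 * (A * v)"
    and "vol p 0 2 4 5 = - (1 * (A * v))"
    and "vol p 0 2 4 6 = - (2 * (A * v))"
    and "vol p 0 2 4 7 = 4 * (A * v * x)"
    and "vol p 0 2 5 6 = - (1 * (A * v))"
    and "vol p 0 2 5 7 = 4 * (A * v * x)"
    and "vol p 0 3 4 6 = - (2 * (A * v))"
    and "vol p 0 3 5 6 = - (1 * (A * v))"
  unfolding p_def by (simp_all add: vol_coords field_simps)

lemma special_floor_volumes:
  fixes g v x A :: real
  defines "p \<equiv> special g v x A 1 (- 1) 0"
  shows "vol p 1 2 3 4 = 3 * (v)"
    and "vol p 1 2 3 5 = 3 * (v)"
    and "vol p 1 2 3 6 = 3 * (v)"
    and "vol p 1 2 4 5 = - (1 * (v))"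
    and "vol p 1 2 4 6 = - (5 * (v))"
    and "vol p 1 3 4 5 = 1 * (v)"
    and "vol p 1 3 4 6 = - (4 * (v))"
    and "vol p 2 3 4 5 = 2 * (v)"
  unfolding p_def by (simp_all add: vol_coords field_simps)

lemma special_signs:
  assumes "0 < v" "0 < x" "0 < A"
  shows "signs_agree stable_quads (special g v x A 0 0 0)" "signs_agree floor_quads (special g v x A 1 (- 1) 0)"
  unfolding signs_agree_def stable_quads_def floor_quads_def
  using assms by (simp_all add: special_stable_volumes special_floor_volumes sgn_mult del: One_nat_def)

text \<open>Scaling the third coordinate scales volumes, and the floor vertices have only the
  heights \<open>s\<close>, \<open>- s\<close> and 0. The signs, which degenerate with
  \<open>s\<close>, can thus be read off from a tuple with a nondegenerate limit.\<close>

lemma floor_signs_scale: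
  assumes "s > 0"
  shows "signs_agree floor_quads (sym_tuple (point x0 y0 h0) (point x1 y1 s) (point x2 y2 (- s)) (point x3 y3 0)) \<longleftrightarrow>
    signs_agree floor_quads (sym_tuple (point x0 y0 h0') (point x1 y1 1) (point x2 y2 (- 1)) (point x3 y3 0))"
proof -
  let ?p = "sym_tuple (point x0 y0 h0) (point x1 y1 s) (point x2 y2 (- s)) (point x3 y3 0)"
  let ?q = "sym_tuple (point x0 y0 h0') (point x1 y1 1) (point x2 y2 (- 1)) (point x3 y3 0)"
  have "list_all (\<lambda>(a, b, c, d, _). vol ?p a b c d = s * vol ?q a b c d) floor_quads"
    unfolding floor_quads_def
    by (simp add: vol_coords field_simps)
  then have "sgn (vol ?p a b c d) = sgn (vol ?q a b c d)" if "(a, b, c, d, t) \<in> set floor_quads" for a b c d t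
    using that assms unfolding list_all_iff by (auto simp: sgn_mult)
  then show ?thesis unfolding signs_agree_def by fastforce
qed

text \<open>The number \<open>u\<close> below measures how far vertex 2 bulges out of the chord from
  1 to 3, and \<open>k\<close> how far the ridge is turned against that chord. Both vanish in a
  special configuration, and the five volumes are combinations of them.\<close>

lemma wall_signs:
  assumes "A > 0" and out: "2 * y2 - y1 - y3 < 0" and "x0 < 0"
    and rear: "0 < y0 - (y1 - y3) * x0" "(2 * y2 - y1 - y3) * x0 < y0 - (y1 - y3) * x0"
  shows "signs_agree wall_quads (sym_tuple (point x0 y0 A) (point (1/2) y1 0) (point 0 y2 0) (point (- 1/2) y3 0))"
proof -
  let ?p = "sym_tuple (point x0 y0 A) (point (1/2) y1 0) (point 0 y2 0) (point (- 1/2) y3 0)"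
  define u where "u = 2 * y2 - y1 - y3"
  define k where "k = y0 - (y1 - y3) * x0"
  note u_k_def = u_def k_def
  have "vol ?p 0 1 2 3 = - (A * u / 2)" "vol ?p 0 4 5 6 = A * u / 2" "vol ?p 0 1 3 7 = - (2 * (A * k))"
    "vol ?p 0 1 2 7 = - (A * (k + u * x0))" "vol ?p 0 2 3 7 = - (A * (k - u * x0))"
    unfolding u_k_def by (simp_all add: vol_coords field_simps)
  moreover have "u < 0" "k > 0" "k - u * x0 > 0" "u * x0 > 0"
    using assms by (simp_all add: u_k_def mult_neg_neg)
  then have "A * u < 0" "A * k > 0" "A * (k - u * x0) > 0" "A * (k + u * x0) > 0"
    using assms(1) by (simp_all add: mult_pos_neg)
  ultimately show ?thesis
    unfolding signs_agree_def wall_quads_def by (simp add: sgn_minus del: One_nat_def)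
qed

section \<open>Markings of flat tori\<close>

text \<open>
  On the flat torus with periods 2 and \<open>2 * \<tau>\<close> the vector \<open>2 * u\<^sub>j\<close> is the edge from the vertex \<open>7 - j\<close>
  to the vertex \<open>j\<close>; the constants make the marking invariant under a half-turn that covers \<open>\<rho>\<close>.
\<close>

definition marking :: "complex \<Rightarrow> complex \<Rightarrow> complex \<Rightarrow> complex \<Rightarrow> complex \<Rightarrow> 8 \<Rightarrow> complex" where
  "marking \<tau> u0 u1 u2 u3 a =
    (if a = 0 then u0 else if a = 1 then u1 - 1/4 - \<tau>/4 else if a = 2 then u2 - 1/2 + \<tau>/2
     else if a = 3 then u3 - 3/4 + \<tau>/4 else if a = 4 then - u3 else if a = 5 then - u2 - 1/4 - \<tau>/4
     else if a = 6 then - u1 - 1/2 + \<tau>/2 else - u0 - 3/4 + \<tau>/4)"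

context
  fixes \<tau> u0 u1 u2 u3 :: complex and e1 e3 :: "8 \<Rightarrow> complex"
  defines "e1 \<equiv> edge1 (2, 2 * \<tau>) (marking \<tau> u0 u1 u2 u3)"
    and "e3 \<equiv> edge3 (2, 2 * \<tau>) (marking \<tau> u0 u1 u2 u3)"
begin

lemma marking_edge1:
  "e1 0 = u1 - u0 - 1" "e1 1 = u2 - u1 - 1 + \<tau>" "e1 2 = u3 - u2 - 1" "e1 3 = - 2 * u3"
  "e1 4 = u3 - u2 - 1" "e1 5 = u2 - u1 - 1 + \<tau>" "e1 6 = u1 - u0 - 1" "e1 7 = 2 * u0"
  unfolding e1_def edge1_def marking_def by (simp_all add: scaleR_conv_of_real mod_8 field_simps)

lemma marking_edge3:
  "e3 0 = u3 - u0 - 1 + \<tau>" "e3 1 = - u1 - u3 + \<tau>" "e3 2 = - 2 * u2" "e3 3 = - u1 - u3 + \<tau>"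
  "e3 4 = u3 - u0 - 1 + \<tau>" "e3 5 = u0 + u2 + \<tau>" "e3 6 = 2 * u1" "e3 7 = u0 + u2 + \<tau>"
  unfolding e3_def edge3_def marking_def by (simp_all add: scaleR_conv_of_real mod_8 field_simps)

end

lemma norm_eq_dist_point_iff:
  "norm z = dist (point a b c) (point a' b' c') \<longleftrightarrow> (Re z)\<^sup>2 + (Im z)\<^sup>2 = (a - a')\<^sup>2 + (b - b')\<^sup>2 + (c - c')\<^sup>2"
  by (simp add: norm_complex_def dist_vec_def L2_set_def sum_3 dist_real_def)

lemma twice_norm_eq_dist_point_iff:
  "2 * norm z = dist (point a b c) (point a' b' c') \<longleftrightarrow> 4 * ((Re z)\<^sup>2 + (Im z)\<^sup>2) = (a - a')\<^sup>2 + (b - b')\<^sup>2 + (c - c')\<^sup>2"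
  using norm_eq_dist_point_iff[of "2 * z"] by (simp add: norm_mult power_mult_distrib distrib_left)

text \<open>The 24 edges form 14 orbits under the half-turn. The lengths of 2-5 and 3-4 agree
  because the plane and the tent share \<open>y2\<close>, \<open>k\<close> and \<open>y3\<close>,
  and the edges 2-3 and 2-4 give the same equation; 11 equations remain.\<close>

lemma marking_lengths:
  fixes e f x0 y0 x1 y1 y2 k y3 X0 Y0 X1 Y1 h0 h1 h2 h3 :: real
  defines "\<zeta> \<equiv> marking (Complex e f) (Complex (- x0) y0) (Complex (- x1) y1) (Complex 0 y2) (Complex k y3)"
    and "L \<equiv> (2, 2 * Complex e f)"
    and "p \<equiv> sym_tuple (point X0 Y0 h0) (point X1 Y1 h1) (point 0 y2 h2) (point (- k) y3 h3)"
  assumes "(x0 - x1 - 1)\<^sup>2 + (y1 - y0)\<^sup>2 = (X0 - X1)\<^sup>2 + (Y0 - Y1)\<^sup>2 + (h0 - h1)\<^sup>2"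
    and "(x1 - 1 + e)\<^sup>2 + (y2 - y1 + f)\<^sup>2 = X1\<^sup>2 + (Y1 - y2)\<^sup>2 + (h1 - h2)\<^sup>2"
    and "(k - 1)\<^sup>2 = k\<^sup>2 + (h2 - h3)\<^sup>2"
    and "x0\<^sup>2 + y0\<^sup>2 = X0\<^sup>2 + Y0\<^sup>2"
    and "x1\<^sup>2 + y1\<^sup>2 = X1\<^sup>2 + Y1\<^sup>2"
    and "(k + x0 - 1 + e)\<^sup>2 + (y3 - y0 + f)\<^sup>2 = (X0 + k)\<^sup>2 + (Y0 - y3)\<^sup>2 + (h0 - h3)\<^sup>2"
    and "(x1 - k + e)\<^sup>2 + (f - y1 - y3)\<^sup>2 = (X1 - k)\<^sup>2 + (Y1 + y3)\<^sup>2 + (h1 - h3)\<^sup>2"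
    and "(e - x0)\<^sup>2 + (y0 + y2 + f)\<^sup>2 = X0\<^sup>2 + (Y0 + y2)\<^sup>2 + (h0 - h2)\<^sup>2"
    and "(k + x1 + e)\<^sup>2 + (y3 - y1 + f)\<^sup>2 = (X1 + k)\<^sup>2 + (Y1 - y3)\<^sup>2 + (h1 - h3)\<^sup>2"
    and "(x0 + e)\<^sup>2 + (y2 - y0 + f)\<^sup>2 = X0\<^sup>2 + (Y0 - y2)\<^sup>2 + (h0 - h2)\<^sup>2"
    and "(1 - x0 - x1)\<^sup>2 + (y0 + y1)\<^sup>2 = (X0 + X1)\<^sup>2 + (Y0 + Y1)\<^sup>2 + (h0 - h1)\<^sup>2"
  shows "norm (edge1 L \<zeta> a) = dist (vec_nth p a) (vec_nth p (a + 1))"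
    and "norm (edge3 L \<zeta> a) = dist (vec_nth p a) (vec_nth p (a + 3))"
    and "norm (edge3 L \<zeta> a - edge1 L \<zeta> a) = dist (vec_nth p (a + 1)) (vec_nth p (a + 3))"
proof -
  note E = assms(4-)
  have "\<forall>a. norm (edge1 L \<zeta> a) = dist (vec_nth p a) (vec_nth p (a + 1))"
    unfolding all_8 using E
    by (simp add: L_def \<zeta>_def p_def marking_edge1 sym_tuple_nth mod_8 norm_mult norm_eq_dist_point_iff twice_norm_eq_dist_point_iff, simp add: power2_eq_square algebra_simps)
  then show "norm (edge1 L \<zeta> a) = dist (vec_nth p a) (vec_nth p (a + 1))" ..
  have "\<forall>a. norm (edge3 L \<zeta> a) = dist (vec_nth p a) (vec_nth p (a + 3))"
    unfolding all_8 using E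
    by (simp add: L_def \<zeta>_def p_def marking_edge3 sym_tuple_nth mod_8 norm_mult norm_eq_dist_point_iff twice_norm_eq_dist_point_iff, simp add: power2_eq_square algebra_simps)
  then show "norm (edge3 L \<zeta> a) = dist (vec_nth p a) (vec_nth p (a + 3))" ..
  have "\<forall>a. norm (edge3 L \<zeta> a - edge1 L \<zeta> a) = dist (vec_nth p (a + 1)) (vec_nth p (a + 3))"
    unfolding all_8 using E
    by (simp add: L_def \<zeta>_def p_def marking_edge1 marking_edge3 sym_tuple_nth mod_8 norm_mult norm_eq_dist_point_iff twice_norm_eq_dist_point_iff, simp add: power2_eq_square algebra_simps)
  then show "norm (edge3 L \<zeta> a - edge1 L \<zeta> a) = dist (vec_nth p (a + 1)) (vec_nth p (a + 3))" ..
qed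

text \<open>
  Here \<open>(x\<^sub>j, y\<^sub>j)\<close> and \<open>(X\<^sub>j, Y\<^sub>j)\<close> are the positions of vertex \<open>j\<close> in the (reflected) plane and in the
  horizontal projection of the tent. For given heights the length equations are solved successively;
  all but two of them determine the remaining coordinates, and these two are equivalent to the
  single equation that occurs as a premise.
\<close>

lemma flat_lengths:
  fixes e f s A \<omega> T k x0 y2 \<theta> D y0 r y3 \<alpha> \<beta> g c Q X0 Y0 X1 Y1 x1 y1 :: real
  assumes f: "f \<noteq> 0"
    and T: "T = A + 2 * s" and k: "2 * k = 1 - s\<^sup>2" and x0: "2 * x0 = 1 - A\<^sup>2"
    and y2: "2 * f * y2 = T\<^sup>2 - e\<^sup>2 - f\<^sup>2" and \<theta>: "f * \<theta> = \<omega> + e"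
    and D: "D * (f * (1 + \<theta>\<^sup>2) + 2 * y2) = 2 * x0 * \<omega>" and y0: "f * y0 = y2 * D + e * x0"
    and Y0: "Y0 = y0 + D" and X0: "X0 = - x0 + \<theta> * D"
    and r: "r * k * (D + f) = k * (X0 - x0) + y2 * D + A * s + s\<^sup>2 / 2 + e - (e\<^sup>2 + f\<^sup>2) / 2 + k - e * k"
    and y3: "y3 = k * r" and g: "f * g = e * y2" and c: "2 * f * c = s\<^sup>2 + e\<^sup>2 + f\<^sup>2 - 2 * e * (k - s\<^sup>2)"
    and Q: "(- 1 - r\<^sup>2 - 2 * r * y2 - 2 * g) * Q\<^sup>2 + (2 * c - 2 * r * (k - s\<^sup>2)) * Q = s\<^sup>2"
    and X1: "X1 = k - s\<^sup>2 + Q * (y2 + r)" and Y1: "Y1 = Q * (1 + g) - c"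
    and x1: "x1 = X1 - r * Q - e" and y1: "y1 = Y1 - Q + f"
  shows "(k - 1)\<^sup>2 = k\<^sup>2 + s\<^sup>2"
    and "x0\<^sup>2 + y0\<^sup>2 = X0\<^sup>2 + Y0\<^sup>2"
    and "x1\<^sup>2 + y1\<^sup>2 = X1\<^sup>2 + Y1\<^sup>2"
    and "(x1 - 1 + e)\<^sup>2 + (y2 - y1 + f)\<^sup>2 = X1\<^sup>2 + (Y1 - y2)\<^sup>2 + (2 * s)\<^sup>2"
    and "(k + x0 - 1 + e)\<^sup>2 + (y3 - y0 + f)\<^sup>2 = (X0 + k)\<^sup>2 + (Y0 - y3)\<^sup>2 + (A + s)\<^sup>2"
    and "(x1 - k + e)\<^sup>2 + (f - y1 - y3)\<^sup>2 = (X1 - k)\<^sup>2 + (Y1 + y3)\<^sup>2 + s\<^sup>2"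
    and "(e - x0)\<^sup>2 + (y0 + y2 + f)\<^sup>2 = X0\<^sup>2 + (Y0 + y2)\<^sup>2 + T\<^sup>2"
    and "(k + x1 + e)\<^sup>2 + (y3 - y1 + f)\<^sup>2 = (X1 + k)\<^sup>2 + (Y1 - y3)\<^sup>2 + s\<^sup>2"
    and "(x0 + e)\<^sup>2 + (y2 - y0 + f)\<^sup>2 = X0\<^sup>2 + (Y0 - y2)\<^sup>2 + T\<^sup>2"
    and "X1 * X0 + Y1 * Y0 = (x0 - 1) * x1 + y0 * y1 \<Longrightarrow> (x0 - x1 - 1)\<^sup>2 + (y1 - y0)\<^sup>2 = (X0 - X1)\<^sup>2 + (Y0 - Y1)\<^sup>2 + A\<^sup>2"
    and "X1 * X0 + Y1 * Y0 = (x0 - 1) * x1 + y0 * y1 \<Longrightarrow> (1 - x0 - x1)\<^sup>2 + (y0 + y1)\<^sup>2 = (X0 + X1)\<^sup>2 + (Y0 + Y1)\<^sup>2 + A\<^sup>2"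
proof -
  show "(k - 1)\<^sup>2 = k\<^sup>2 + s\<^sup>2" using k by algebra
  \<comment> \<open>Divided by \<open>f\<close>, and then multiplied by \<open>D\<close>, this is
    the equality of the lengths of \<open>(x0, y0)\<close> and \<open>(X0, Y0)\<close>.\<close>
  have "f * (D * (1 + \<theta>\<^sup>2)) = f * (2 * x0 * \<theta> - 2 * y0)" using D \<theta> y0 by algebra
  then have D': "D * (1 + \<theta>\<^sup>2) = 2 * x0 * \<theta> - 2 * y0" using f by simp
  show E0: "x0\<^sup>2 + y0\<^sup>2 = X0\<^sup>2 + Y0\<^sup>2" unfolding X0 Y0 using D' by algebra
  show E1: "x1\<^sup>2 + y1\<^sup>2 = X1\<^sup>2 + Y1\<^sup>2"
    unfolding x1 y1 using Q k c g X1 Y1 by algebra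
  show "(x1 - 1 + e)\<^sup>2 + (y2 - y1 + f)\<^sup>2 = X1\<^sup>2 + (Y1 - y2)\<^sup>2 + (2 * s)\<^sup>2"
    unfolding x1 y1 using Q k c g X1 Y1 by algebra
  show "(x1 - k + e)\<^sup>2 + (f - y1 - y3)\<^sup>2 = (X1 - k)\<^sup>2 + (Y1 + y3)\<^sup>2 + s\<^sup>2"
    unfolding x1 y1 y3 using Q k c g X1 Y1 by algebra
  show "(k + x1 + e)\<^sup>2 + (y3 - y1 + f)\<^sup>2 = (X1 + k)\<^sup>2 + (Y1 - y3)\<^sup>2 + s\<^sup>2"
    unfolding x1 y1 y3 using Q k c g X1 Y1 by algebra
  show "(e - x0)\<^sup>2 + (y0 + y2 + f)\<^sup>2 = X0\<^sup>2 + (Y0 + y2)\<^sup>2 + T\<^sup>2"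
    using E0 y2 y0 Y0 by algebra
  show "(x0 + e)\<^sup>2 + (y2 - y0 + f)\<^sup>2 = X0\<^sup>2 + (Y0 - y2)\<^sup>2 + T\<^sup>2"
    using E0 y2 y0 Y0 by algebra
  show "(k + x0 - 1 + e)\<^sup>2 + (y3 - y0 + f)\<^sup>2 = (X0 + k)\<^sup>2 + (Y0 - y3)\<^sup>2 + (A + s)\<^sup>2"
  proof -
    have "2 * (r * k * (D + f)) = 2 * k * (X0 - x0) + 2 * y2 * D + 2 * A * s + s\<^sup>2 + 2 * e - (e\<^sup>2 + f\<^sup>2) + 2 * k - 2 * e * k"
      unfolding r by (simp add: field_simps)
    then show ?thesis using E0 y0 Y0 y3 k x0 by algebra
  qed
  show "(x0 - x1 - 1)\<^sup>2 + (y1 - y0)\<^sup>2 = (X0 - X1)\<^sup>2 + (Y0 - Y1)\<^sup>2 + A\<^sup>2"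
    if "X1 * X0 + Y1 * Y0 = (x0 - 1) * x1 + y0 * y1" using that E0 E1 x0 by algebra
  show "(1 - x0 - x1)\<^sup>2 + (y0 + y1)\<^sup>2 = (X0 + X1)\<^sup>2 + (Y0 + Y1)\<^sup>2 + A\<^sup>2"
    if "X1 * X0 + Y1 * Y0 = (x0 - 1) * x1 + y0 * y1" using that E0 E1 x0 by algebra
qed

section \<open>Continuity of tuples, markings and edges\<close>

lemma tendsto_point [tendsto_intros]:
  assumes "(a \<longlongrightarrow> a') F" "(b \<longlongrightarrow> b') F" "(c \<longlongrightarrow> c') F"
  shows "((\<lambda>n. point (a n) (b n) (c n)) \<longlongrightarrow> point a' b' c') F"
proof (rule vec_tendstoI)
  fix i :: 3
  show "((\<lambda>n. vec_nth (point (a n) (b n) (c n)) i) \<longlongrightarrow> vec_nth (point a' b' c') i) F"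
    using assms exhaust_3[of i] by auto
qed

lemma tendsto_\<rho>:
  assumes "(a \<longlongrightarrow> a') F"
  shows "((\<lambda>n. \<rho> (a n)) \<longlongrightarrow> \<rho> a') F"
proof (rule vec_tendstoI)
  fix i :: 3
  show "((\<lambda>n. vec_nth (\<rho> (a n)) i) \<longlongrightarrow> vec_nth (\<rho> a') i) F"
    using exhaust_3[of i] by (auto intro!: tendsto_minus tendsto_vec_nth[OF assms])
qed

lemma tendsto_sym_tuple [tendsto_intros]:
  assumes "(a \<longlongrightarrow> a') F" "(b \<longlongrightarrow> b') F" "(c \<longlongrightarrow> c') F" "(d \<longlongrightarrow> d') F"
  shows "((\<lambda>n. sym_tuple (a n) (b n) (c n) (d n)) \<longlongrightarrow> sym_tuple a' b' c' d') F"
proof (rule vec_tendstoI)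
  fix i
  show "((\<lambda>n. vec_nth (sym_tuple (a n) (b n) (c n) (d n)) i) \<longlongrightarrow> vec_nth (sym_tuple a' b' c' d') i) F"
    unfolding sym_tuple_def using assms by (auto intro!: tendsto_\<rho>)
qed

lemma tendsto_marking:
  assumes "(\<tau> \<longlongrightarrow> \<tau>') F" "(a \<longlongrightarrow> a') F" "(b \<longlongrightarrow> b') F" "(c \<longlongrightarrow> c') F" "(d \<longlongrightarrow> d') F"
  shows "((\<lambda>n. marking (\<tau> n) (a n) (b n) (c n) (d n) i) \<longlongrightarrow> marking \<tau>' a' b' c' d' i) F"
  unfolding marking_def
  by (auto intro!: tendsto_diff tendsto_add tendsto_divide tendsto_minus assms)

lemma tendsto_edges:
  assumes "(L \<longlongrightarrow> L') F" "\<And>i. ((\<lambda>n. \<zeta> n i) \<longlongrightarrow> \<zeta>' i) F"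
  shows "((\<lambda>n. edge1 (L n) (\<zeta> n) a) \<longlongrightarrow> edge1 L' \<zeta>' a) F" "((\<lambda>n. edge3 (L n) (\<zeta> n) a) \<longlongrightarrow> edge3 L' \<zeta>' a) F"
  unfolding edge1_def edge3_def by (intro tendsto_intros assms)+

lemma point_eq_iff: "point a b c = point a' b' c' \<longleftrightarrow> a = a' \<and> b = b' \<and> c = c'"
  by (auto simp: vec_eq_iff forall_3)

lemma sym_tuple_eq_iff: "sym_tuple a b c d = sym_tuple a' b' c' d' \<longleftrightarrow> a = a' \<and> b = b' \<and> c = c' \<and> d = d'"
  by (metis sym_tuple_nth(1-4))

lemma tendsto_eventually_less:
  fixes a b :: "'a \<Rightarrow> real"
  assumes "(a \<longlongrightarrow> a') F" "(b \<longlongrightarrow> b') F" "a' < b'"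
  shows "\<forall>\<^sub>F n in F. a n < b n"
  using order_tendstoD(1)[OF tendsto_diff[OF assms(2,1)], of 0] assms(3) by simp

section \<open>A family of bent tents\<close>

text \<open>
  The vertices 0, 1, 2, 3 are put at the heights \<open>A + s\<close>, \<open>s\<close>, \<open>- s\<close>, 0. For \<open>w = s = 0\<close> one obtains the
  special configuration of \<open>e + i f\<close>, which has a flat floor and flat walls. A small \<open>w\<close> bends the walls
  and a much smaller \<open>s\<close> bends the floor. The remaining length equation is \<open>H w e s = 0\<close>, to be solved for \<open>e\<close>.
  The term \<open>t\<close> is quadratic in \<open>w\<close> because for \<open>s = 0\<close> this equation amounts to \<open>f t = D (w + t)\<close>, where \<open>D\<close>
  is of order \<open>w\<close>.
\<close>

locale bend =
  fixes f l :: real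
  assumes f_pos: "f > 0"
begin

definition "t w = l * w\<^sup>2"
definition "A w e = sqrt (2 * e - t w)"
definition "T w e s = A w e + 2 * s"
definition "k s = (1 - s\<^sup>2) / (2::real)"
definition "x0 w e = (1 - (A w e)\<^sup>2) / 2"
definition "y2 w e s = ((T w e s)\<^sup>2 - e\<^sup>2 - f\<^sup>2) / (2 * f)"
definition "\<theta> w e = (w + e) / f"
definition "den w e s = f * (1 + (\<theta> w e)\<^sup>2) + 2 * y2 w e s"
definition "D w e s = 2 * x0 w e * w / den w e s"
definition "y0 w e s = (y2 w e s * D w e s + e * x0 w e) / f"
definition "Y0 w e s = y0 w e s + D w e s"
definition "X0 w e s = - x0 w e + \<theta> w e * D w e s"
definition "r w e s = (k s * (X0 w e s - x0 w e) + y2 w e s * D w e s + A w e * s + s\<^sup>2 / 2 + e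
  - (e\<^sup>2 + f\<^sup>2) / 2 + k s - e * k s) / (k s * (D w e s + f))"
definition "y3 w e s = k s * r w e s"
definition "g w e s = e * y2 w e s / f"
definition "c e s = (s\<^sup>2 + e\<^sup>2 + f\<^sup>2 - 2 * e * (k s - s\<^sup>2)) / (2 * f)"
definition "\<alpha> w e s = - 1 - (r w e s)\<^sup>2 - 2 * r w e s * y2 w e s - 2 * g w e s"
definition "\<beta> w e s = 2 * c e s - 2 * r w e s * (k s - s\<^sup>2)"
definition "disc w e s = (\<beta> w e s)\<^sup>2 + 4 * \<alpha> w e s * s\<^sup>2"
text \<open>
  Of the two roots of \<open>\<alpha> Q\<^sup>2 + \<beta> Q = s\<^sup>2\<close> this is the one that vanishes with \<open>s\<close>, in a form that also makes
  sense for \<open>\<alpha> = 0\<close>.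
\<close>

definition "Q w e s = 2 * s\<^sup>2 / (\<beta> w e s + sqrt (disc w e s))"
definition "X1 w e s = k s - s\<^sup>2 + Q w e s * (y2 w e s + r w e s)"
definition "Y1 w e s = Q w e s * (1 + g w e s) - c e s"
definition "x1 w e s = X1 w e s - r w e s * Q w e s - e"
definition "y1 w e s = Y1 w e s - Q w e s + f"
definition "H w e s = X1 w e s * X0 w e s + Y1 w e s * Y0 w e s - (x0 w e - 1) * x1 w e s - y0 w e s * y1 w e s"

text \<open>The denominators other than the constant \<open>f\<close> are positive, and so is the
  discriminant. The condition is open, and where it holds all coordinates of the tent are
  continuous.\<close>

definition "regular w e s \<longleftrightarrow> 0 < den w e s \<and> 0 < D w e s + f \<and> 0 < k s \<and> 0 < \<beta> w e s \<and> 0 < disc w e s"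

definition "tuple w e s = sym_tuple (point (X0 w e s) (Y0 w e s) (A w e + s)) (point (X1 w e s) (Y1 w e s) s)
  (point 0 (y2 w e s) (- s)) (point (- k s) (y3 w e s) 0)"

definition "mark w e s = marking (Complex e f) (Complex (- x0 w e) (y0 w e s)) (Complex (- x1 w e s) (y1 w e s))
  (Complex 0 (y2 w e s)) (Complex (k s) (y3 w e s))"

lemma Q_equation:
  assumes "regular w e s"
  shows "\<alpha> w e s * (Q w e s)\<^sup>2 + \<beta> w e s * Q w e s = s\<^sup>2"
proof -
  define S where "S = sqrt (disc w e s)"
  define b where "b = \<beta> w e s + S"
  have "S > 0" "\<beta> w e s > 0" using assms by (auto simp: S_def regular_def)
  then have b: "b > 0" by (simp add: b_def)
  have S: "S\<^sup>2 = (\<beta> w e s)\<^sup>2 + 4 * \<alpha> w e s * s\<^sup>2" using assms by (simp add: S_def regular_def disc_def[symmetric])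
  have q: "b * Q w e s = 2 * s\<^sup>2" using b by (simp add: Q_def b_def S_def)
  have "b\<^sup>2 * (\<alpha> w e s * (Q w e s)\<^sup>2 + \<beta> w e s * Q w e s) = b\<^sup>2 * s\<^sup>2"
    using q S b_def by algebra
  then show ?thesis using b by simp
qed

lemma tuple_lengths:
  fixes a :: 8
  assumes "regular w e s" and "H w e s = 0"
  defines "L \<equiv> (2, 2 * Complex e f)"
  shows "norm (edge1 L (mark w e s) a) = dist (vec_nth (tuple w e s) a) (vec_nth (tuple w e s) (a + 1))"
    and "norm (edge3 L (mark w e s) a) = dist (vec_nth (tuple w e s) a) (vec_nth (tuple w e s) (a + 3))"
    and "norm (edge3 L (mark w e s) a - edge1 L (mark w e s) a) =
      dist (vec_nth (tuple w e s) (a + 1)) (vec_nth (tuple w e s) (a + 3))"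
proof -
  have f: "f \<noteq> 0" using f_pos by simp
  have nz: "den w e s \<noteq> 0" "D w e s + f \<noteq> 0" "k s \<noteq> 0" using assms(1) by (auto simp: regular_def)
  have rel: "D w e s * (f * (1 + (\<theta> w e)\<^sup>2) + 2 * y2 w e s) = 2 * x0 w e * w"
    using nz by (simp add: D_def den_def[symmetric])
  have r: "r w e s * k s * (D w e s + f) = k s * (X0 w e s - x0 w e) + y2 w e s * D w e s + A w e * s + s\<^sup>2 / 2 + e
    - (e\<^sup>2 + f\<^sup>2) / 2 + k s - e * k s"
    using nz by (simp add: r_def)
  have q: "(- 1 - (r w e s)\<^sup>2 - 2 * r w e s * y2 w e s - 2 * g w e s) * (Q w e s)\<^sup>2 + (2 * c e s - 2 * r w e s * (k s - s\<^sup>2)) * Q w e s = s\<^sup>2"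
    using Q_equation[OF assms(1)] by (simp add: \<alpha>_def \<beta>_def)
  have h: "X1 w e s * X0 w e s + Y1 w e s * Y0 w e s = (x0 w e - 1) * x1 w e s + y0 w e s * y1 w e s"
    using assms(2) by (simp add: H_def)
  have "2 * k s = 1 - s\<^sup>2" "2 * x0 w e = 1 - (A w e)\<^sup>2" "2 * f * y2 w e s = (T w e s)\<^sup>2 - e\<^sup>2 - f\<^sup>2"
    "f * \<theta> w e = w + e" "f * y0 w e s = y2 w e s * D w e s + e * x0 w e" "f * g w e s = e * y2 w e s"
    "2 * f * c e s = s\<^sup>2 + e\<^sup>2 + f\<^sup>2 - 2 * e * (k s - s\<^sup>2)"
    using f by (simp_all add: k_def x0_def y2_def \<theta>_def y0_def g_def c_def)
  note E = flat_lengths[OF f T_def this(1-4) rel this(5) Y0_def X0_def r y3_def this(6,7) q X1_def Y1_def x1_def y1_def]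
  have heights: "A w e + s - s = A w e" "s - - s = 2 * s" "- s - 0 = - s" "A w e + s - 0 = A w e + s" "s - 0 = s"
    "A w e + s - - s = T w e s" "(- s)\<^sup>2 = s\<^sup>2" by (simp_all add: T_def)
  show "norm (edge1 L (mark w e s) a) = dist (vec_nth (tuple w e s) a) (vec_nth (tuple w e s) (a + 1))"
    unfolding L_def mark_def tuple_def
    by (rule marking_lengths(1)) (simp_all only: heights E(1-9) E(10)[OF h] E(11)[OF h])
  show "norm (edge3 L (mark w e s) a) = dist (vec_nth (tuple w e s) a) (vec_nth (tuple w e s) (a + 3))"
    unfolding L_def mark_def tuple_def
    by (rule marking_lengths(2)) (simp_all only: heights E(1-9) E(10)[OF h] E(11)[OF h])
  show "norm (edge3 L (mark w e s) a - edge1 L (mark w e s) a) =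
      dist (vec_nth (tuple w e s) (a + 1)) (vec_nth (tuple w e s) (a + 3))"
    unfolding L_def mark_def tuple_def
    by (rule marking_lengths(3)) (simp_all only: heights E(1-9) E(10)[OF h] E(11)[OF h])
qed

section \<open>Continuity of the bent tents at regular parameters\<close>

context
  fixes F :: "'a filter" and w e s :: "'a \<Rightarrow> real" and w' e' s' :: real
  assumes w: "(w \<longlongrightarrow> w') F" and e: "(e \<longlongrightarrow> e') F" and s: "(s \<longlongrightarrow> s') F"
    and reg: "regular w' e' s'"
begin

private lemma nz: "f \<noteq> 0" "den w' e' s' \<noteq> 0" "D w' e' s' + f \<noteq> 0" "k s' \<noteq> 0" "\<beta> w' e' s' + sqrt (disc w' e' s') \<noteq> 0"
proof -
  have "0 < \<beta> w' e' s'" "0 < sqrt (disc w' e' s')" using reg by (simp_all add: regular_def)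
  then show "\<beta> w' e' s' + sqrt (disc w' e' s') \<noteq> 0" by linarith
qed (use reg f_pos in \<open>auto simp: regular_def\<close>)

lemma tendsto_A: "((\<lambda>n. A (w n) (e n)) \<longlongrightarrow> A w' e') F"
  unfolding A_def t_def by (intro tendsto_intros w e)
lemma tendsto_k: "((\<lambda>n. k (s n)) \<longlongrightarrow> k s') F"
  unfolding k_def by (intro tendsto_intros s) simp
lemma tendsto_x0: "((\<lambda>n. x0 (w n) (e n)) \<longlongrightarrow> x0 w' e') F"
  unfolding x0_def by (intro tendsto_intros tendsto_A) simp
lemma tendsto_y2: "((\<lambda>n. y2 (w n) (e n) (s n)) \<longlongrightarrow> y2 w' e' s') F"
  unfolding y2_def T_def by (intro tendsto_intros tendsto_A e s) (use nz in simp)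
lemma tendsto_\<theta>: "((\<lambda>n. \<theta> (w n) (e n)) \<longlongrightarrow> \<theta> w' e') F"
  unfolding \<theta>_def by (intro tendsto_intros w e nz)
lemma tendsto_den: "((\<lambda>n. den (w n) (e n) (s n)) \<longlongrightarrow> den w' e' s') F"
  unfolding den_def by (intro tendsto_intros tendsto_\<theta> tendsto_y2)
lemma tendsto_D: "((\<lambda>n. D (w n) (e n) (s n)) \<longlongrightarrow> D w' e' s') F"
  unfolding D_def by (intro tendsto_intros tendsto_x0 w tendsto_den nz)
lemma tendsto_y0: "((\<lambda>n. y0 (w n) (e n) (s n)) \<longlongrightarrow> y0 w' e' s') F"
  unfolding y0_def by (intro tendsto_intros tendsto_y2 tendsto_D tendsto_x0 e nz)
lemma tendsto_Y0: "((\<lambda>n. Y0 (w n) (e n) (s n)) \<longlongrightarrow> Y0 w' e' s') F"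
  unfolding Y0_def by (intro tendsto_intros tendsto_y0 tendsto_D)
lemma tendsto_X0: "((\<lambda>n. X0 (w n) (e n) (s n)) \<longlongrightarrow> X0 w' e' s') F"
  unfolding X0_def by (intro tendsto_intros tendsto_\<theta> tendsto_D tendsto_x0)
lemma tendsto_r: "((\<lambda>n. r (w n) (e n) (s n)) \<longlongrightarrow> r w' e' s') F"
  unfolding r_def by (intro tendsto_intros tendsto_k tendsto_X0 tendsto_x0 tendsto_y2 tendsto_D tendsto_A e s) (use nz in simp_all)
lemma tendsto_y3: "((\<lambda>n. y3 (w n) (e n) (s n)) \<longlongrightarrow> y3 w' e' s') F"
  unfolding y3_def by (intro tendsto_intros tendsto_k tendsto_r)
lemma tendsto_g: "((\<lambda>n. g (w n) (e n) (s n)) \<longlongrightarrow> g w' e' s') F"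
  unfolding g_def by (intro tendsto_intros tendsto_y2 e nz)
lemma tendsto_c: "((\<lambda>n. c (e n) (s n)) \<longlongrightarrow> c e' s') F"
  unfolding c_def by (intro tendsto_intros tendsto_k e s) (use nz in simp)
lemma tendsto_\<alpha>: "((\<lambda>n. \<alpha> (w n) (e n) (s n)) \<longlongrightarrow> \<alpha> w' e' s') F"
  unfolding \<alpha>_def by (intro tendsto_intros tendsto_r tendsto_y2 tendsto_g)
lemma tendsto_\<beta>: "((\<lambda>n. \<beta> (w n) (e n) (s n)) \<longlongrightarrow> \<beta> w' e' s') F"
  unfolding \<beta>_def by (intro tendsto_intros tendsto_r tendsto_c tendsto_k s)
lemma tendsto_disc: "((\<lambda>n. disc (w n) (e n) (s n)) \<longlongrightarrow> disc w' e' s') F"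
  unfolding disc_def by (intro tendsto_intros tendsto_\<alpha> tendsto_\<beta> s)
lemma tendsto_Q: "((\<lambda>n. Q (w n) (e n) (s n)) \<longlongrightarrow> Q w' e' s') F"
  unfolding Q_def by (intro tendsto_intros tendsto_\<beta> tendsto_disc s nz)
lemma tendsto_X1: "((\<lambda>n. X1 (w n) (e n) (s n)) \<longlongrightarrow> X1 w' e' s') F"
  unfolding X1_def by (intro tendsto_intros tendsto_k tendsto_Q tendsto_y2 tendsto_r s)
lemma tendsto_Y1: "((\<lambda>n. Y1 (w n) (e n) (s n)) \<longlongrightarrow> Y1 w' e' s') F"
  unfolding Y1_def by (intro tendsto_intros tendsto_Q tendsto_g tendsto_c)
lemma tendsto_x1: "((\<lambda>n. x1 (w n) (e n) (s n)) \<longlongrightarrow> x1 w' e' s') F"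
  unfolding x1_def by (intro tendsto_intros tendsto_X1 tendsto_r tendsto_Q e)
lemma tendsto_y1: "((\<lambda>n. y1 (w n) (e n) (s n)) \<longlongrightarrow> y1 w' e' s') F"
  unfolding y1_def by (intro tendsto_intros tendsto_Y1 tendsto_Q)
lemma tendsto_H: "((\<lambda>n. H (w n) (e n) (s n)) \<longlongrightarrow> H w' e' s') F"
  unfolding H_def by (intro tendsto_intros tendsto_X1 tendsto_X0 tendsto_Y1 tendsto_Y0 tendsto_x0 tendsto_x1 tendsto_y0 tendsto_y1)

lemma eventually_regular: "\<forall>\<^sub>F n in F. regular (w n) (e n) (s n)"
proof -
  have "\<forall>\<^sub>F n in F. 0 < den (w n) (e n) (s n)" "\<forall>\<^sub>F n in F. 0 < D (w n) (e n) (s n) + f" "\<forall>\<^sub>F n in F. 0 < k (s n)"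
    "\<forall>\<^sub>F n in F. 0 < \<beta> (w n) (e n) (s n)" "\<forall>\<^sub>F n in F. 0 < disc (w n) (e n) (s n)"
    using reg by (auto simp: regular_def intro: order_tendstoD(1)[OF tendsto_den] order_tendstoD(1)[OF tendsto_k]
      order_tendstoD(1)[OF tendsto_\<beta>] order_tendstoD(1)[OF tendsto_disc] order_tendstoD(1)[OF tendsto_add[OF tendsto_D tendsto_const]])
  then show ?thesis unfolding regular_def by eventually_elim auto
qed

lemma tendsto_tuple: "((\<lambda>n. tuple (w n) (e n) (s n)) \<longlongrightarrow> tuple w' e' s') F"
  unfolding tuple_def
  by (intro tendsto_intros tendsto_X0 tendsto_Y0 tendsto_A tendsto_X1 tendsto_Y1 tendsto_y2 tendsto_y3 tendsto_k s)

lemma tendsto_mark: "((\<lambda>n. mark (w n) (e n) (s n) a) \<longlongrightarrow> mark w' e' s' a) F"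
  unfolding mark_def
  by (intro tendsto_marking tendsto_Complex tendsto_minus tendsto_const e
    tendsto_x0 tendsto_y0 tendsto_x1 tendsto_y1 tendsto_y2 tendsto_y3 tendsto_k)

end

end

section \<open>The special configurations and their deformations\<close>

text \<open>The formulas are those of the bent family at \<open>w = s = 0\<close>. They extend to
  boundary points of the domain at which \<open>regular\<close> fails.\<close>

definition special_tuple :: "complex \<Rightarrow> real^3^8" where
  "special_tuple \<tau> = special (Re \<tau> / Im \<tau>) (((Re \<tau>)\<^sup>2 + (Im \<tau>)\<^sup>2 - 2 * Re \<tau>) / (2 * Im \<tau>)) (1/2 - Re \<tau>)
     (sqrt (2 * Re \<tau>)) 0 0 0"

definition special_marking :: "complex \<Rightarrow> 8 \<Rightarrow> complex" where
  "special_marking \<tau> = marking \<tau>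
     (Complex (Re \<tau> - 1/2) (Re \<tau> * (1/2 - Re \<tau>) / Im \<tau>))
     (Complex (Re \<tau> - 1/2) (Im \<tau> - ((Re \<tau>)\<^sup>2 + (Im \<tau>)\<^sup>2 - Re \<tau>) / (2 * Im \<tau>)))
     (Complex 0 ((2 * Re \<tau> - (Re \<tau>)\<^sup>2 - (Im \<tau>)\<^sup>2) / (2 * Im \<tau>)))
     (Complex (1/2) ((3 * Re \<tau> - (Re \<tau>)\<^sup>2 - (Im \<tau>)\<^sup>2) / (2 * Im \<tau>)))"

text \<open>For this slope all inequalities follow from \<open>0 < e < 1/2\<close> and the last
  premise. They become false on the arc of the domain, where \<open>edge3\<close> vanishes at the
  labels 1, 2 and 3. Being strict, they persist for nearby bent tents.\<close>

lemma special_cone: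
  fixes e f :: real
  assumes e: "0 < e" "e < 1/2" and f: "f > 0" and n: "2 * e < e\<^sup>2 + f\<^sup>2"
  defines "\<kappa> \<equiv> (e\<^sup>2 + f\<^sup>2) / f"
  defines "e1 \<equiv> edge1 (2, 2 * Complex e f) (special_marking (Complex e f))"
    and "e3 \<equiv> edge3 (2, 2 * Complex e f) (special_marking (Complex e f))"
  shows "\<bar>Im (e1 a)\<bar> < - (\<kappa> * Re (e1 a))" "\<kappa> * \<bar>Re (e3 a)\<bar> < Im (e3 a)"
proof -
  define m where "m = e\<^sup>2 + f\<^sup>2"
  have ff: "f\<^sup>2 = m - e\<^sup>2" by (simp add: m_def)
  have m: "m > 0" "2 * e < m" using e n unfolding m_def by simp_all
  have em: "e * e < e / 2" using mult_strict_left_mono[OF e(2,1)] by simp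
  have *: "\<bar>a / f\<bar> < - (\<kappa> * b)" if "\<bar>a\<bar> < - (m * b)" for a b
    using that f unfolding \<kappa>_def m_def[symmetric] by (simp add: abs_div divide_less_eq)
  have **: "\<kappa> * \<bar>b\<bar> < a / f" if "m * \<bar>b\<bar> < a" for a b
    using that f unfolding \<kappa>_def m_def[symmetric] by (simp add: divide_strict_right_mono)
  have i: "Im (e1 0) = (m / 2) / f" "Im (e1 1) = (e / 2) / f" "Im (e1 2) = (e / 2) / f" "Im (e1 3) = (m - 3 * e) / f"
    "Im (e1 4) = (e / 2) / f" "Im (e1 5) = (e / 2) / f" "Im (e1 6) = (m / 2) / f" "Im (e1 7) = (e * (1 - 2 * e)) / f"
    using f unfolding e1_def special_marking_def marking_edge1
    by (simp_all add: field_simps power2_eq_square m_def)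
  have r: "Re (e1 0) = -1" "Re (e1 1) = -1/2" "Re (e1 2) = -1/2" "Re (e1 3) = -1"
    "Re (e1 4) = -1/2" "Re (e1 5) = -1/2" "Re (e1 6) = -1" "Re (e1 7) = 2 * e - 1"
    unfolding e1_def special_marking_def by (simp_all add: marking_edge1)
  have "e * (1 - 2 * e) < m * (1 - 2 * e)" using e m by (intro mult_strict_right_mono) auto
  then have "\<forall>a. \<bar>Im (e1 a)\<bar> < - (\<kappa> * Re (e1 a))"
    unfolding all_8 i r using e m by (intro conjI *) (auto simp: abs_less_iff algebra_simps)
  then show "\<bar>Im (e1 a)\<bar> < - (\<kappa> * Re (e1 a))" by blast
  have i: "Im (e3 0) = (e + m / 2) / f" "Im (e3 1) = (m - 2 * e) / f" "Im (e3 2) = (m - 2 * e) / f" "Im (e3 3) = (m - 2 * e) / f"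
    "Im (e3 4) = (e + m / 2) / f" "Im (e3 5) = (m / 2 + 3 / 2 * e - 2 * e\<^sup>2) / f" "Im (e3 6) = (m + e - 2 * e\<^sup>2) / f"
    "Im (e3 7) = (m / 2 + 3 / 2 * e - 2 * e\<^sup>2) / f"
    using f unfolding e3_def special_marking_def marking_edge3
    by (simp_all add: field_simps power2_eq_square m_def)
  have r: "Re (e3 0) = 0" "Re (e3 1) = 0" "Re (e3 2) = 0" "Re (e3 3) = 0"
    "Re (e3 4) = 0" "Re (e3 5) = 2 * e - 1/2" "Re (e3 6) = 2 * e - 1" "Re (e3 7) = 2 * e - 1/2"
    unfolding e3_def special_marking_def by (simp_all add: marking_edge3)
  have "\<bar>2 * e - 1/2\<bar> < 1/2" unfolding abs_less_iff using e by (intro conjI; linarith)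
  then have "m * \<bar>2 * e - 1/2\<bar> < m * (1/2)" using m by (intro mult_strict_left_mono)
  then have c5: "m * \<bar>2 * e - 1/2\<bar> < m / 2 + 3 / 2 * e - 2 * e\<^sup>2"
    using em e(1) unfolding power2_eq_square by linarith
  have "0 < e * m" using e m by simp
  moreover have "m * \<bar>2 * e - 1\<bar> = m - 2 * (e * m)" using e by (simp add: abs_if algebra_simps)
  ultimately have c6: "m * \<bar>2 * e - 1\<bar> < m + e - 2 * e\<^sup>2" using em unfolding power2_eq_square by linarith
  have "\<forall>a. \<kappa> * \<bar>Re (e3 a)\<bar> < Im (e3 a)"
    unfolding all_8 i r using e m by (intro conjI ** c5 c6) auto
  then show "\<kappa> * \<bar>Re (e3 a)\<bar> < Im (e3 a)" by blast
qed

context bend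
begin

lemma A_squared: "0 \<le> 2 * e - t w \<Longrightarrow> (A w e)\<^sup>2 = 2 * e - t w"
  by (simp add: A_def)

lemma level_zero:
  assumes "0 \<le> 2 * e - t w"
  shows "x0 w e = (1 - 2 * e + t w) / 2" "y2 w e 0 = (2 * e - t w - e\<^sup>2 - f\<^sup>2) / (2 * f)"
    "k 0 = 1 / 2" "c e 0 = (e\<^sup>2 + f\<^sup>2 - e) / (2 * f)" "Q w e 0 = 0" "X1 w e 0 = 1 / 2" "Y1 w e 0 = - c e 0"
    "x1 w e 0 = 1 / 2 - e" "y1 w e 0 = f - c e 0" "y3 w e 0 = r w e 0 / 2"
    "den w e 0 = (w\<^sup>2 + 2 * w * e + 2 * e - t w) / f"
proof -
  show z: "x0 w e = (1 - 2 * e + t w) / 2" "y2 w e 0 = (2 * e - t w - e\<^sup>2 - f\<^sup>2) / (2 * f)"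
    "k 0 = 1 / 2" "c e 0 = (e\<^sup>2 + f\<^sup>2 - e) / (2 * f)" "Q w e 0 = 0" "X1 w e 0 = 1 / 2" "Y1 w e 0 = - c e 0"
    "x1 w e 0 = 1 / 2 - e" "y1 w e 0 = f - c e 0" "y3 w e 0 = r w e 0 / 2"
    using A_squared[OF assms] by (simp_all add: x0_def y2_def T_def k_def c_def Q_def X1_def Y1_def x1_def y1_def y3_def)
  show "den w e 0 = (w\<^sup>2 + 2 * w * e + 2 * e - t w) / f"
    unfolding den_def \<theta>_def z(2) using f_pos by (simp add: field_simps power2_eq_square)
qed

lemma special_values:
  assumes e: "0 < e" "2 * e < e\<^sup>2 + f\<^sup>2"
  shows "regular 0 e 0" "tuple 0 e 0 = special_tuple (Complex e f)" "mark 0 e 0 = special_marking (Complex e f)"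
proof -
  have t: "t 0 = 0" by (simp add: t_def)
  have A: "A 0 e = sqrt (2 * e)" by (simp add: A_def t)
  have z: "x0 0 e = 1 / 2 - e" "y2 0 e 0 = (2 * e - e\<^sup>2 - f\<^sup>2) / (2 * f)"
    "k 0 = 1 / 2" "c e 0 = (e\<^sup>2 + f\<^sup>2 - e) / (2 * f)" "Q 0 e 0 = 0" "X1 0 e 0 = 1 / 2" "Y1 0 e 0 = - c e 0"
    "x1 0 e 0 = 1 / 2 - e" "y1 0 e 0 = f - c e 0" "y3 0 e 0 = r 0 e 0 / 2" "den 0 e 0 = 2 * e / f"
    using level_zero[of e 0] e by (simp_all add: t diff_divide_distrib)
  have D: "D 0 e 0 = 0" by (simp add: D_def)
  have y: "y0 0 e 0 = e * (1 / 2 - e) / f" "Y0 0 e 0 = e * (1 / 2 - e) / f" "X0 0 e 0 = e - 1 / 2"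
    unfolding Y0_def X0_def y0_def D z by simp_all
  have r: "r 0 e 0 = (3 * e - e\<^sup>2 - f\<^sup>2) / f"
    using f_pos unfolding r_def D z y by (simp add: field_simps power2_eq_square)
  have \<beta>: "\<beta> 0 e 0 = 2 * (e\<^sup>2 + f\<^sup>2 - 2 * e) / f"
    using f_pos unfolding \<beta>_def r z by (simp add: field_simps power2_eq_square)
  have "\<beta> 0 e 0 > 0" using e f_pos by (simp add: \<beta>)
  then show "regular 0 e 0" using e f_pos by (simp add: regular_def z D disc_def)
  have a: "- ((e\<^sup>2 + f\<^sup>2 - e) / (2 * f)) = - ((e\<^sup>2 + f\<^sup>2 - 2 * e) / (2 * f)) - e / f / 2"
    "(2 * e - e\<^sup>2 - f\<^sup>2) / (2 * f) = - ((e\<^sup>2 + f\<^sup>2 - 2 * e) / (2 * f))"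
    "(3 * e - e\<^sup>2 - f\<^sup>2) / (f * 2) = e / (f * 2) - (e\<^sup>2 + f\<^sup>2 - 2 * e) / (2 * f)"
    using f_pos by (simp_all add: field_simps)
  show "tuple 0 e 0 = special_tuple (Complex e f)"
    unfolding tuple_def special_tuple_def special_def z y A r by (simp add: a)
  show "mark 0 e 0 = special_marking (Complex e f)"
    unfolding mark_def special_marking_def z y r by (simp add: mult.commute)
qed

lemma H_zero:
  assumes "0 \<le> 2 * e - t w" "den w e 0 \<noteq> 0"
  shows "2 * H w e 0 = D w e 0 * (w + t w) / f - t w"
proof -
  note z = level_zero[OF assms(1)]
  have f: "f \<noteq> 0" using f_pos by simp
  have fy0: "f * y0 w e 0 = y2 w e 0 * D w e 0 + e * x0 w e" using f by (simp add: y0_def)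
  have a: "2 * f * y2 w e 0 = 2 * e - t w - e\<^sup>2 - f\<^sup>2" "2 * f * c e 0 = e\<^sup>2 + f\<^sup>2 - e" "f * \<theta> w e = w + e" "2 * x0 w e = 1 - 2 * e + t w"
    using f by (simp_all add: z \<theta>_def)
  have b: "2 * H w e 0 = X0 w e 0 - 2 * c e 0 * Y0 w e 0 - (x0 w e - 1) * (1 - 2 * e) - 2 * y0 w e 0 * (f - c e 0)"
    by (simp add: H_def z(6-9) algebra_simps)
  have "f * (2 * H w e 0) = f * (D w e 0 * (w + t w) / f - t w)"
    unfolding b using fy0 a f Y0_def[of w e 0] X0_def[of w e 0]
    by (simp add: right_diff_distrib) algebra
  then show ?thesis using f by simp
qed

text \<open>For \<open>s = 0\<close> the equation \<open>H w e s = 0\<close> is linear in \<open>e\<close>, with the following solution.\<close>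

definition "balance w = (l\<^sup>2 * w\<^sup>2 * (1 + w) + l * w + 1) / (2 * (1 + 2 * l * w + l))"

lemma H_zero_balance:
  assumes "0 \<le> 2 * e - t w" "0 < den w e 0" "0 < 1 + 2 * l * w + l"
  shows "den w e 0 * f * H w e 0 = w\<^sup>2 * (1 + 2 * l * w + l) * (balance w - e)"
proof -
  have f: "f \<noteq> 0" using f_pos by simp
  have a: "f * den w e 0 = w\<^sup>2 + 2 * w * e + 2 * e - t w" using f by (simp add: level_zero[OF assms(1)])
  have D: "D w e 0 * den w e 0 = 2 * x0 w e * w" using assms(2) by (simp add: D_def)
  have x: "2 * x0 w e = 1 - 2 * e + t w" by (simp add: level_zero[OF assms(1)])
  have h: "2 * f * H w e 0 = D w e 0 * (w + t w) - f * t w"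
    using H_zero[OF assms(1)] assms(2) f by (simp add: field_simps)
  have s: "2 * (1 + 2 * l * w + l) * balance w = l\<^sup>2 * w\<^sup>2 * (1 + w) + l * w + 1"
    unfolding balance_def times_divide_eq_right by (rule nonzero_mult_div_cancel_left) (use assms(3) in \<open>metis less_irrefl mult_eq_0_iff zero_neq_numeral\<close>)
  have "2 * (den w e 0 * f * H w e 0) = 2 * (w\<^sup>2 * (1 + 2 * l * w + l) * (balance w - e))"
    using a D x h s t_def[of w] by algebra
  then show ?thesis by simp
qed

text \<open>The quantity whose positivity decides the walls, divided by the displacement \<^term>\<open>D w e 0\<close>.\<close>

definition "bulge w e = 1 + y2 w e 0 / f + \<theta> w e * (e - t w) / f
  + (w + t w) / f * (x0 w e / f + 2 * X0 w e 0 / (D w e 0 + f))"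

text \<open>The closing equation expresses \<open>f * t w\<close> through \<open>D w e 0\<close>. As
  a result the bulge of vertex 2 is a negative multiple of \<open>t w\<close>, and the turn of the
  ridge is governed by \<open>D w e 0 * bulge w e\<close>.\<close>

lemma wall_signs_balanced:
  assumes "0 < 2 * e - t w" "regular w e 0" "H w e 0 = 0" "w > 0" "t w > 0" "x0 w e > 0" "X0 w e 0 < 0" "bulge w e > 0"
  shows "signs_agree wall_quads (tuple w e 0)"
proof -
  have f: "f \<noteq> 0" using f_pos by simp
  have e: "0 \<le> 2 * e - t w" using assms(1) by simp
  note z = level_zero[OF e]
  have den: "den w e 0 > 0" and Df: "D w e 0 + f > 0" using assms(2) by (simp_all add: regular_def)
  have D: "D w e 0 > 0" using den assms(4,6) by (simp add: D_def)
  have tD: "f * t w = D w e 0 * (w + t w)"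
    using H_zero[OF e] den assms(3) f by (simp add: field_simps)
  define u where "u = 2 * y2 w e 0 - Y1 w e 0 - y3 w e 0"
  have a: "2 * f * y2 w e 0 = 2 * e - t w - e\<^sup>2 - f\<^sup>2" "2 * f * c e 0 = e\<^sup>2 + f\<^sup>2 - e" "f * \<theta> w e = w + e" "2 * x0 w e = 1 - 2 * e + t w"
    using f by (simp_all add: z \<theta>_def)
  have u': "2 * u = 4 * y2 w e 0 + 2 * c e 0 - r w e 0" by (simp add: u_def z(7,10))
  have "2 * (r w e 0 * (D w e 0 + f)) = 2 * (X0 w e 0 - x0 w e) + 4 * (y2 w e 0 * D w e 0) + 2 * e - 2 * (e\<^sup>2 + f\<^sup>2) + 2"
    using Df by (simp add: r_def z(3) field_simps)
  then have "f * (u * (D w e 0 + f)) = f * (- t w)"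
    using u' a tD X0_def[of w e 0] by algebra
  then have u: "u * (D w e 0 + f) = - t w" using f mult_left_cancel by blast
  have "u < 0" using u assms(5) Df by (smt (verit, best) mult_nonneg_nonneg)
  have fy0: "f * y0 w e 0 = y2 w e 0 * D w e 0 + e * x0 w e" using f by (simp add: y0_def)
  have X0: "X0 w e 0 = - x0 w e + \<theta> w e * D w e 0" and Y0: "Y0 w e 0 = y0 w e 0 + D w e 0"
    by (simp_all add: X0_def Y0_def)
  \<comment> \<open>The left side is the difference of the two sides of the second
    \<open>rear\<close> condition of \<open>wall_signs\<close>. The first condition then follows,
    because \<open>u * X0 w e 0\<close> is positive.\<close>
  have W: "Y0 w e 0 - 2 * (y2 w e 0 - y3 w e 0) * X0 w e 0 = D w e 0 * bulge w e"
  proof -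
    define q where "q = 2 * X0 w e 0 / (D w e 0 + f)"
    have q: "q * (D w e 0 + f) = 2 * X0 w e 0" using Df by (simp add: q_def)
    have uX: "2 * u * X0 w e 0 = - (t w * q)" using q u by algebra
    have "f * f * (D w e 0 * bulge w e) = D w e 0 * (f * f + f * y2 w e 0 + f * \<theta> w e * (e - t w) + (w + t w) * (x0 w e + f * q))"
    proof -
      have b: "bulge w e = 1 + y2 w e 0 / f + \<theta> w e * (e - t w) / f + (w + t w) / f * (x0 w e / f + q)"
        by (simp add: bulge_def q_def)
      show ?thesis unfolding b using f by (simp add: field_simps)
    qed
    moreover have "2 * (y2 w e 0 - y3 w e 0) = 2 * (Y1 w e 0 - y2 w e 0) + 2 * u" by (simp add: u_def)
    moreover have "f * (2 * (Y1 w e 0 - y2 w e 0)) = t w - e" unfolding z(7) using a(1,2) by (simp add: algebra_simps)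
    ultimately have "f * f * (Y0 w e 0 - 2 * (y2 w e 0 - y3 w e 0) * X0 w e 0) = f * f * (D w e 0 * bulge w e)"
      using uX fy0 X0 Y0 tD by algebra
    then show ?thesis using f by simp
  qed
  have "0 < D w e 0 * bulge w e" using D assms(8) by simp
  then have W0: "u * X0 w e 0 < Y0 w e 0 - (Y1 w e 0 - y3 w e 0) * X0 w e 0"
    unfolding W[symmetric] u_def by (simp add: algebra_simps)
  moreover have "0 < u * X0 w e 0" using \<open>u < 0\<close> assms(7) by (simp add: mult_neg_neg)
  ultimately have W1: "0 < Y0 w e 0 - (Y1 w e 0 - y3 w e 0) * X0 w e 0" by linarith
  have "A w e > 0" using assms(1) by (simp add: A_def)
  then show ?thesis
    unfolding tuple_def using wall_signs[OF _ \<open>u < 0\<close>[unfolded u_def] assms(7) W1 W0[unfolded u_def]] by (simp add: z(3,6))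
qed

end

section \<open>Pup tents near the special configurations\<close>

lemma (in pup_tuple) pup_tent:
  assumes "tiled L \<zeta> p f"
  shows "pup_tent p"
  unfolding pup_tent_def
  using inj_on_realization tiled.cone_angle_eq[OF assms] \<rho>_image_torus sym hull_triangles by blast

context bend
begin

lemma eventually_balanced:
  assumes l: "l > 0" and e: "e = 1 / (2 * (1 + l))" "2 * e < e\<^sup>2 + f\<^sup>2"
  shows "(balance \<longlongrightarrow> e) (at_right 0)"
    and "\<forall>\<^sub>F w in at_right 0. regular w (balance w) 0 \<and> 0 < 2 * balance w - t w \<and> H w (balance w) 0 = 0 \<and>
      signs_agree wall_quads (tuple w (balance w) 0)"
proof -
  have e0: "0 < e" "e < 1 / 2" unfolding e(1) using l by (simp_all add: field_simps)
  have w: "((\<lambda>w. w) \<longlongrightarrow> 0) (at_right (0::real))" by (rule tendsto_ident_at)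
  have "(balance \<longlongrightarrow> (l\<^sup>2 * 0\<^sup>2 * (1 + 0) + l * 0 + 1) / (2 * (1 + 2 * l * 0 + l))) (at_right 0)"
    unfolding balance_def by (intro tendsto_intros) (use l in simp)
  then show b: "(balance \<longlongrightarrow> e) (at_right 0)" using e(1) by simp
  note reg = special_values(1)[OF e0(1) e(2)]
  note lim = w b tendsto_const[of 0] reg
  have t: "((\<lambda>w. t w) \<longlongrightarrow> 0) (at_right 0)"
    unfolding t_def by (rule tendsto_eq_intros w refl)+ simp
  have z: "0 \<le> 2 * e - t 0" using e0 by (simp add: t_def)
  note z = level_zero[OF z]
  have D: "D 0 e 0 = 0" by (simp add: D_def)
  have x: "x0 0 e > 0" "X0 0 e 0 < 0" using e0 by (simp_all add: z(1) X0_def D t_def)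
  have "bulge 0 e = (e\<^sup>2 + f\<^sup>2 + 2 * e) / (2 * f\<^sup>2)"
    using f_pos unfolding bulge_def z D \<theta>_def by (simp add: t_def field_simps power2_eq_square)
  then have "bulge 0 e > 0" using e0 f_pos by (simp add: add_nonneg_pos)
  moreover have "((\<lambda>w. bulge w (balance w)) \<longlongrightarrow> bulge 0 e) (at_right 0)"
  proof -
    have t': "((\<lambda>w. t w) \<longlongrightarrow> t 0) (at_right 0)" using t by (simp add: t_def)
    show ?thesis unfolding bulge_def
      by (intro tendsto_intros tendsto_y2[OF lim] tendsto_\<theta>[OF lim] tendsto_x0[OF lim] tendsto_X0[OF lim] tendsto_D[OF lim] w b t')
        (use f_pos D in auto)
  qed
  ultimately have "\<forall>\<^sub>F w in at_right 0. bulge w (balance w) > 0" by (rule order_tendstoD(1)[rotated])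
  moreover have "\<forall>\<^sub>F w in at_right 0. regular w (balance w) 0" by (rule eventually_regular[OF lim])
  moreover have "\<forall>\<^sub>F w in at_right 0. x0 w (balance w) > 0" by (rule order_tendstoD(1)[OF tendsto_x0[OF lim] x(1)])
  moreover have "\<forall>\<^sub>F w in at_right 0. X0 w (balance w) 0 < 0" by (rule order_tendstoD(2)[OF tendsto_X0[OF lim] x(2)])
  moreover have "\<forall>\<^sub>F w in at_right 0. 0 < 2 * balance w - t w"
    by (rule order_tendstoD(1)[of _ "2 * e - 0"]) (intro tendsto_intros b t, use e0 in simp)
  moreover have "\<forall>\<^sub>F w::real in at_right 0. w > 0" by (simp add: eventually_at_right_less)
  ultimately show "\<forall>\<^sub>F w in at_right 0. regular w (balance w) 0 \<and> 0 < 2 * balance w - t w \<and> H w (balance w) 0 = 0 \<and>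
      signs_agree wall_quads (tuple w (balance w) 0)"
  proof eventually_elim
    case (elim w)
    have "den w (balance w) 0 > 0" using elim(2) by (simp add: regular_def)
    moreover have "0 < 1 + 2 * l * w + l" using l elim(6) by (simp add: add_pos_pos)
    ultimately have "H w (balance w) 0 = 0"
      using H_zero_balance[of "balance w" w] elim(5) f_pos by simp
    moreover have "t w > 0" using l elim(6) by (simp add: t_def)
    ultimately show ?case using wall_signs_balanced[of "balance w" w] elim by blast
  qed
qed

text \<open>At \<open>s = 0\<close> the function \<open>H\<close> changes sign from positive to
  negative at \<open>balance w\<close>. For small \<open>s > 0\<close> the signs at both ends of a
  short interval persist, and the intermediate value theorem in \<open>e\<close> gives a root. The
  other conditions are open.\<close>

lemma solve_closing:
  assumes l: "l > 0" and w: "w > 0" and \<eta>: "\<eta> > 0"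
    and ok: "regular w (balance w) 0" "0 < 2 * balance w - t w" "signs_agree wall_quads (tuple w (balance w) 0)"
  obtains e s where "\<bar>e - balance w\<bar> < \<eta>" "0 < s" "s < \<eta>" "regular w e s" "H w e s = 0"
    "signs_agree wall_quads (tuple w e s)"
proof -
  define N :: "(real \<times> real) filter" where "N = nhds (balance w, 0)"
  have N: "(fst \<longlongrightarrow> balance w) N" "(snd \<longlongrightarrow> 0) N"
    unfolding N_def by (auto intro!: tendsto_eq_intros filterlim_ident simp: filterlim_ident)
  have "\<forall>\<^sub>F q in N. regular w (fst q) (snd q)"
    by (rule eventually_regular[OF tendsto_const N ok(1)])
  moreover have "\<forall>\<^sub>F q in N. signs_agree wall_quads (tuple w (fst q) (snd q))"
    by (rule signs_agree_stable[OF ok(3) tendsto_tuple[OF tendsto_const N ok(1)] quads_nonzero(3)])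
  moreover have "\<forall>\<^sub>F q in N. 0 < 2 * fst q - t w"
    by (rule order_tendstoD(1)[OF _ ok(2)]) (intro tendsto_intros N)
  ultimately have "\<forall>\<^sub>F q in N. regular w (fst q) (snd q) \<and> signs_agree wall_quads (tuple w (fst q) (snd q)) \<and> 0 < 2 * fst q - t w"
    by eventually_elim blast
  then obtain \<delta> where \<delta>: "\<delta> > 0" and near: "\<And>q. dist q (balance w, 0) < \<delta> \<Longrightarrow>
      regular w (fst q) (snd q) \<and> signs_agree wall_quads (tuple w (fst q) (snd q)) \<and> 0 < 2 * fst q - t w"
    unfolding N_def eventually_nhds_metric by blast
  define d where "d = min \<delta> \<eta> / 4"
  have d: "0 < d" "d < \<eta>" "2 * d < \<delta>" using \<delta> \<eta> by (auto simp: d_def min_def)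
  have near': "regular w e s" "signs_agree wall_quads (tuple w e s)" "0 < 2 * e - t w"
    if "\<bar>e - balance w\<bar> \<le> d" "\<bar>s\<bar> \<le> d" for e s
  proof -
    have "dist (e, s) (balance w, 0) \<le> \<bar>e - balance w\<bar> + \<bar>s\<bar>"
      using sqrt_sum_squares_le_sum_abs[of "e - balance w" s] by (simp add: dist_Pair_Pair dist_real_def)
    then show "regular w e s" "signs_agree wall_quads (tuple w e s)" "0 < 2 * e - t w"
      using near[of "(e, s)"] that d by auto
  qed
  have M: "0 < w\<^sup>2 * (1 + 2 * l * w + l)" using l w by (simp add: add_pos_pos)
  have H: "den w e 0 * f * H w e 0 = w\<^sup>2 * (1 + 2 * l * w + l) * (balance w - e)" "den w e 0 * f > 0"
    if "\<bar>e - balance w\<bar> \<le> d" for e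
  proof -
    have "0 < 2 * e - t w" "0 < den w e 0" using near'[OF that, of 0] d by (auto simp: regular_def)
    then show "den w e 0 * f * H w e 0 = w\<^sup>2 * (1 + 2 * l * w + l) * (balance w - e)" "den w e 0 * f > 0"
      using H_zero_balance[of e w] l w f_pos by (auto simp: add_pos_pos)
  qed
  have "0 < den w (balance w - d) 0 * f * H w (balance w - d) 0"
    unfolding H(1)[of "balance w - d", simplified, OF less_imp_le[OF d(1)], unfolded abs_of_pos[OF d(1)]] using M d(1) by simp
  then have Hl: "0 < H w (balance w - d) 0" by (rule zero_less_mult_pos) (use H(2)[of "balance w - d"] d(1) in simp)
  have "den w (balance w + d) 0 * f * H w (balance w + d) 0 < 0"
    unfolding H(1)[of "balance w + d", simplified, OF less_imp_le[OF d(1)], unfolded abs_of_pos[OF d(1)]] using M d(1) by (simp add: mult_pos_neg)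
  then have Hr: "H w (balance w + d) 0 < 0"
    using H(2)[of "balance w + d"] d(1) mult_less_cancel_left_pos[of "den w (balance w + d) 0 * f" "H w (balance w + d) 0" 0] by simp
  have lim: "((\<lambda>s. H w e s) \<longlongrightarrow> H w e 0) (at_right 0)" if "\<bar>e - balance w\<bar> \<le> d" for e
    by (rule tendsto_H[OF tendsto_const tendsto_const tendsto_ident_at near'(1)[OF that]]) (use d in simp)
  have "\<forall>\<^sub>F s in at_right 0. 0 < H w (balance w - d) s"
    by (rule order_tendstoD(1)[OF lim Hl]) (use d in simp)
  moreover have "\<forall>\<^sub>F s in at_right 0. H w (balance w + d) s < 0"
    by (rule order_tendstoD(2)[OF lim Hr]) (use d in simp)
  moreover have "\<forall>\<^sub>F s in at_right 0. s < d" by (rule order_tendstoD(2)[OF tendsto_ident_at d(1)])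
  moreover have "\<forall>\<^sub>F s in at_right (0::real). 0 < s" by (simp add: eventually_at_right_less)
  ultimately have "\<forall>\<^sub>F s in at_right 0. 0 < H w (balance w - d) s \<and> H w (balance w + d) s < 0 \<and> s < d \<and> 0 < s"
    by eventually_elim blast
  then obtain s where s: "0 < H w (balance w - d) s" "H w (balance w + d) s < 0" "s < d" "0 < s"
    using eventually_happens[of _ "at_right (0::real)"] by (auto simp: trivial_limit_at_right_real)
  have "\<exists>e\<ge>balance w - d. e \<le> balance w + d \<and> H w e s = 0"
  proof (rule IVT2)
    show "\<forall>e. balance w - d \<le> e \<and> e \<le> balance w + d \<longrightarrow> isCont (\<lambda>e. H w e s) e"
      unfolding isCont_def
      by (intro allI impI tendsto_H tendsto_const tendsto_ident_at near'(1)) (use s in auto)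
  qed (use s d in auto)
  then obtain e where e: "\<bar>e - balance w\<bar> \<le> d" "H w e s = 0" by (auto simp: abs_le_iff) (smt (verit))
  show ?thesis
    by (rule that[of e s]) (use e s d near'[OF e(1), of s] in auto)
qed

end

text \<open>The approximating tori vary as well, since the closing equation is solved for the real
  part of their parameter.\<close>

definition good_limit :: "complex \<Rightarrow> bool" where
  "good_limit \<tau> \<longleftrightarrow> (\<exists>\<tau>s \<zeta>s ps fs. (\<forall>n::nat. tiled (2, 2 * \<tau>s n) (\<zeta>s n) (ps n) (fs n) \<and> pup_tent (ps n)) \<and>
     \<tau>s \<longlonglongrightarrow> \<tau> \<and> (\<forall>a. (\<lambda>n. \<zeta>s n a) \<longlonglongrightarrow> special_marking \<tau> a) \<and> ps \<longlonglongrightarrow> special_tuple \<tau>)"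

lemma good_limit_interior:
  fixes e f :: real
  assumes e: "0 < e" "e < 1/2" and f: "f > 0" and n: "2 * e < e\<^sup>2 + f\<^sup>2"
  shows "good_limit (Complex e f)"
proof -
  \<comment> \<open>Solves \<open>e = 1 / (2 * (1 + l))\<close>, whose right side is the value of
    \<open>balance\<close> at 0.\<close>
  define l where "l = (1 - 2 * e) / (2 * e)"
  have l: "l > 0" "e = 1 / (2 * (1 + l))" using e by (simp_all add: l_def field_simps)
  interpret bend f l by unfold_locales (rule f)
  note bal = eventually_balanced[OF l n]
  have "\<exists>w e' s. 0 < w \<and> w < \<eta> \<and> \<bar>e' - e\<bar> < \<eta> \<and> 0 < s \<and> s < \<eta> \<and> regular w e' s \<and> H w e' s = 0 \<and>
      signs_agree wall_quads (tuple w e' s)" if \<eta>: "\<eta> > 0" for \<eta>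
  proof -
    have "\<forall>\<^sub>F w in at_right 0. \<bar>balance w - e\<bar> < \<eta> / 2"
      using tendstoD[OF bal(1), of "\<eta> / 2"] that by (simp add: dist_real_def)
    moreover have "\<forall>\<^sub>F w in at_right (0::real). w < \<eta>" by (rule order_tendstoD(2)[OF tendsto_ident_at that])
    moreover have "\<forall>\<^sub>F w in at_right (0::real). 0 < w" by (simp add: eventually_at_right_less)
    ultimately have "\<forall>\<^sub>F w in at_right 0. \<bar>balance w - e\<bar> < \<eta> / 2 \<and> w < \<eta> \<and> 0 < w \<and> regular w (balance w) 0 \<and> 0 < 2 * balance w - t w \<and>
      signs_agree wall_quads (tuple w (balance w) 0)"
      using bal(2) by eventually_elim blast
    then obtain w where w: "\<bar>balance w - e\<bar> < \<eta> / 2" "w < \<eta>" "0 < w" "regular w (balance w) 0" "0 < 2 * balance w - t w"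
      "signs_agree wall_quads (tuple w (balance w) 0)"
      using eventually_happens[of _ "at_right (0::real)"] by (auto simp: trivial_limit_at_right_real)
    obtain e' s where "\<bar>e' - balance w\<bar> < \<eta> / 2" "0 < s" "s < \<eta> / 2" "regular w e' s" "H w e' s = 0"
      "signs_agree wall_quads (tuple w e' s)"
      by (rule solve_closing[OF l(1) w(3) _ w(4-6), of "\<eta> / 2"]) (use \<eta> in auto)
    moreover from this(1) w(1) have "\<bar>e' - e\<bar> < \<eta>" by linarith
    ultimately have "0 < w \<and> w < \<eta> \<and> \<bar>e' - e\<bar> < \<eta> \<and> 0 < s \<and> s < \<eta> \<and> regular w e' s \<and> H w e' s = 0 \<and>
      signs_agree wall_quads (tuple w e' s)" using w \<eta> by auto
    then show ?thesis by blast
  qed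
  then have "\<forall>n. \<exists>w e' s. 0 < w \<and> w < inverse (real (Suc n)) \<and> \<bar>e' - e\<bar> < inverse (real (Suc n)) \<and> 0 < s \<and> s < inverse (real (Suc n)) \<and> regular w e' s \<and> H w e' s = 0 \<and>
      signs_agree wall_quads (tuple w e' s)" by simp
  then obtain w e' s where q: "\<And>n. 0 < w n" "\<And>n. w n < inverse (real (Suc n))" "\<And>n. \<bar>e' n - e\<bar> < inverse (real (Suc n))"
    "\<And>n. 0 < s n" "\<And>n. s n < inverse (real (Suc n))" "\<And>n. regular (w n) (e' n) (s n)" "\<And>n. H (w n) (e' n) (s n) = 0"
    "\<And>n. signs_agree wall_quads (tuple (w n) (e' n) (s n))" by metis
  have inv0: "(\<lambda>n. inverse (real (Suc n))) \<longlonglongrightarrow> 0" by (rule LIMSEQ_inverse_real_of_nat)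
  have "norm (w n) \<le> inverse (real (Suc n))" "norm (s n) \<le> inverse (real (Suc n))"
    "norm (e' n - e) \<le> inverse (real (Suc n))" for n
    using q(1,2,3,4,5)[of n] by (simp_all add: less_imp_le)
  then have w: "w \<longlonglongrightarrow> 0" and s: "s \<longlonglongrightarrow> 0" and "(\<lambda>n. e' n - e) \<longlonglongrightarrow> 0"
    by (auto intro!: Lim_null_comparison[OF always_eventually inv0])
  from this(3) have e': "e' \<longlonglongrightarrow> e" by (simp add: LIM_zero_iff)
  note sv = special_values[OF e(1) n]
  note lim = w e' s sv(1)
  have lt: "(\<lambda>n. tuple (w n) (e' n) (s n)) \<longlonglongrightarrow> special_tuple (Complex e f)"
    using tendsto_tuple[OF lim] unfolding sv .
  have lm: "(\<lambda>n. mark (w n) (e' n) (s n) a) \<longlonglongrightarrow> special_marking (Complex e f) a" for a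
    using tendsto_mark[OF lim] unfolding sv .
  have lL: "(\<lambda>n. (2, 2 * Complex (e' n) f)) \<longlonglongrightarrow> (2, 2 * Complex e f)"
    by (intro tendsto_intros e')
  have lE1: "(\<lambda>n. edge1 (2, 2 * Complex (e' n) f) (mark (w n) (e' n) (s n)) a) \<longlonglongrightarrow>
      edge1 (2, 2 * Complex e f) (special_marking (Complex e f)) a"
    and lE3: "(\<lambda>n. edge3 (2, 2 * Complex (e' n) f) (mark (w n) (e' n) (s n)) a) \<longlonglongrightarrow>
      edge3 (2, 2 * Complex e f) (special_marking (Complex e f)) a" for a
    by (rule tendsto_edges[OF lL lm])+
  define \<kappa> where "\<kappa> = (e\<^sup>2 + f\<^sup>2) / f"
  define v where "v = (e\<^sup>2 + f\<^sup>2 - 2 * e) / (2 * f)"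
  have v: "v > 0" using n f by (simp add: v_def)
  have sp: "special_tuple (Complex e f) = special (e / f) v (1/2 - e) (sqrt (2 * e)) 0 0 0"
    by (simp add: special_tuple_def v_def)
  have signs: "signs_agree stable_quads (special_tuple (Complex e f))"
    "signs_agree floor_quads (special (e / f) v (1/2 - e) (sqrt (2 * e)) 1 (- 1) 0)"
    unfolding sp using special_signs[OF v, of "1/2 - e" "sqrt (2 * e)"] e by auto
  \<comment> \<open>The tents with the floor heights \<open>s\<close>, \<open>- s\<close>, 0
    stretched to 1, -1, 0: the floor volumes of their limit do not vanish.\<close>
  define floor where "floor n = sym_tuple (point (X0 (w n) (e' n) (s n)) (Y0 (w n) (e' n) (s n)) (A (w n) (e' n) + s n))
      (point (X1 (w n) (e' n) (s n)) (Y1 (w n) (e' n) (s n)) 1) (point 0 (y2 (w n) (e' n) (s n)) (- 1))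
      (point (- k (s n)) (y3 (w n) (e' n) (s n)) 0)" for n
  have "floor \<longlonglongrightarrow> sym_tuple (point (X0 0 e 0) (Y0 0 e 0) (A 0 e + 0)) (point (X1 0 e 0) (Y1 0 e 0) 1)
      (point 0 (y2 0 e 0) (- 1)) (point (- k 0) (y3 0 e 0) 0)"
    unfolding floor_def
    by (intro tendsto_intros tendsto_X0[OF lim] tendsto_Y0[OF lim] tendsto_A[OF lim] tendsto_X1[OF lim] tendsto_Y1[OF lim]
      tendsto_y2[OF lim] tendsto_y3[OF lim] tendsto_k[OF lim] s)
  moreover have "sym_tuple (point (X0 0 e 0) (Y0 0 e 0) (A 0 e + 0)) (point (X1 0 e 0) (Y1 0 e 0) 1)
      (point 0 (y2 0 e 0) (- 1)) (point (- k 0) (y3 0 e 0) 0) = special (e / f) v (1/2 - e) (sqrt (2 * e)) 1 (- 1) 0"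
    using sv(2) unfolding sp tuple_def special_def sym_tuple_eq_iff point_eq_iff by simp
  ultimately have "\<forall>\<^sub>F n in sequentially. signs_agree floor_quads (floor n)"
    using signs_agree_stable[OF signs(2) _ quads_nonzero(2)] by simp
  moreover have "\<forall>\<^sub>F n in sequentially. signs_agree stable_quads (tuple (w n) (e' n) (s n))"
    by (rule signs_agree_stable[OF signs(1) lt quads_nonzero(1)])
  moreover have "\<forall>\<^sub>F n in sequentially. \<forall>a. \<bar>Im (edge1 (2, 2 * Complex (e' n) f) (mark (w n) (e' n) (s n)) a)\<bar>
      < - (\<kappa> * Re (edge1 (2, 2 * Complex (e' n) f) (mark (w n) (e' n) (s n)) a))"
  proof (rule eventually_all_finite)
    fix a
    show "\<forall>\<^sub>F n in sequentially. \<bar>Im (edge1 (2, 2 * Complex (e' n) f) (mark (w n) (e' n) (s n)) a)\<bar>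
      < - (\<kappa> * Re (edge1 (2, 2 * Complex (e' n) f) (mark (w n) (e' n) (s n)) a))"
      by (rule tendsto_eventually_less[OF _ _ special_cone(1)[OF e f n, folded \<kappa>_def, of a]]) (intro tendsto_intros lE1)+
  qed
  moreover have "\<forall>\<^sub>F n in sequentially. \<forall>a. \<kappa> * \<bar>Re (edge3 (2, 2 * Complex (e' n) f) (mark (w n) (e' n) (s n)) a)\<bar>
      < Im (edge3 (2, 2 * Complex (e' n) f) (mark (w n) (e' n) (s n)) a)"
  proof (rule eventually_all_finite)
    fix a
    show "\<forall>\<^sub>F n in sequentially. \<kappa> * \<bar>Re (edge3 (2, 2 * Complex (e' n) f) (mark (w n) (e' n) (s n)) a)\<bar>
      < Im (edge3 (2, 2 * Complex (e' n) f) (mark (w n) (e' n) (s n)) a)"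
      by (rule tendsto_eventually_less[OF _ _ special_cone(2)[OF e f n, folded \<kappa>_def, of a]]) (intro tendsto_intros lE3)+
  qed
  ultimately have "\<forall>\<^sub>F n in sequentially. tiled (2, 2 * Complex (e' n) f) (mark (w n) (e' n) (s n)) (tuple (w n) (e' n) (s n)) \<kappa>
      \<and> pup_tent (tuple (w n) (e' n) (s n))"
  proof eventually_elim
    case (elim n)
    have "\<kappa> > 0" using e f by (simp add: \<kappa>_def add_nonneg_pos)
    then have tiled: "tiled (2, 2 * Complex (e' n) f) (mark (w n) (e' n) (s n)) (tuple (w n) (e' n) (s n)) \<kappa>"
      using elim(3,4) f by unfold_locales (auto simp: tuple_lengths[OF q(6,7)] oriented_basis_def)
    have "signs_agree floor_quads (tuple (w n) (e' n) (s n))"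
      using elim(1) unfolding floor_def tuple_def by (rule iffD2[OF floor_signs_scale[OF q(4)]])
    then have "pup_chirotope (tuple (w n) (e' n) (s n))"
      using elim(2) q(8) by (simp add: pup_chirotope_iff)
    then interpret pup_tuple "tuple (w n) (e' n) (s n)"
      by unfold_locales (simp_all add: tuple_def sym_tuple_symmetric)
    show ?case using tiled pup_tent[OF tiled] ..
  qed
  then obtain m where m: "\<And>n. tiled (2, 2 * Complex (e' (n + m)) f) (mark (w (n + m)) (e' (n + m)) (s (n + m))) (tuple (w (n + m)) (e' (n + m)) (s (n + m))) \<kappa>
      \<and> pup_tent (tuple (w (n + m)) (e' (n + m)) (s (n + m)))"
    unfolding eventually_sequentially by (metis le_add2)
  have lc: "(\<lambda>n. Complex (e' n) f) \<longlonglongrightarrow> Complex e f" by (intro tendsto_intros e')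
  show ?thesis
    unfolding good_limit_def
    by (rule exI[of _ "\<lambda>n. Complex (e' (n + m)) f"], rule exI[of _ "\<lambda>n. mark (w (n + m)) (e' (n + m)) (s (n + m))"],
      rule exI[of _ "\<lambda>n. tuple (w (n + m)) (e' (n + m)) (s (n + m))"], rule exI[of _ "\<lambda>_. \<kappa>"], intro conjI allI)
      (use m in \<open>auto intro!: LIMSEQ_ignore_initial_segment lc lt lm\<close>)
qed

section \<open>From the interior of the domain to its boundary\<close>

lemma tendsto_special_tuple:
  assumes "(\<tau>s \<longlongrightarrow> \<tau>) F" "Im \<tau> > 0"
  shows "((\<lambda>n. special_tuple (\<tau>s n)) \<longlongrightarrow> special_tuple \<tau>) F"
  unfolding special_tuple_def special_def by (intro tendsto_intros assms) (use assms(2) in auto)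

lemma tendsto_special_marking:
  assumes "(\<tau>s \<longlongrightarrow> \<tau>) F" "Im \<tau> > 0"
  shows "((\<lambda>n. special_marking (\<tau>s n) a) \<longlongrightarrow> special_marking \<tau> a) F"
  unfolding special_marking_def by (intro tendsto_marking tendsto_intros assms) (use assms(2) in auto)

text \<open>A metric form of \<open>good_limit\<close>, in which limits of limits reduce to the
  triangle inequality.\<close>

definition approximable :: "real \<Rightarrow> complex \<Rightarrow> bool" where
  "approximable \<eta> \<tau> \<longleftrightarrow> (\<exists>\<tau>' \<zeta> p f. tiled (2, 2 * \<tau>') \<zeta> p f \<and> pup_tent p \<and> dist \<tau>' \<tau> < \<eta> \<and>
     (\<forall>a. dist (\<zeta> a) (special_marking \<tau> a) < \<eta>) \<and> dist p (special_tuple \<tau>) < \<eta>)"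

lemma good_limit_iff: "good_limit \<tau> \<longleftrightarrow> (\<forall>\<eta>>0. approximable \<eta> \<tau>)"
proof
  assume "good_limit \<tau>"
  then obtain \<tau>s \<zeta>s ps fs where *: "\<And>n::nat. tiled (2, 2 * \<tau>s n) (\<zeta>s n) (ps n) (fs n)" "\<And>n. pup_tent (ps n)"
    "\<tau>s \<longlonglongrightarrow> \<tau>" "\<And>a. (\<lambda>n. \<zeta>s n a) \<longlonglongrightarrow> special_marking \<tau> a" "ps \<longlonglongrightarrow> special_tuple \<tau>"
    unfolding good_limit_def by blast
  have "approximable \<eta> \<tau>" if \<eta>: "\<eta> > 0" for \<eta>
  proof -
    have "\<forall>\<^sub>F n in sequentially. dist (\<tau>s n) \<tau> < \<eta>" using tendstoD[OF *(3) \<eta>] .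
    moreover have "\<forall>\<^sub>F n in sequentially. \<forall>a. dist (\<zeta>s n a) (special_marking \<tau> a) < \<eta>"
      using tendstoD[OF *(4) \<eta>] by (intro eventually_all_finite)
    moreover have "\<forall>\<^sub>F n in sequentially. dist (ps n) (special_tuple \<tau>) < \<eta>" using tendstoD[OF *(5) \<eta>] .
    ultimately have "\<forall>\<^sub>F n in sequentially. dist (\<tau>s n) \<tau> < \<eta> \<and> (\<forall>a. dist (\<zeta>s n a) (special_marking \<tau> a) < \<eta>) \<and>
        dist (ps n) (special_tuple \<tau>) < \<eta>"
      by eventually_elim blast
    then obtain n where "dist (\<tau>s n) \<tau> < \<eta>" "\<forall>a. dist (\<zeta>s n a) (special_marking \<tau> a) < \<eta>" "dist (ps n) (special_tuple \<tau>) < \<eta>"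
      using eventually_happens[of _ sequentially] by auto
    then show ?thesis unfolding approximable_def using *(1,2) by blast
  qed
  then show "\<forall>\<eta>>0. approximable \<eta> \<tau>" by blast
next
  assume "\<forall>\<eta>>0. approximable \<eta> \<tau>"
  then have "\<forall>n. approximable (inverse (real (Suc n))) \<tau>" by simp
  then obtain \<tau>s \<zeta>s ps fs where *: "\<And>n. tiled (2, 2 * \<tau>s n) (\<zeta>s n) (ps n) (fs n)" "\<And>n. pup_tent (ps n)"
    "\<And>n. dist (\<tau>s n) \<tau> < inverse (real (Suc n))" "\<And>n a. dist (\<zeta>s n a) (special_marking \<tau> a) < inverse (real (Suc n))"
    "\<And>n. dist (ps n) (special_tuple \<tau>) < inverse (real (Suc n))"
    unfolding approximable_def by metis
  have lim: "x \<longlonglongrightarrow> y" if "\<And>n. dist (x n) y < inverse (real (Suc n))" for x and y :: "'a::real_normed_vector"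
    by (rule Lim_transform_bound[OF always_eventually LIMSEQ_inverse_real_of_nat, THEN LIM_zero_cancel])
      (use that in \<open>auto simp: dist_norm less_imp_le\<close>)
  show "good_limit \<tau>"
    unfolding good_limit_def using *(1,2) lim[OF *(3)] lim[OF *(4)] lim[OF *(5)] by blast
qed

lemma good_limit_closed:
  assumes "\<And>n::nat. good_limit (\<tau>s n)" "\<tau>s \<longlonglongrightarrow> \<tau>" "Im \<tau> > 0"
  shows "good_limit \<tau>"
  unfolding good_limit_iff
proof (intro allI impI)
  fix \<eta> :: real assume "\<eta> > 0"
  then have \<eta>: "\<eta> / 2 > 0" by simp
  have "\<forall>\<^sub>F n in sequentially. dist (\<tau>s n) \<tau> < \<eta> / 2" using tendstoD[OF assms(2) \<eta>] .
  moreover have "\<forall>\<^sub>F n in sequentially. \<forall>a. dist (special_marking (\<tau>s n) a) (special_marking \<tau> a) < \<eta> / 2"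
    using tendstoD[OF tendsto_special_marking[OF assms(2,3)] \<eta>] by (intro eventually_all_finite)
  moreover have "\<forall>\<^sub>F n in sequentially. dist (special_tuple (\<tau>s n)) (special_tuple \<tau>) < \<eta> / 2"
    using tendstoD[OF tendsto_special_tuple[OF assms(2,3)] \<eta>] .
  ultimately have "\<forall>\<^sub>F n in sequentially. dist (\<tau>s n) \<tau> < \<eta> / 2 \<and> (\<forall>a. dist (special_marking (\<tau>s n) a) (special_marking \<tau> a) < \<eta> / 2) \<and>
      dist (special_tuple (\<tau>s n)) (special_tuple \<tau>) < \<eta> / 2"
    by eventually_elim blast
  then obtain n where n: "dist (\<tau>s n) \<tau> < \<eta> / 2" "\<And>a. dist (special_marking (\<tau>s n) a) (special_marking \<tau> a) < \<eta> / 2"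
    "dist (special_tuple (\<tau>s n)) (special_tuple \<tau>) < \<eta> / 2"
    using eventually_happens[of _ sequentially] by auto
  obtain \<tau>' \<zeta> p f where "tiled (2, 2 * \<tau>') \<zeta> p f" "pup_tent p" "dist \<tau>' (\<tau>s n) < \<eta> / 2"
    "\<And>a. dist (\<zeta> a) (special_marking (\<tau>s n) a) < \<eta> / 2" "dist p (special_tuple (\<tau>s n)) < \<eta> / 2"
    using assms(1)[of n] \<eta> unfolding good_limit_iff approximable_def by blast
  with n show "approximable \<eta> \<tau>"
    unfolding approximable_def by (blast intro: dist_triangle_half_r[OF _ ] dist_triangle_half_l dist_commute_lessI)
qed

lemma good_limit_bicusped:
  assumes "\<tau> \<in> bicusped_domain"
  shows "good_limit \<tau>"
proof -
  define x y where "x = Re \<tau>" and "y = Im \<tau>"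
  have \<tau>: "y > 0" "0 \<le> x" "x \<le> 1/2" "2 * x \<le> x\<^sup>2 + y\<^sup>2"
    using assms by (simp_all add: bicusped_domain_def x_def y_def)
  define \<delta> where "\<delta> n = inverse (real (Suc (Suc n)))" for n
  have \<delta>: "0 < \<delta> n" "\<delta> n < 1" for n by (simp_all add: \<delta>_def inverse_less_1_iff)
  have \<delta>0: "\<delta> \<longlonglongrightarrow> 0" unfolding \<delta>_def by (rule LIMSEQ_Suc[OF LIMSEQ_inverse_real_of_nat])
  \<comment> \<open>Moves the point towards the line with real part 1/4 and upwards. The square of
    the imaginary part grows by at least \<open>2 * \<delta> n\<close>, whereas
    \<open>e\<^sup>2 - 2 * e\<close> drops by at most half of \<open>\<delta> n\<close>, so the
    point is interior.\<close>
  define e f where "e n = x + (1/4 - x) * \<delta> n" and "f n = y + \<delta> n / y" for n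
  show ?thesis
  proof (rule good_limit_closed)
    show "good_limit (Complex (e n) (f n))" for n
    proof (rule good_limit_interior)
      define P where "P = x * (1 - \<delta> n)"
      have "0 \<le> P" "P \<le> 1/2 * (1 - \<delta> n)"
        unfolding P_def using \<tau> \<delta>[of n] by (auto intro!: mult_right_mono)
      moreover have "e n = P + \<delta> n / 4" by (simp add: e_def P_def algebra_simps)
      ultimately show e: "0 < e n" "e n < 1/2" using \<delta>[of n] by (simp_all add: field_simps)
      show "0 < f n" using \<tau> \<delta>[of n] by (simp add: f_def add_pos_pos)
      have "(f n)\<^sup>2 = y\<^sup>2 + 2 * \<delta> n + (\<delta> n / y)\<^sup>2" using \<tau> by (simp add: f_def power2_sum)
      then have f: "y\<^sup>2 + 2 * \<delta> n \<le> (f n)\<^sup>2" by simp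
      have "\<bar>(e n - x) * (2 - e n - x)\<bar> \<le> \<delta> n / 4 * 2"
        unfolding abs_mult
      proof (rule mult_mono)
        have "\<bar>1/4 - x\<bar> \<le> 1/4" using \<tau> by (simp add: abs_if)
        then have "\<bar>1/4 - x\<bar> * \<delta> n \<le> 1/4 * \<delta> n" using \<delta>[of n] by (intro mult_right_mono) auto
        then show "\<bar>e n - x\<bar> \<le> \<delta> n / 4" using \<delta>[of n] by (simp add: e_def abs_mult)
      qed (use e \<tau> \<delta>[of n] in auto)
      moreover have "(e n)\<^sup>2 - 2 * e n = x\<^sup>2 - 2 * x - (e n - x) * (2 - e n - x)" by (simp add: power2_eq_square algebra_simps)
      ultimately show "2 * e n < (e n)\<^sup>2 + (f n)\<^sup>2" using f \<tau>(4) \<delta>[of n] by (simp add: abs_le_iff)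
    qed
    have "e \<longlonglongrightarrow> x + (1/4 - x) * 0" "f \<longlonglongrightarrow> y + 0 / y"
      unfolding e_def f_def by (intro tendsto_intros \<delta>0; use \<tau> in simp)+
    then have "(\<lambda>n. Complex (e n) (f n)) \<longlonglongrightarrow> Complex x y" by (intro tendsto_Complex) simp_all
    then show "(\<lambda>n. Complex (e n) (f n)) \<longlonglongrightarrow> \<tau>" by (simp add: x_def y_def)
    show "Im \<tau> > 0" using \<tau>(1) by (simp add: y_def)
  qed
qed

definition folded_tent :: "complex \<Rightarrow> basis \<times> (complex set \<Rightarrow> real^3)" where
  "folded_tent \<tau> = ((2, 2 * \<tau>), flat_map.torus_map (2, 2 * \<tau>) (special_marking \<tau>) (special_tuple \<tau>))"

lemma folded_tent_gracefully_immersed: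
  assumes "\<tau> \<in> bicusped_domain"
  shows "gracefully_immersed (folded_tent \<tau>)" "represents (folded_tent \<tau>) (similarity_class (special_tuple \<tau>))"
proof -
  obtain \<tau>s \<zeta>s ps fs where *: "\<And>n::nat. tiled (2, 2 * \<tau>s n) (\<zeta>s n) (ps n) (fs n)" "\<And>n. pup_tent (ps n)"
    "\<tau>s \<longlonglongrightarrow> \<tau>" "\<And>a. (\<lambda>n. \<zeta>s n a) \<longlonglongrightarrow> special_marking \<tau> a" "ps \<longlonglongrightarrow> special_tuple \<tau>"
    using good_limit_bicusped[OF assms] unfolding good_limit_def by blast
  have ob: "oriented_basis (2, 2 * \<tau>)"
    using assms by (simp add: oriented_basis_def bicusped_domain_def)
  have lims: "(\<lambda>n. fst (2, 2 * \<tau>s n)) \<longlonglongrightarrow> fst (2, 2 * \<tau>)" "(\<lambda>n. snd (2, 2 * \<tau>s n)) \<longlonglongrightarrow> snd (2, 2 * \<tau>)"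
    unfolding fst_conv snd_conv by (intro tendsto_intros *(3))+
  note a = limit_of_tiled[where Ls = "\<lambda>n. (2, 2 * \<tau>s n)", OF *(1,2) ob lims *(4,5)]
  show "gracefully_immersed (folded_tent \<tau>)"
    unfolding folded_tent_def by (rule gracefully_immersed_limit[OF a])
  show "represents (folded_tent \<tau>) (similarity_class (special_tuple \<tau>))"
    unfolding folded_tent_def represents_def split_conv using a(2) *(5) by blast
qed

lemma tuple_limit:
  assumes "\<tau> \<in> bicusped_domain"
  obtains ps where "\<And>n::nat. pup_tent (ps n)" "ps \<longlonglongrightarrow> special_tuple \<tau>"
  using good_limit_bicusped[OF assms] unfolding good_limit_def by blast

section \<open>The family inside the space of similarity classes\<close>

lemma similarity_id: "similarity (\<lambda>x. x)"
  unfolding similarity_def by (intro exI[of _ 1]) simp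

lemma similarity_class_eqD:
  assumes "similarity_class p = similarity_class q"
  obtains r where "r > 0" "\<And>i j. dist (vec_nth p i) (vec_nth p j) = r * dist (vec_nth q i) (vec_nth q j)"
proof -
  have "p \<in> similarity_class p" unfolding similarity_class_def using similarity_id by force
  then obtain f where "similarity f" "p = (\<chi> i. f (vec_nth q i))" using assms by (auto simp: similarity_class_def)
  then show ?thesis using that unfolding similarity_def by auto
qed

text \<open>Equality in the triangle inequality puts \<open>b\<close> on the segment, at equal
  distances from both ends.\<close>

lemma dist_midpoint_unique:
  fixes a b c :: "'a::real_inner"
  assumes "dist a b = dist a c / 2" "dist b c = dist a c / 2"
  shows "b = midpoint a c"
proof (cases "a = c")
  case False
  have "dist a c = dist a b + dist b c" using assms by simp
  then have "norm (a - b) *\<^sub>R (b - c) = norm (b - c) *\<^sub>R (a - b)" by (simp add: dist_triangle_eq)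
  moreover have "dist b c \<noteq> 0" "dist a b = dist b c" unfolding assms using False by simp_all
  then have "norm (a - b) = norm (b - c)" "norm (b - c) \<noteq> 0" by (simp_all only: dist_norm not_False_eq_True)
  ultimately have "b - c = a - b" by simp
  then have "a + c = b + b" by (simp add: algebra_simps)
  then show ?thesis by (metis midpoint_eq_iff)
qed (use assms in simp)

lemma special_dist:
  fixes \<tau>
  defines "e \<equiv> Re \<tau>" and "f \<equiv> Im \<tau>" and "p \<equiv> special_tuple \<tau>"
  defines "h \<equiv> sqrt (1 + (e / f)\<^sup>2)"
  shows "dist (vec_nth p 1) (vec_nth p 3) = h" "dist (vec_nth p 1) (vec_nth p 2) = h / 2" "dist (vec_nth p 2) (vec_nth p 3) = h / 2"
    "dist (vec_nth p 0) (vec_nth p 7) = \<bar>1 - 2 * e\<bar> * h" "dist (vec_nth p 1) (vec_nth p 4) = \<bar>e\<^sup>2 + f\<^sup>2 - 2 * e\<bar> / \<bar>f\<bar>"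
proof -
  have d: "dist (point a b c) (point a' b' c) = sqrt ((a - a')\<^sup>2 + (b - b')\<^sup>2)" for a b c a' b'
    by (simp add: dist_vec_def L2_set_def sum_3 dist_real_def)
  have s: "sqrt (t\<^sup>2 + (t * u)\<^sup>2) = \<bar>t\<bar> * sqrt (1 + u\<^sup>2)" for t u :: real
  proof -
    have "t\<^sup>2 + (t * u)\<^sup>2 = t\<^sup>2 * (1 + u\<^sup>2)" by (simp add: power_mult_distrib distrib_left)
    then show ?thesis by (simp add: real_sqrt_mult)
  qed
  show "dist (vec_nth p 1) (vec_nth p 3) = h"
    using s[of 1 "- e / f"] by (simp add: p_def special_tuple_def special_def sym_tuple_nth d h_def e_def f_def)
  have "sqrt ((1 / 2)\<^sup>2 + (e / f / 2)\<^sup>2) = sqrt ((1 + (e / f)\<^sup>2) / 2\<^sup>2)"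
    by (simp add: power_divide add_divide_distrib)
  also have "\<dots> = h / 2" by (simp add: real_sqrt_divide h_def)
  finally have half: "sqrt ((1 / 2)\<^sup>2 + (e / f / 2)\<^sup>2) = h / 2" .
  show "dist (vec_nth p 1) (vec_nth p 2) = h / 2" "dist (vec_nth p 2) (vec_nth p 3) = h / 2"
    unfolding half[symmetric] by (simp_all add: p_def special_tuple_def special_def sym_tuple_nth d e_def f_def)
  show "dist (vec_nth p 0) (vec_nth p 7) = \<bar>1 - 2 * e\<bar> * h"
    using s[of "2 * e - 1" "- e / f"]
    by (simp add: p_def special_tuple_def special_def sym_tuple_nth d h_def e_def f_def algebra_simps abs_minus_commute)
  show "dist (vec_nth p 1) (vec_nth p 4) = \<bar>e\<^sup>2 + f\<^sup>2 - 2 * e\<bar> / \<bar>f\<bar>"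
    by (simp add: p_def special_tuple_def special_def sym_tuple_nth d e_def f_def abs_div abs_minus_commute[of "2 * Re \<tau>"])
qed

text \<open>
  Recovers \<open>\<tau> = e + i f\<close> from ratios of distances: with \<open>n\<^sup>2 = e\<^sup>2 + f\<^sup>2\<close> the ratio \<open>b\<close> is \<open>(n\<^sup>2 - 2 e) / n\<close>, a
  quadratic equation for \<open>n\<close>.
\<close>

definition shape :: "real^3^8 \<Rightarrow> complex" where
  "shape p = (let d = dist (vec_nth p 1) (vec_nth p 3); e = (1 - dist (vec_nth p 0) (vec_nth p 7) / d) / 2; b = dist (vec_nth p 1) (vec_nth p 4) / d
     in Complex e (sqrt (((b + sqrt (b\<^sup>2 + 8 * e)) / 2)\<^sup>2 - e\<^sup>2)))"

lemma shape_special: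
  assumes "\<tau> \<in> bicusped_domain"
  shows "shape (special_tuple \<tau>) = \<tau>"
proof -
  define e f where "e = Re \<tau>" and "f = Im \<tau>"
  have \<tau>: "f > 0" "0 \<le> e" "e \<le> 1/2" "0 \<le> e\<^sup>2 + f\<^sup>2 - 2 * e"
    using assms by (simp_all add: bicusped_domain_def e_def f_def)
  define n where "n = sqrt (e\<^sup>2 + f\<^sup>2)"
  have n: "n > 0" "n\<^sup>2 = e\<^sup>2 + f\<^sup>2" using \<tau> by (simp_all add: n_def add_nonneg_pos)
  define h where "h = sqrt (1 + (e / f)\<^sup>2)"
  have "1 + (e / f)\<^sup>2 = (n / f)\<^sup>2" using \<tau> by (simp add: power_divide n field_simps)
  then have h: "h = n / f" using n \<tau> by (simp add: h_def)
  note d = special_dist[of \<tau>, folded e_def f_def, folded h_def]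
  define b where "b = (n\<^sup>2 - 2 * e) / n"
  have b: "dist (vec_nth (special_tuple \<tau>) 1) (vec_nth (special_tuple \<tau>) 4) / h = b"
    unfolding d using \<tau> n by (simp add: h b_def)
  have "1 - dist (vec_nth (special_tuple \<tau>) 0) (vec_nth (special_tuple \<tau>) 7) / h = 2 * e"
    unfolding d using \<tau> n by (simp add: h)
  then have s: "shape (special_tuple \<tau>) = Complex e (sqrt (((b + sqrt (b\<^sup>2 + 8 * e)) / 2)\<^sup>2 - e\<^sup>2))"
    unfolding shape_def Let_def d(1) b by simp
  have "b\<^sup>2 + 8 * e = ((n\<^sup>2 + 2 * e) / n)\<^sup>2"
  proof -
    have "b * n = n\<^sup>2 - 2 * e" using n(1) by (simp add: b_def)
    then have "(b\<^sup>2 + 8 * e) * n\<^sup>2 = (n\<^sup>2 + 2 * e)\<^sup>2" by algebra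
    then show ?thesis using n(1) by (simp add: power_divide eq_divide_eq)
  qed
  then have sq: "sqrt (b\<^sup>2 + 8 * e) = (n\<^sup>2 + 2 * e) / n" using n \<tau> by simp
  have "(b + (n\<^sup>2 + 2 * e) / n) / 2 = n" using n(1) by (simp add: b_def field_simps power2_eq_square)
  then have "(b + sqrt (b\<^sup>2 + 8 * e)) / 2 = n" unfolding sq .
  then show ?thesis unfolding s using n \<tau> by (simp add: e_def f_def)
qed

lemma shape_similarity_class:
  assumes "similarity_class p = similarity_class q"
  shows "shape p = shape q"
proof -
  obtain r where r: "r > 0" "\<And>i j. dist (vec_nth p i) (vec_nth p j) = r * dist (vec_nth q i) (vec_nth q j)"
    using similarity_class_eqD[OF assms] by blast
  show ?thesis using r(1) by (simp add: shape_def r(2) Let_def)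
qed

lemma special_tuple_nonconstant: "special_tuple \<tau> \<in> nonconstant_tuples" "vec_nth (special_tuple \<tau>) 1 \<noteq> vec_nth (special_tuple \<tau>) 3"
proof -
  have "0 < 1 + (Re \<tau> / Im \<tau>)\<^sup>2" by (simp add: add_pos_nonneg)
  then have "0 < dist (vec_nth (special_tuple \<tau>) 1) (vec_nth (special_tuple \<tau>) 3)" unfolding special_dist by simp
  then show "vec_nth (special_tuple \<tau>) 1 \<noteq> vec_nth (special_tuple \<tau>) 3" by auto
  then show "special_tuple \<tau> \<in> nonconstant_tuples" unfolding nonconstant_tuples_def by blast
qed

text \<open>In a special configuration vertex 2 is the midpoint of the edge from 1 to 3.\<close>

lemma special_not_pup_tent: "similarity_class (special_tuple \<tau>) \<notin> pup_tent_space"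
proof
  assume "similarity_class (special_tuple \<tau>) \<in> pup_tent_space"
  then obtain p where p: "pup_tent p" "similarity_class p = similarity_class (special_tuple \<tau>)"
    by (auto simp: pup_tent_space_def)
  obtain r where r: "\<And>i j. dist (vec_nth p i) (vec_nth p j) = r * dist (vec_nth (special_tuple \<tau>) i) (vec_nth (special_tuple \<tau>) j)"
    by (rule similarity_class_eqD[OF p(2)]) (rule that)
  have "vec_nth p 2 = midpoint (vec_nth p 1) (vec_nth p 3)"
    by (rule dist_midpoint_unique) (simp_all add: r special_dist)
  then have eq: "affine_extension p (axis 2 1) = affine_extension p (midpoint (axis 1 1) (axis 3 1))"
    by (simp add: midpoint_def linear_add[OF linear_affine_extension] linear_cmul[OF linear_affine_extension])
  have "{0, 1, 3} \<in> K" "{0, 2, 3} \<in> K" by (auto simp: K_eq)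
  then have "axis 2 1 \<in> realization" "midpoint (axis 1 1) (axis 3 1) \<in> realization"
  proof -
    show "axis 2 1 \<in> realization" if "{0, 2, 3} \<in> K"
      unfolding realization_def using that by (intro UN_I[OF that] hull_inc) auto
    show "midpoint (axis 1 1) (axis 3 1) \<in> realization" if "{0, 1, 3} \<in> K"
      unfolding realization_def by (intro UN_I[OF that]) (rule subsetD[OF _ midpoint_in_closed_segment],
        auto simp: segment_convex_hull intro!: hull_mono)
  qed
  then have "axis 2 1 = (midpoint (axis 1 1) (axis 3 1) :: real^8)"
    by (intro inj_onD[where f = "affine_extension p", OF _ eq]) (use p(1) in \<open>simp_all add: pup_tent_def\<close>)
  moreover have "vec_nth (axis 2 1 :: real^8) 2 = 1" "vec_nth (midpoint (axis 1 1) (axis 3 1) :: real^8) 2 = 0"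
    by (simp_all add: midpoint_def axis_def)
  ultimately show False by simp
qed

lemma special_boundary:
  assumes "\<tau> \<in> bicusped_domain"
  shows "similarity_class (special_tuple \<tau>) \<in> pup_tent_boundary"
proof -
  let ?X = "similarity_class (special_tuple \<tau>)"
  obtain ps where ps: "\<And>n::nat. pup_tent (ps n)" "ps \<longlonglongrightarrow> special_tuple \<tau>"
    using tuple_limit[OF assms] by blast
  have "\<exists>Y. Y \<noteq> ?X \<and> Y \<in> pup_tent_space \<and> Y \<in> U" if U: "openin similarity_space U" "?X \<in> U" for U
  proof -
    obtain T where T: "open T" "{p \<in> nonconstant_tuples. similarity_class p \<in> U} = nonconstant_tuples \<inter> T"
      using U(1) unfolding openin_similarity_space openin_subtopology by auto
    have "special_tuple \<tau> \<in> T" using T(2) U(2) special_tuple_nonconstant(1) by blast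
    then have "\<forall>\<^sub>F n in sequentially. ps n \<in> T" by (rule topological_tendstoD[OF ps(2) T(1)])
    moreover have "\<forall>\<^sub>F n in sequentially. vec_nth (ps n) 1 - vec_nth (ps n) 3 \<noteq> 0"
      by (rule tendsto_imp_eventually_ne[where c = "vec_nth (special_tuple \<tau>) 1 - vec_nth (special_tuple \<tau>) 3"])
        (intro tendsto_intros ps(2), use special_tuple_nonconstant(2) in simp)
    ultimately have "\<forall>\<^sub>F n in sequentially. ps n \<in> T \<and> ps n \<in> nonconstant_tuples"
      by eventually_elim (auto simp: nonconstant_tuples_def)
    then obtain n where "ps n \<in> T" "ps n \<in> nonconstant_tuples"
      using eventually_happens[of _ sequentially] by auto
    then have "similarity_class (ps n) \<in> U" "similarity_class (ps n) \<in> pup_tent_space"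
      using T(2) ps(1) by (auto simp: pup_tent_space_def)
    then show ?thesis using special_not_pup_tent by metis
  qed
  moreover have "?X \<in> topspace similarity_space"
    using special_tuple_nonconstant(1) by (simp add: topspace_similarity_space)
  ultimately have "?X \<in> similarity_space derived_set_of pup_tent_space"
    unfolding in_derived_set_of by blast
  then show ?thesis using special_not_pup_tent by (simp add: pup_tent_boundary_def)
qed

text \<open>An open set, saturated under similarity, on which the denominator of
  \<open>shape\<close> does not vanish.\<close>

definition "edged_tuples = {p :: real^3^8. vec_nth p 1 \<noteq> vec_nth p 3}"

definition "class_shape X = shape (SOME p. similarity_class p = X)"

lemma class_shape: "class_shape (similarity_class p) = shape p"
proof -
  have "similarity_class (SOME q. similarity_class q = similarity_class p) = similarity_class p"
    by (rule someI_ex) blast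
  then show ?thesis unfolding class_shape_def by (rule shape_similarity_class)
qed

lemma continuous_on_shape: "continuous_on edged_tuples shape"
  unfolding shape_def Let_def
  by (intro continuous_intros) (auto simp: edged_tuples_def)

text \<open>A quotient map may fail to restrict to a quotient map on a subspace, but it does
  restrict to one on an open saturated set such as \<open>edged_tuples\<close>. Continuity on the
  image of the domain follows by a further restriction.\<close>

lemma continuous_map_class_shape:
  "continuous_map (subtopology similarity_space (similarity_class ` edged_tuples)) euclidean class_shape"
proof (rule continuous_compose_quotient_map)
  have sub: "edged_tuples \<subseteq> nonconstant_tuples" by (auto simp: edged_tuples_def nonconstant_tuples_def)
  have "p \<in> edged_tuples" if "similarity_class p \<in> similarity_class ` edged_tuples" for p
  proof -
    obtain q where q: "q \<in> edged_tuples" "similarity_class p = similarity_class q" using \<open>similarity_class p \<in> _\<close> by auto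
    obtain r where "r > 0" "dist (vec_nth p 1) (vec_nth p 3) = r * dist (vec_nth q 1) (vec_nth q 3)"
      using similarity_class_eqD[OF q(2)] by metis
    then show ?thesis using q(1) by (auto simp: edged_tuples_def)
  qed
  then have pre: "{p \<in> nonconstant_tuples. similarity_class p \<in> similarity_class ` edged_tuples} = edged_tuples"
    using sub by blast
  have "open edged_tuples"
    unfolding edged_tuples_def by (intro open_Collect_neq continuous_intros)
  then have "openin similarity_space (similarity_class ` edged_tuples)"
    unfolding openin_similarity_space pre using sub by (auto intro: open_openin_trans open_subset)
  then have "quotient_map (subtopology (top_of_set nonconstant_tuples) edged_tuples)
      (subtopology similarity_space (similarity_class ` edged_tuples)) similarity_class"
    by (intro quotient_map_restriction[OF quotient_map_similarity_space]) (use pre in auto)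
  then show "quotient_map (top_of_set edged_tuples) (subtopology similarity_space (similarity_class ` edged_tuples)) similarity_class"
    using sub by (simp add: subtopology_subtopology Int_absorb1)
  have "class_shape \<circ> similarity_class = shape" by (auto simp: class_shape)
  then show "continuous_map (top_of_set edged_tuples) euclidean (class_shape \<circ> similarity_class)"
    using continuous_on_shape by simp
qed

lemma folded_tents_homeomorphic:
  "subtopology similarity_space ((\<lambda>\<tau>. similarity_class (special_tuple \<tau>)) ` bicusped_domain)
     homeomorphic_space top_of_set bicusped_domain"
proof -
  let ?h = "\<lambda>\<tau>. similarity_class (special_tuple \<tau>)"
  have "homeomorphic_maps (top_of_set bicusped_domain) (subtopology similarity_space (?h ` bicusped_domain)) ?h class_shape"
    unfolding homeomorphic_maps_def
  proof (intro conjI ballI)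
    have "continuous_on bicusped_domain special_tuple"
      unfolding continuous_on_def by (intro ballI tendsto_special_tuple tendsto_ident_at) (simp add: bicusped_domain_def)
    then have "continuous_map (top_of_set bicusped_domain) (top_of_set nonconstant_tuples) special_tuple"
      using special_tuple_nonconstant(1) by (simp add: continuous_map_in_subtopology image_subset_iff)
    then have "continuous_map (top_of_set bicusped_domain) similarity_space (similarity_class \<circ> special_tuple)"
      by (rule continuous_map_compose[OF _ quotient_imp_continuous_map[OF quotient_map_similarity_space]])
    then show "continuous_map (top_of_set bicusped_domain) (subtopology similarity_space (?h ` bicusped_domain)) ?h"
      by (auto simp: continuous_map_in_subtopology o_def)
    have "?h ` bicusped_domain \<subseteq> similarity_class ` edged_tuples"
      using special_tuple_nonconstant(2) by (auto simp: edged_tuples_def)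
    then have "continuous_map (subtopology similarity_space (?h ` bicusped_domain)) euclidean class_shape"
      by (rule continuous_map_from_subtopology_mono[OF continuous_map_class_shape])
    then show "continuous_map (subtopology similarity_space (?h ` bicusped_domain)) (top_of_set bicusped_domain) class_shape"
      by (auto simp: continuous_map_in_subtopology class_shape shape_special)
  qed (auto simp: class_shape shape_special)
  then show ?thesis
    using homeomorphic_maps_imp_homeomorphic_space homeomorphic_space_sym by blast
qed

section \<open>The modular group\<close>

lemma modular_denominator_nonzero:
  fixes c d :: int
  assumes "Im z > 0" "c \<noteq> 0 \<or> d \<noteq> 0"
  shows "of_int c * z + of_int d \<noteq> 0"
proof
  assume z: "of_int c * z + of_int d = 0"
  then have "Im (of_int c * z + of_int d) = 0" by simp
  then have "c = 0" using assms(1) by simp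
  then show False using z assms(2) by simp
qed

lemma modular_orbit_subset:
  assumes z: "Im z > 0" and w: "w \<in> modular_orbit z"
  shows "modular_orbit w \<subseteq> modular_orbit z" "z \<in> modular_orbit w"
proof -
  obtain a b c d :: int where w: "w = (of_int a * z + of_int b) / (of_int c * z + of_int d)" and det: "a * d - b * c = 1"
    using w unfolding modular_orbit_def by blast
  have nz: "of_int c * z + of_int d \<noteq> 0" using modular_denominator_nonzero[OF z, of c d] det by (cases "c = 0") auto
  show "modular_orbit w \<subseteq> modular_orbit z"
  proof
    fix u assume "u \<in> modular_orbit w"
    then obtain a' b' c' d' :: int where u: "u = (of_int a' * w + of_int b') / (of_int c' * w + of_int d')" and det': "a' * d' - b' * c' = 1"
      unfolding modular_orbit_def by blast
    have "of_int x * w + of_int y = (of_int (x * a + y * c) * z + of_int (x * b + y * d)) / (of_int c * z + of_int d)" for x y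
      unfolding w using nz by (simp add: field_simps)
    then have "u = (of_int (a' * a + b' * c) * z + of_int (a' * b + b' * d)) / (of_int (c' * a + d' * c) * z + of_int (c' * b + d' * d))"
      unfolding u using nz by simp
    moreover have "(a' * a + b' * c) * (c' * b + d' * d) - (a' * b + b' * d) * (c' * a + d' * c) = 1"
      using det det' by algebra
    ultimately show "u \<in> modular_orbit z" unfolding modular_orbit_def by blast
  qed
  have "of_int (a * d - b * c) = (1::complex)" unfolding det by simp
  then have D: "of_int a * of_int d - of_int b * of_int c = (1::complex)" by simp
  have "of_int d * w + of_int (- b) = z / (of_int c * z + of_int d)" "of_int (- c) * w + of_int a = 1 / (of_int c * z + of_int d)"
    unfolding w using nz D by (simp_all add: field_simps)
  then have "z = (of_int d * w + of_int (- b)) / (of_int (- c) * w + of_int a)" using nz by simp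
  moreover have "d * a - (- b) * (- c) = 1" using det by (simp add: mult.commute)
  ultimately show "z \<in> modular_orbit w" unfolding modular_orbit_def by blast
qed

lemma modular_orbit_upper:
  assumes "Im z > 0" "w \<in> modular_orbit z"
  shows "Im w > 0"
proof -
  obtain a b c d :: int where w: "w = (of_int a * z + of_int b) / (of_int c * z + of_int d)" and det: "a * d - b * c = 1"
    using assms(2) unfolding modular_orbit_def by blast
  have nz: "of_int c * z + of_int d \<noteq> 0" using modular_denominator_nonzero[OF assms(1), of c d] det by (cases "c = 0") auto
  have "of_int (a * d - b * c) = (1::real)" unfolding det by simp
  then have D: "of_int a * of_int d - of_int b * of_int c = (1::real)" by simp
  have "Im w = ((of_int a * of_int d - of_int b * of_int c) * Im z) / (norm (of_int c * z + of_int d))\<^sup>2"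
    unfolding w by (simp add: Im_divide cmod_power2 algebra_simps)
  then show ?thesis using nz assms(1) unfolding D by simp
qed

lemma modular_orbit_eq:
  assumes "Im z > 0" "w \<in> modular_orbit z"
  shows "modular_orbit w = modular_orbit z"
  using modular_orbit_subset[OF assms] modular_orbit_subset(1)[OF modular_orbit_upper[OF assms]] by blast

text \<open>The imaginary part of \<open>(a z + b) / (c z + d)\<close> is largest when \<open>c z + d\<close> is shortest.\<close>

lemma shortest_coprime_pair:
  assumes z: "Im z > 0"
  obtains c d :: int where "coprime c d"
    "\<And>c' d'. coprime c' d' \<Longrightarrow> norm (of_int c * z + of_int d) \<le> norm (of_int c' * z + of_int d')"
proof -
  define N where "N q = norm (of_int (fst q) * z + of_int (snd q))" for q :: "int \<times> int"
  \<comment> \<open>Vectors longer than \<open>N (0, 1) = 1\<close> cannot be shortest, and only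
    finitely many are not longer.\<close>
  define S where "S = {q. coprime (fst q) (snd q) \<and> N q \<le> 1}"
  define A where "A = \<lceil>1 / Im z\<rceil>"
  define B where "B = \<lceil>1 + of_int A * norm z\<rceil>"
  have "S \<subseteq> {- A..A} \<times> {- B..B}"
  proof
    fix q assume q: "q \<in> S"
    obtain c d where cd: "q = (c, d)" by (cases q)
    have n: "norm (of_int c * z + of_int d) \<le> 1" using q by (simp add: S_def N_def cd)
    have "\<bar>of_int c * Im z\<bar> \<le> 1" using abs_Im_le_cmod[of "of_int c * z + of_int d"] n by simp
    then have "\<bar>of_int c\<bar> \<le> 1 / Im z" using z by (simp add: abs_mult field_simps)
    then have c: "\<bar>of_int c\<bar> \<le> (of_int A :: real)" unfolding A_def by linarith
    have "of_int d = (of_int c * z + of_int d) - of_int c * z" by simp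
    then have "norm (of_int d :: complex) \<le> norm (of_int c * z + of_int d) + norm (of_int c * z)"
      by (metis norm_triangle_ineq4)
    also have "\<dots> \<le> 1 + of_int A * norm z" using n c by (intro add_mono) (auto simp: norm_mult intro: mult_right_mono)
    finally have "\<bar>of_int d\<bar> \<le> (of_int B :: real)" unfolding B_def by simp linarith
    with c show "q \<in> {- A..A} \<times> {- B..B}" unfolding cd by (auto simp: abs_le_iff)
  qed
  then have "finite S" by (rule finite_subset) simp
  moreover have "(0, 1) \<in> S" by (simp add: S_def N_def)
  ultimately obtain q where q: "q \<in> S" "\<And>q'. q' \<in> S \<Longrightarrow> N q \<le> N q'"
    using arg_min_if_finite[of S N] by (metis empty_iff linorder_not_less)
  show ?thesis
  proof (rule that[of "fst q" "snd q"])
    fix c' d' :: int assume "coprime c' d'"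
    then show "norm (of_int (fst q) * z + of_int (snd q)) \<le> norm (of_int c' * z + of_int d')"
      using q(1) q(2)[of "(c', d')"] by (cases "N (c', d') \<le> 1") (auto simp: S_def N_def)
  qed (use q in \<open>simp add: S_def\<close>)
qed

text \<open>A shortest pair \<open>(c, d)\<close> is completed to a matrix of determinant 1; adding
  multiples of \<open>(c, d)\<close> to its first row translates the image point by integers. Its
  norm is the quotient of the lengths belonging to the two rows, at least 1 by minimality.\<close>

lemma modular_reduction:
  assumes z: "Im z > 0"
  obtains w where "w \<in> modular_orbit z" "\<bar>Re w\<bar> \<le> 1/2" "1 \<le> norm w"
proof -
  obtain c d :: int where cd: "coprime c d"
    "\<And>c' d'. coprime c' d' \<Longrightarrow> norm (of_int c * z + of_int d) \<le> norm (of_int c' * z + of_int d')"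
    using shortest_coprime_pair[OF z] by blast
  obtain a0 b0 :: int where "a0 * d - b0 * c = 1"
  proof -
    obtain u v where "u * c + v * d = 1" using cd(1) by (metis bezout_int coprime_iff_gcd_eq_1)
    then show ?thesis by (intro that[of v "- u"]) (simp add: algebra_simps)
  qed
  have nz: "of_int c * z + of_int d \<noteq> 0" using modular_denominator_nonzero[OF z, of c d] cd(1) by (cases "c = 0") auto
  define n where "n = - round (Re ((of_int a0 * z + of_int b0) / (of_int c * z + of_int d)))"
  define a b where "a = a0 + n * c" and "b = b0 + n * d"
  have det: "a * d - b * c = 1" using \<open>a0 * d - b0 * c = 1\<close> by (simp add: a_def b_def algebra_simps)
  define w where "w = (of_int a * z + of_int b) / (of_int c * z + of_int d)"
  have "w = (of_int a0 * z + of_int b0) / (of_int c * z + of_int d) + of_int n"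
    unfolding w_def a_def b_def using nz by (simp add: field_simps)
  then have "Re w = Re ((of_int a0 * z + of_int b0) / (of_int c * z + of_int d)) + of_int n" by simp
  then have "\<bar>Re w\<bar> \<le> 1/2"
    using of_int_round_abs_le[of "Re ((of_int a0 * z + of_int b0) / (of_int c * z + of_int d))"] by (simp add: n_def abs_minus_commute)
  moreover have "w \<in> modular_orbit z" unfolding modular_orbit_def w_def using det by blast
  moreover have "1 \<le> norm w"
  proof -
    have "coprime a b"
    proof (rule coprimeI)
      fix k assume "k dvd a" "k dvd b"
      then have "k dvd a * d - b * c" by simp
      then show "is_unit k" using det by simp
    qed
    from cd(2)[OF this] show ?thesis unfolding w_def using nz by (simp add: norm_divide)
  qed
  ultimately show ?thesis using that by blast
qed

text \<open>The right half of the usual fundamental domain lies in the bi-cusped one, and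
  \<open>- 1 / w\<close> carries the left half into it: the line of real part -1/2 goes to the
  circle of radius 1 around 1.\<close>

lemma bicusped_domain_meets_orbits:
  assumes z: "Im z > 0"
  obtains \<tau> where "\<tau> \<in> bicusped_domain" "modular_orbit \<tau> = modular_orbit z"
proof -
  obtain w where w: "w \<in> modular_orbit z" "\<bar>Re w\<bar> \<le> 1/2" "1 \<le> norm w" using modular_reduction[OF z] by blast
  have Im: "Im w > 0" by (rule modular_orbit_upper[OF z w(1)])
  have n: "1 \<le> (Re w)\<^sup>2 + (Im w)\<^sup>2" using w(3) by (simp add: cmod_power2[symmetric])
  show ?thesis
  proof (cases "0 \<le> Re w")
    case True
    then have "w \<in> bicusped_domain" using w(2) n Im by (simp add: bicusped_domain_def)
    then show ?thesis using that modular_orbit_eq[OF z w(1)] by blast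
  next
    case False
    define m where "m = (Re w)\<^sup>2 + (Im w)\<^sup>2"
    have m: "m \<ge> 1" using n by (simp add: m_def)
    have RI: "Re (- 1 / w) = - Re w / m" "Im (- 1 / w) = Im w / m"
      by (simp_all add: Re_divide Im_divide m_def)
    have sq: "(Re (- 1 / w))\<^sup>2 + (Im (- 1 / w))\<^sup>2 = 1 / m"
    proof -
      have "(Re (- 1 / w))\<^sup>2 + (Im (- 1 / w))\<^sup>2 = m / m\<^sup>2" unfolding RI by (simp add: power_divide m_def add_divide_distrib)
      then show ?thesis using m by (simp add: power2_eq_square)
    qed
    have "- Re w \<le> m * (1/2)" using w(2) m by (simp add: abs_le_iff)
    then have "- Re w / m \<le> 1/2" using m by (subst pos_divide_le_eq) linarith+
    then have "Re (- 1 / w) \<le> 1/2" unfolding RI .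
    moreover have "0 \<le> Re (- 1 / w)" "0 < Im (- 1 / w)" unfolding RI using False Im m by (auto simp: divide_nonneg_pos divide_nonpos_pos)
    moreover have "0 \<le> (1 + 2 * Re w) / m" using w(2) m by (simp add: abs_le_iff)
    then have "0 \<le> 1 / m - 2 * Re (- 1 / w)" unfolding RI by (simp add: add_divide_distrib)
    ultimately have "- 1 / w \<in> bicusped_domain" using sq by (simp add: bicusped_domain_def)
    moreover have "- 1 / w = (of_int 0 * w + of_int (- 1)) / (of_int 1 * w + of_int 0)" by simp
    then have "- 1 / w \<in> modular_orbit w" unfolding modular_orbit_def by fastforce
    ultimately show ?thesis using that modular_orbit_eq[OF z w(1)] modular_orbit_eq[OF Im] by metis
  qed
qed

theorem theorem1p6:
  shows "\<exists>G \<subseteq> pup_tent_boundary. \<exists>tent.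
    (\<forall>X\<in>G. gracefully_immersed (tent X) \<and> represents (tent X) X) \<and>
    subtopology similarity_space G homeomorphic_space top_of_set bicusped_domain \<and>
    \<Phi> ` tent ` G = modular_surface"
proof -
  define G where "G = (\<lambda>\<tau>. similarity_class (special_tuple \<tau>)) ` bicusped_domain"
  \<comment> \<open>\<open>class_shape\<close> recovers the parameter from a similarity class, which
    makes the tent a function of the class.\<close>
  define tent where "tent X = folded_tent (class_shape X)" for X
  have tent: "tent (similarity_class (special_tuple \<tau>)) = folded_tent \<tau>" if "\<tau> \<in> bicusped_domain" for \<tau>
    using that by (simp add: tent_def class_shape shape_special)
  have "\<Phi> (folded_tent \<tau>) = modular_orbit \<tau>" for \<tau> by (simp add: \<Phi>_def folded_tent_def)
  then have "\<Phi> ` tent ` G = modular_orbit ` bicusped_domain"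
    unfolding G_def image_image by (intro image_cong) (simp_all add: tent)
  also have "\<dots> = modular_surface"
    unfolding modular_surface_def
  proof
    show "modular_orbit ` bicusped_domain \<subseteq> modular_orbit ` upper_half_plane"
      by (auto simp: bicusped_domain_def upper_half_plane_def)
    show "modular_orbit ` upper_half_plane \<subseteq> modular_orbit ` bicusped_domain"
    proof (rule image_subsetI)
      fix z assume "z \<in> upper_half_plane"
      then have "Im z > 0" by (simp add: upper_half_plane_def)
      then obtain \<tau> where "\<tau> \<in> bicusped_domain" "modular_orbit \<tau> = modular_orbit z"
        by (rule bicusped_domain_meets_orbits)
      then show "modular_orbit z \<in> modular_orbit ` bicusped_domain" by (metis imageI)
    qed
  qed
  finally have "\<Phi> ` tent ` G = modular_surface" .
  moreover have "\<forall>X\<in>G. gracefully_immersed (tent X) \<and> represents (tent X) X"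
    unfolding G_def using folded_tent_gracefully_immersed by (auto simp: tent)
  moreover have "G \<subseteq> pup_tent_boundary" unfolding G_def using special_boundary by blast
  ultimately show ?thesis using folded_tents_homeomorphic unfolding G_def[symmetric] by blast
qed

end
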